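(* TDS and CTDS, restricted to instances whose discount factor is $\lambda=\frac1n$ for a natural number $n\ge 2$, are in PSPACE.
   Context: An instance of TDS consists of a rational discount factor $0<\lambda<1$, a rational target $t$, and rational weights $a,b$; it asks whether there exists an infinite sequence $w\in\{a,b\}^\omega$ with $\sum_{i=0}^\infty w(i)\lambda^i=t$. CTDS additionally takes an $\omega$-regular expression $e$ over $\{a,b\}$ and requires $w$ to belong to the language of $e$. *)

theory Defs
  imports Complex_Main
begin

datatype token = T0 | T1 | TMinus | TSlash | TSep
  | TA | TB | TEmpty | TEps | TPlus | TTimes | TStar | TOmega | TConc | TOPlus

fun tok_code :: "token \<Rightarrow> nat" where
  "tok_code T0 = 1" | "tok_code T1 = 2" | "tok_code TMinus = 3" | "tok_code TSlash = 4"
| "tok_code TSep = 5" | "tok_code TA = 6" | "tok_code TB = 7" | "tok_code TEmpty = 8"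
| "tok_code TEps = 9" | "tok_code TPlus = 10" | "tok_code TTimes = 11" | "tok_code TStar = 12"
| "tok_code TOmega = 13" | "tok_code TConc = 14" | "tok_code TOPlus = 15"

datatype dir = DL | DR | DS

text \<open>States are 0..nst-1 (0 = start, 1 = accept, 2 = reject); tape symbols are
  0..nsym-1 (0 = blank, token t is written as tok_code t).  The tape is one-way infinite.\<close>
record tm =
  nst :: nat
  nsym :: nat
  delta :: "nat \<Rightarrow> nat \<Rightarrow> nat \<times> nat \<times> dir"

definition wf_tm :: "tm \<Rightarrow> bool" where
  "wf_tm M \<longleftrightarrow> nst M \<ge> 3 \<and> nsym M > 15 \<and>
     (\<forall>q<nst M. \<forall>s<nsym M. case delta M q s of (q', s', d) \<Rightarrow> q' < nst M \<and> s' < nsym M)"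

type_synonym config = "nat \<times> (nat \<Rightarrow> nat) \<times> nat"   (* state, tape, head position *)

fun move :: "dir \<Rightarrow> nat \<Rightarrow> nat" where
  "move DL h = h - 1" | "move DR h = h + 1" | "move DS h = h"

definition halting :: "nat \<Rightarrow> bool" where
  "halting q \<longleftrightarrow> q = 1 \<or> q = 2"

definition step :: "tm \<Rightarrow> config \<Rightarrow> config" where
  "step M c = (case c of (q, tp, h) \<Rightarrow>
     if halting q then (q, tp, h)
     else (case delta M q (tp h) of (q', s', d) \<Rightarrow> (q', tp(h := s'), move d h)))"

definition init_config :: "token list \<Rightarrow> config" where
  "init_config w = (0, \<lambda>i. if i < length w then tok_code (w ! i) else 0, 0)"

definition run :: "tm \<Rightarrow> token list \<Rightarrow> nat \<Rightarrow> config" where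
  "run M w t = (step M ^^ t) (init_config w)"

definition decides_in_space :: "tm \<Rightarrow> token list set \<Rightarrow> (nat \<Rightarrow> nat) \<Rightarrow> bool" where
  "decides_in_space M L p \<longleftrightarrow> (\<forall>w.
      (\<exists>t. halting (fst (run M w t))) \<and>
      ((\<exists>t. fst (run M w t) = 1) \<longleftrightarrow> w \<in> L) \<and>
      (\<forall>t. snd (snd (run M w t)) < p (length w)))"

definition in_PSPACE :: "token list set \<Rightarrow> bool" where
  "in_PSPACE L \<longleftrightarrow> (\<exists>M c k. wf_tm M \<and> decides_in_space M L (\<lambda>n. c * (n + 1) ^ k))"

fun nat_enc :: "nat \<Rightarrow> token list" where
  "nat_enc n = (if n < 2 then [if n = 0 then T0 else T1]
                else nat_enc (n div 2) @ [if n mod 2 = 0 then T0 else T1])"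

definition int_enc :: "int \<Rightarrow> token list" where
  "int_enc i = (if i < 0 then TMinus # nat_enc (nat (- i)) else nat_enc (nat i))"

definition rat_enc :: "rat \<Rightarrow> token list" where
  "rat_enc r = (case quotient_of r of (p, q) \<Rightarrow> int_enc p @ [TSlash] @ int_enc q)"

datatype letter = La | Lb

datatype rexp = REmpty | REps | RSym letter | RPlus rexp rexp | RTimes rexp rexp | RStar rexp

datatype oexp = Omega rexp | OConc rexp oexp | OPlus oexp oexp

fun lang :: "rexp \<Rightarrow> letter list set" where
  "lang REmpty = {}"
| "lang REps = {[]}"
| "lang (RSym x) = {[x]}"
| "lang (RPlus r s) = lang r \<union> lang s"
| "lang (RTimes r s) = {u @ v | u v. u \<in> lang r \<and> v \<in> lang s}"
| "lang (RStar r) = {concat ws | ws. set ws \<subseteq> lang r}"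

text \<open>Omega r: infinite concatenations of nonempty words of L(r).\<close>
fun olang :: "oexp \<Rightarrow> (nat \<Rightarrow> letter) set" where
  "olang (Omega r) = {w. \<exists>f. strict_mono f \<and> f 0 = 0 \<and>
        (\<forall>i. map w [f i..<f (Suc i)] \<in> lang r)}"
| "olang (OConc r e) = {w. \<exists>n. map w [0..<n] \<in> lang r \<and> (\<lambda>i. w (n + i)) \<in> olang e}"
| "olang (OPlus e1 e2) = olang e1 \<union> olang e2"

fun rexp_enc :: "rexp \<Rightarrow> token list" where
  "rexp_enc REmpty = [TEmpty]"
| "rexp_enc REps = [TEps]"
| "rexp_enc (RSym La) = [TA]"
| "rexp_enc (RSym Lb) = [TB]"
| "rexp_enc (RPlus r s) = TPlus # rexp_enc r @ rexp_enc s"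
| "rexp_enc (RTimes r s) = TTimes # rexp_enc r @ rexp_enc s"
| "rexp_enc (RStar r) = TStar # rexp_enc r"

fun oexp_enc :: "oexp \<Rightarrow> token list" where
  "oexp_enc (Omega r) = TOmega # rexp_enc r"
| "oexp_enc (OConc r e) = TConc # rexp_enc r @ oexp_enc e"
| "oexp_enc (OPlus e1 e2) = TOPlus # oexp_enc e1 @ oexp_enc e2"

definition wval :: "rat \<Rightarrow> rat \<Rightarrow> letter \<Rightarrow> real" where
  "wval a b x = (case x of La \<Rightarrow> of_rat a | Lb \<Rightarrow> of_rat b)"

definition discounted_sum_is :: "rat \<Rightarrow> rat \<Rightarrow> rat \<Rightarrow> (nat \<Rightarrow> letter) \<Rightarrow> rat \<Rightarrow> bool" where
  "discounted_sum_is lam a b w t \<longleftrightarrow> (\<lambda>i. wval a b (w i) * of_rat lam ^ i) sums of_rat t"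

definition TDS_yes :: "rat \<Rightarrow> rat \<Rightarrow> rat \<Rightarrow> rat \<Rightarrow> bool" where
  "TDS_yes lam t a b \<longleftrightarrow> 0 < lam \<and> lam < 1 \<and> (\<exists>w. discounted_sum_is lam a b w t)"

definition CTDS_yes :: "rat \<Rightarrow> rat \<Rightarrow> rat \<Rightarrow> rat \<Rightarrow> oexp \<Rightarrow> bool" where
  "CTDS_yes lam t a b e \<longleftrightarrow> 0 < lam \<and> lam < 1 \<and>
     (\<exists>w. w \<in> olang e \<and> discounted_sum_is lam a b w t)"

definition TDS_enc :: "rat \<Rightarrow> rat \<Rightarrow> rat \<Rightarrow> rat \<Rightarrow> token list" where
  "TDS_enc lam t a b = rat_enc lam @ [TSep] @ rat_enc t @ [TSep] @ rat_enc a @ [TSep] @ rat_enc b"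

definition CTDS_enc :: "rat \<Rightarrow> rat \<Rightarrow> rat \<Rightarrow> rat \<Rightarrow> oexp \<Rightarrow> token list" where
  "CTDS_enc lam t a b e = TDS_enc lam t a b @ [TSep] @ oexp_enc e"

definition TDS_inv_nat_lang :: "token list set" where
  "TDS_inv_nat_lang = {TDS_enc lam t a b | lam t a b.
      (\<exists>n::nat. n \<ge> 2 \<and> lam = 1 / of_nat n) \<and> TDS_yes lam t a b}"

definition CTDS_inv_nat_lang :: "token list set" where
  "CTDS_inv_nat_lang = {CTDS_enc lam t a b e | lam t a b e.
      (\<exists>n::nat. n \<ge> 2 \<and> lam = 1 / of_nat n) \<and> CTDS_yes lam t a b e}"

end

theory Submission
  imports Defs
begin

text \<open>Only space matters, so a Turing machine may be programmed as a counter machine whose registers are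
  numbers modulo \<open>B = 2 ^ W\<close>: one tape cell holds one bit of every register, and a linear number \<open>W\<close>
  of cells suffices.  Such registers evaluate everything that is built by iteration, in particular bounded
  quantifiers over numbers with linearly many bits.

  For \<open>\<lambda> = 1/n\<close> the target equation becomes \<open>Q * (\<Sum>i | w i = Lb. n ^ - i) = P\<close> with natural
  numbers \<open>P\<close> and \<open>Q\<close>.  Reading the word from the left, the residual of \<open>P\<close> stays in
  \<open>{0..2 Q}\<close> and determines the next letter, except for a single binary choice that a fixed preference
  resolves.  Hence the only nondeterminism is in the automaton of the \<open>\<omega>\<close>-regular expression, and
  that is removed by the subset construction: a witness exists iff the deterministic sequence of pairs (residual, set
  of automaton nodes) reaches a pair from which some accepting node recurs with the same residual.  Pairs have linearly
  many bits, so the search is bounded.\<close>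

section \<open>Counter programs on a Turing machine\<close>

text \<open>The machine model is deterministic, so guessing a run of the automaton would need a
  determinisation argument of Savitch type. It is avoided because residuals evolve deterministically
  and a set of automaton nodes is a bit mask with two bits per input token. Since time is free,
  loops may run up to \<open>B - 1\<close> times, and almost every correctness condition says that
  some number is below \<open>B\<close>. The size of \<open>B\<close> comes from the number of pairs
  in the search. With \<open>Z = 2 ^ L\<close> for a word of length \<open>L\<close>, the encoded
  numbers are below \<open>Z\<close>. After clearing denominators \<open>P\<close> and
  \<open>Q\<close> are differences of sums of two products of four such numbers, hence below
  \<open>2 * Z ^ 4\<close>, and there are at most \<open>(2 * Q + 1) * 2 ^ (2 * L)\<close>, thus at
  most \<open>4 * Z ^ 6\<close>, pairs. The final choice \<open>B = 2 ^ (64 * L)\<close> leaves room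
  for this, for the number that codes the input with four bits per token, and for the five tokens
  that turn an unconstrained instance into a constrained one.\<close>

datatype com = CSkip | CDec nat | CSeq com com | CLoop nat com

text \<open>The only arithmetic primitive is the decrement modulo \<open>B\<close>, because a single
  sweep with borrow implements it. A loop consumes its counter, which ends at 0;
  \<open>wf_com\<close> forbids the body to write it, so it is positive in every round and
  \<open>\<sigma> v - 1\<close> is the same decrement.\<close>

fun exec :: "nat \<Rightarrow> com \<Rightarrow> (nat \<Rightarrow> nat) \<Rightarrow> nat \<Rightarrow> nat" where
  "exec B CSkip \<sigma> = \<sigma>"
| "exec B (CDec v) \<sigma> = \<sigma>(v := (\<sigma> v + B - 1) mod B)"
| "exec B (CSeq c d) \<sigma> = exec B d (exec B c \<sigma>)"
| "exec B (CLoop v c) \<sigma> = ((\<lambda>\<sigma>. exec B c (\<sigma>(v := \<sigma> v - 1))) ^^ \<sigma> v) \<sigma>"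

fun writes :: "com \<Rightarrow> nat set" where
  "writes CSkip = {}"
| "writes (CDec v) = {v}"
| "writes (CSeq c d) = writes c \<union> writes d"
| "writes (CLoop v c) = insert v (writes c)"

fun wf_com :: "nat \<Rightarrow> com \<Rightarrow> bool" where
  "wf_com K CSkip \<longleftrightarrow> True"
| "wf_com K (CDec v) \<longleftrightarrow> v < K"
| "wf_com K (CSeq c d) \<longleftrightarrow> wf_com K c \<and> wf_com K d"
| "wf_com K (CLoop v c) \<longleftrightarrow> v < K \<and> v \<notin> writes c \<and> wf_com K c"

lemma exec_unwritten: "v \<notin> writes c \<Longrightarrow> exec B c \<sigma> v = \<sigma> v"
proof (induction c arbitrary: \<sigma>)
  case (CLoop u c)
  have "((\<lambda>\<sigma>. exec B c (\<sigma>(u := \<sigma> u - 1))) ^^ n) \<sigma> v = \<sigma> v" for n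
    using CLoop by (induction n) auto
  then show ?case by simp
qed auto

lemma exec_less: "0 < B \<Longrightarrow> (\<And>v. \<sigma> v < B) \<Longrightarrow> exec B c \<sigma> v < B"
proof (induction c arbitrary: \<sigma> v)
  case (CLoop u c)
  have "((\<lambda>\<sigma>. exec B c (\<sigma>(u := \<sigma> u - 1))) ^^ n) \<sigma> v < B" for n v
  proof (induction n arbitrary: v)
    case 0 then show ?case using CLoop.prems by simp
  next
    case (Suc n)
    have "((((\<lambda>\<sigma>. exec B c (\<sigma>(u := \<sigma> u - 1))) ^^ n) \<sigma>)(u := x)) w < B" if "x < B" for w x
      using Suc[of w] that unfolding fun_upd_def by auto
    then show ?case using CLoop.IH CLoop.prems Suc by (simp add: less_imp_diff_less)
  qed
  then show ?case by simp
qed auto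

definition reach :: "tm \<Rightarrow> nat \<Rightarrow> config \<Rightarrow> config \<Rightarrow> bool" where
  "reach M W c c' \<longleftrightarrow> (\<exists>t. (step M ^^ t) c = c' \<and> (\<forall>t'\<le>t. snd (snd ((step M ^^ t') c)) \<le> W))"

lemma reach_refl: "snd (snd c) \<le> W \<Longrightarrow> reach M W c c"
  unfolding reach_def by (rule exI[of _ 0]) simp

lemma reach_trans [trans]:
  assumes "reach M W a b" "reach M W b c" shows "reach M W a c"
proof -
  obtain s where s: "(step M ^^ s) a = b" "\<And>t'. t' \<le> s \<Longrightarrow> snd (snd ((step M ^^ t') a)) \<le> W"
    using assms(1) unfolding reach_def by blast
  obtain t where t: "(step M ^^ t) b = c" "\<And>t'. t' \<le> t \<Longrightarrow> snd (snd ((step M ^^ t') b)) \<le> W"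
    using assms(2) unfolding reach_def by blast
  have "(step M ^^ (t + s)) a = c" using s t by (simp add: funpow_add)
  moreover have "snd (snd ((step M ^^ u) a)) \<le> W" if "u \<le> t + s" for u
  proof (cases "u \<le> s")
    case False
    then have "(step M ^^ u) a = (step M ^^ (u - s)) b"
      using s(1) funpow_add[of "u - s" s "step M"] by simp
    then show ?thesis using t(2) that False by simp
  qed (use s in auto)
  ultimately show ?thesis unfolding reach_def by blast
qed

text \<open>States 1 and 2 halt and freeze the configuration, so only the start state and the states
  from 3 on make moves.\<close>

lemma reach_step:
  assumes "3 \<le> q \<or> q = 0" "delta M q (tp h) = (q', s', d)" "h \<le> W" "move d h \<le> W"
  shows "reach M W (q, tp, h) (q', tp(h := s'), move d h)"
proof -
  have "step M (q, tp, h) = (q', tp(h := s'), move d h)"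
    using assms by (auto simp: step_def halting_def)
  then show ?thesis unfolding reach_def using assms
    by (intro exI[of _ 1]) (auto simp: le_Suc_eq)
qed

lemma reach_step_same:
  assumes "3 \<le> q \<or> q = 0" "delta M q (tp h) = (q', tp h, d)" "h \<le> W" "move d h \<le> W"
  shows "reach M W (q, tp, h) (q', tp, move d h)"
  using reach_step[of q M tp h q' "tp h" d W] assms by simp

lemma reach_left:
  assumes "3 \<le> q" "\<And>i. i \<le> h \<Longrightarrow> 0 < i \<Longrightarrow> delta M q (tp i) = (q, tp i, DL)"
    "delta M q (tp 0) = (e, tp 0, DS)" "h \<le> W"
  shows "reach M W (q, tp, h) (e, tp, 0)"
  using assms(2,4)
proof (induction h)
  case 0 then show ?case using reach_step_same[of q M tp 0 e DS W] assms by simp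
next
  case (Suc h)
  have "reach M W (q, tp, Suc h) (q, tp, h)"
    using reach_step_same[of q M tp "Suc h" q DL W] assms Suc by simp
  also have "reach M W \<dots> (e, tp, 0)" using Suc by simp
  finally show ?case .
qed

lemma reach_right:
  assumes "3 \<le> q" "\<And>i. h \<le> i \<Longrightarrow> i < h' \<Longrightarrow> delta M q (tp i) = (q, tp i, DR)"
    "h \<le> h'" "h' \<le> W"
  shows "reach M W (q, tp, h) (q, tp, h')"
  using assms(2-4)
proof (induction "h' - h" arbitrary: h')
  case 0 then show ?case using reach_refl[of "(q, tp, h)" W M] by simp
next
  case (Suc n)
  then obtain k where k: "h' = Suc k" "h \<le> k" "n = k - h" by (cases h') auto
  have "reach M W (q, tp, h) (q, tp, k)" using Suc k by simp
  also have "reach M W \<dots> (q, tp, h')"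
    using reach_step_same[of q M tp k q DR W] assms(1) Suc.prems k by simp
  finally show ?case .
qed

text \<open>Cell \<open>i\<close> of the tape holds bit \<open>i\<close> of each of the \<open>K\<close> registers, offset by the 16 input
  symbols; bit \<open>K\<close> of a cell marks the left end of the tape.\<close>

definition tape_rep :: "nat \<Rightarrow> nat \<Rightarrow> (nat \<Rightarrow> nat) \<Rightarrow> (nat \<Rightarrow> nat) \<Rightarrow> bool" where
  "tape_rep K W \<sigma> tp \<longleftrightarrow>
     (\<forall>i<W. 16 \<le> tp i \<and> (\<forall>v<K. bit (tp i - 16) v = bit (\<sigma> v) i) \<and> (bit (tp i - 16) K \<longleftrightarrow> i = 0))
     \<and> (\<forall>i\<ge>W. tp i = 0)"

text \<open>A left move at cell 0 leaves the head in place, so the machine cannot notice the left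
  end unless it is marked; this is why a cell needs the extra bit \<open>K\<close>.\<close>

definition rewind :: "nat \<Rightarrow> nat \<Rightarrow> nat \<Rightarrow> nat \<Rightarrow> nat \<times> nat \<times> dir" where
  "rewind K s e = (\<lambda>a. if 16 \<le> a \<and> bit (a - 16) K then (e, a, DS) else (s, a, DL))"

text \<open>Besides its body a loop takes five states: the zero test, one rewind for each outcome,
  and the two states of the decrement.\<close>

fun csize :: "com \<Rightarrow> nat" where
  "csize CSkip = 1"
| "csize (CDec v) = 2"
| "csize (CSeq c d) = csize c + csize d"
| "csize (CLoop v c) = 5 + csize c"

definition flip :: "nat \<Rightarrow> nat \<Rightarrow> nat" where
  "flip v a = 16 + flip_bit v (a - 16)"

text \<open>Binary decrement with borrow: zeros become ones until the first one is met, which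
  becomes zero. If the sweep reaches the blank, the register was 0 and now holds
  \<open>2 ^ W - 1\<close>, which is the wrap-around modulo \<open>2 ^ W\<close>.\<close>

definition dec_code :: "nat \<Rightarrow> nat \<Rightarrow> nat \<Rightarrow> nat \<Rightarrow> (nat \<Rightarrow> nat \<times> nat \<times> dir) list" where
  "dec_code K v s e =
    [\<lambda>a. if a < 16 then (s + 1, a, DL)
         else if bit (a - 16) v then (s + 1, flip v a, DL) else (s, flip v a, DR),
     rewind K (s + 1) e]"

text \<open>\<open>code K c s e\<close> is the transition table of the states \<open>s, s + 1, \<dots>\<close> that execute \<open>c\<close>
  and then continue in state \<open>e\<close>.\<close>

fun code :: "nat \<Rightarrow> com \<Rightarrow> nat \<Rightarrow> nat \<Rightarrow> (nat \<Rightarrow> nat \<times> nat \<times> dir) list" where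
  "code K CSkip s e = [\<lambda>a. (e, a, DS)]"
| "code K (CDec v) s e = dec_code K v s e"
| "code K (CSeq c d) s e = code K c s (s + csize c) @ code K d (s + csize c) e"
| "code K (CLoop v c) s e =
    [\<lambda>a. if a < 16 then (s + 2, a, DL)
         else if bit (a - 16) v then (s + 1, a, DL) else (s, a, DR),
     rewind K (s + 1) (s + 3), rewind K (s + 2) e]
    @ dec_code K v (s + 3) (s + 5) @ code K c (s + 5) s"

lemma length_code [simp]: "length (code K c s e) = csize c"
  by (induction c arbitrary: s e) (auto simp: dec_code_def)

definition has_code :: "tm \<Rightarrow> nat \<Rightarrow> (nat \<Rightarrow> nat \<times> nat \<times> dir) list \<Rightarrow> bool" where
  "has_code M s l \<longleftrightarrow> 3 \<le> s \<and> (\<forall>i<length l. delta M (s + i) = l ! i)"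

lemma has_code_append:
  "has_code M s (l @ l') \<longleftrightarrow> has_code M s l \<and> has_code M (s + length l) l'"
  unfolding has_code_def
  apply (auto simp: nth_append)
  subgoal for i by (metis add_diff_cancel_left' add.assoc nat_add_left_cancel_less not_add_less1)
  subgoal for i by (metis add.assoc add_diff_inverse_nat nat_add_left_cancel_less)
  done

lemma has_code_Cons:
  "has_code M s (f # l) \<longleftrightarrow> 3 \<le> s \<and> delta M s = f \<and> has_code M (Suc s) l"
  unfolding has_code_def by (auto simp: All_less_Suc2)

lemma has_code_Nil: "has_code M s [] \<longleftrightarrow> 3 \<le> s"
  by (simp add: has_code_def)

text \<open>With \<open>i\<close> the position of the lowest one, the predecessor clears bit
  \<open>i\<close> and sets all bits below. The induction strips the last bit: an odd number just
  loses it, and \<open>2 * y\<close> has the predecessor \<open>2 * (y - 1) + 1\<close>.\<close>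

lemma bit_pred_nat:
  fixes x :: nat
  assumes "bit x i" "\<And>j. j < i \<Longrightarrow> \<not> bit x j"
  shows "bit (x - 1) j = (if j < i then True else if j = i then False else bit x j)"
  using assms
proof (induction i arbitrary: x j)
  case 0
  then have "odd x" by (simp add: bit_0)
  then obtain y where "x = 2 * y + 1" by (rule oddE)
  then show ?case by (cases j) (auto simp: bit_0 bit_Suc)
next
  case (Suc i)
  have "even x" using Suc.prems(2)[of 0] by (simp add: bit_0)
  then obtain y where y: "x = 2 * y" by (rule evenE)
  have 1: "bit y i" "\<And>j. j < i \<Longrightarrow> \<not> bit y j"
    using Suc.prems(1) Suc.prems(2)[of "Suc _"] y by (auto simp: bit_Suc)
  then have "y > 0" by (cases y) auto
  then have "x - 1 = 2 * (y - 1) + 1" using y by simp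
  then show ?case using Suc.IH[OF 1] y by (cases j) (auto simp: bit_0 bit_Suc)
qed

lemma bit_flip: "bit (flip v a - 16) u \<longleftrightarrow> (bit (a - 16) u \<noteq> (u = v))"
  by (auto simp: flip_def bit_flip_bit_iff)

lemma tape_repD:
  assumes "tape_rep K W \<sigma> tp"
  shows "i < W \<Longrightarrow> 16 \<le> tp i" "i < W \<Longrightarrow> v < K \<Longrightarrow> bit (tp i - 16) v = bit (\<sigma> v) i"
    "i < W \<Longrightarrow> bit (tp i - 16) K = (i = 0)" "W \<le> i \<Longrightarrow> tp i = 0"
  using assms by (auto simp: tape_rep_def)

text \<open>\<open>F\<close> stands for the cells in which the borrow flips bit \<open>v\<close>:
  those up to the lowest one, or all \<open>W\<close> cells when the register is 0.\<close>

lemma tape_rep_flip: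
  assumes "tape_rep K W \<sigma> tp" "v < K" "\<And>i. tp' i = (if i \<in> F then flip v (tp i) else tp i)" "F \<subseteq> {..<W}"
    "\<And>i. i < W \<Longrightarrow> bit x i = (bit (\<sigma> v) i \<noteq> (i \<in> F))"
  shows "tape_rep K W (\<sigma>(v := x)) tp'"
proof -
  have "16 \<le> flip v a" for a by (simp add: flip_def)
  then show ?thesis using assms by (auto simp: tape_rep_def bit_flip not_less)
qed

lemma reach_rewind:
  assumes "tape_rep K W \<sigma> tp" "3 \<le> s" "delta M s = rewind K s e" "h < W"
  shows "reach M W (s, tp, h) (e, tp, 0)"
  using assms by (intro reach_left) (auto simp: rewind_def tape_rep_def)

lemma lowest_bit:
  fixes x :: nat
  assumes "x \<noteq> 0" "x < 2 ^ W"
  obtains i where "i < W" "bit x i" "\<And>j. j < i \<Longrightarrow> \<not> bit x j"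
proof -
  define i where "i = (LEAST i. bit x i)"
  have "\<exists>i. bit x i" using assms(1) bit_eq_iff[of x 0] by auto
  then have i: "bit x i" and il: "\<And>j. j < i \<Longrightarrow> \<not> bit x j"
    unfolding i_def by (auto intro: LeastI_ex dest: not_less_Least)
  have "take_bit W x = x" using assms(2) by (simp only: take_bit_nat_eq_self_iff)
  then have "i < W" using i bit_take_bit_iff[of W x i] by simp
  then show thesis using that i il by blast
qed

lemma pred_mod:
  fixes x :: nat
  assumes "0 < x" "x < B" shows "(x + B - 1) mod B = x - 1"
proof -
  have "x + B - 1 = (x - 1) + B" using assms by linarith
  then have "(x + B - 1) mod B = (x - 1) mod B" by (simp only: mod_add_self2)
  then show ?thesis using assms by simp
qed

lemma reach_dec:
  assumes M: "has_code M s (dec_code K v s e)" and v: "v < K" and W: "0 < W"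
    and rep: "tape_rep K W \<sigma> tp" and lt: "\<sigma> v < 2 ^ W"
  shows "\<exists>tp'. tape_rep K W (\<sigma>(v := (\<sigma> v + 2 ^ W - 1) mod 2 ^ W)) tp' \<and> reach M W (s, tp, 0) (e, tp', 0)"
proof -
  have s: "3 \<le> s" and d0: "delta M s = (\<lambda>a. if a < 16 then (s + 1, a, DL)
         else if bit (a - 16) v then (s + 1, flip v a, DL) else (s, flip v a, DR))"
    and d1: "delta M (s + 1) = rewind K (s + 1) e"
    using M by (auto simp: dec_code_def has_code_Cons)
  \<comment> \<open>The tape after the borrow has passed the first \<open>h\<close> cells.\<close>
  define tq where "tq h = (\<lambda>j. if j < h then flip v (tp j) else tp j)" for h
  have scan: "reach M W (s, tp, 0) (s, tq h, h)"
    if "h \<le> W" "\<And>j. j < h \<Longrightarrow> \<not> bit (\<sigma> v) j" for h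
    using that
  proof (induction h)
    case 0 then show ?case using reach_refl by (simp add: tq_def)
  next
    case (Suc h)
    have cell: "16 \<le> tp h" "\<not> bit (tp h - 16) v"
      using Suc.prems rep v by (auto simp: tape_rep_def)
    have "reach M W (s, tp, 0) (s, tq h, h)" using Suc by simp
    also have "reach M W \<dots> (s, (tq h)(h := flip v (tp h)), move DR h)"
      using Suc.prems(1) cell s by (intro reach_step) (auto simp: d0 tq_def)
    also have "(tq h)(h := flip v (tp h)) = tq (Suc h)" by (auto simp: tq_def)
    finally show ?case by simp
  qed
  have ret: "\<exists>tp'. tape_rep K W \<sigma>' tp' \<and> reach M W (s, tp, 0) (e, tp', 0)"
    if "reach M W (s, tp, 0) (s + 1, tp', h)" "tape_rep K W \<sigma>' tp'" "h < W" for tp' h \<sigma>'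
  proof -
    have "3 \<le> s + 1" using s by simp
    from reach_trans[OF that(1) reach_rewind[OF that(2) this d1 that(3)]] that(2) show ?thesis by blast
  qed
  let ?\<sigma> = "\<sigma>(v := (\<sigma> v + 2 ^ W - 1) mod 2 ^ W)"
  show ?thesis
  proof (cases "\<sigma> v = 0")
    case True
    have "reach M W (s, tp, 0) (s, tq W, W)" using scan True by simp
    also have "reach M W \<dots> (s + 1, tq W, W - 1)"
      using rep s reach_step_same[of s M "tq W" W "s + 1" DL W]
      by (auto simp: d0 tq_def tape_rep_def)
    finally have r: "reach M W (s, tp, 0) (s + 1, tq W, W - 1)" .
    have "?\<sigma> v = mask W" using True by (simp add: mask_eq_exp_minus_1)
    then have "tape_rep K W ?\<sigma> (tq W)"
      using rep v True by (intro tape_rep_flip[of _ _ _ tp _ _ "{..<W}"]) (auto simp: tq_def bit_mask_iff)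
    then show ?thesis using ret[OF r] W by simp
  next
    case False
    obtain i where "i < W" and i: "bit (\<sigma> v) i" and il: "\<And>j. j < i \<Longrightarrow> \<not> bit (\<sigma> v) j"
      using lowest_bit[of "\<sigma> v" W] False lt by auto
    define tr where "tr = (tq i)(i := flip v (tp i))"
    have "reach M W (s, tp, 0) (s, tq i, i)" using scan \<open>i < W\<close> il by simp
    also have "reach M W \<dots> (s + 1, tr, move DL i)" unfolding tr_def
      using rep s \<open>i < W\<close> i v by (intro reach_step) (auto simp: d0 tq_def tape_rep_def)
    finally have r: "reach M W (s, tp, 0) (s + 1, tr, i - 1)" by simp
    have "?\<sigma> v = \<sigma> v - 1" using pred_mod[OF _ lt] False by simp
    moreover have "tr = (\<lambda>j. if j \<le> i then flip v (tp j) else tp j)" by (auto simp: tr_def tq_def)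
    ultimately have "tape_rep K W ?\<sigma> tr"
      using rep v \<open>i < W\<close> i il
      by (intro tape_rep_flip[of _ _ _ tp _ _ "{..i}"]) (auto simp: bit_pred_nat[OF i il] simp del: One_nat_def)
    then show ?thesis using ret[OF r] \<open>i < W\<close> by simp
  qed
qed

lemma reach_code:
  assumes "wf_com K c" "has_code M s (code K c s e)" "0 < W" "tape_rep K W \<sigma> tp" "\<And>v. \<sigma> v < 2 ^ W"
  shows "\<exists>tp'. tape_rep K W (exec (2 ^ W) c \<sigma>) tp' \<and> reach M W (s, tp, 0) (e, tp', 0)"
  using assms
proof (induction c arbitrary: s e \<sigma> tp)
  case CSkip
  then have "reach M W (s, tp, 0) (e, tp, 0)"
    using reach_step_same[of s M tp 0 e DS W] by (simp add: has_code_Cons)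
  then show ?case using CSkip by auto
next
  case (CDec v)
  then show ?case unfolding exec.simps wf_com.simps code.simps by (intro reach_dec)
next
  case (CSeq c d)
  have 1: "has_code M s (code K c s (s + csize c))" "has_code M (s + csize c) (code K d (s + csize c) e)"
    using CSeq.prems by (auto simp: has_code_append)
  have wf: "wf_com K c" "wf_com K d" using CSeq.prems by auto
  obtain tp1 where tp1: "tape_rep K W (exec (2 ^ W) c \<sigma>) tp1" "reach M W (s, tp, 0) (s + csize c, tp1, 0)"
    using CSeq.IH(1)[OF wf(1) 1(1) CSeq.prems(3-5)] by blast
  have "exec (2 ^ W) c \<sigma> v < 2 ^ W" for v using exec_less[of "2 ^ W"] CSeq.prems(5) by simp
  then obtain tp2 where tp2: "tape_rep K W (exec (2 ^ W) d (exec (2 ^ W) c \<sigma>)) tp2"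
    "reach M W (s + csize c, tp1, 0) (e, tp2, 0)"
    using CSeq.IH(2)[OF wf(2) 1(2) CSeq.prems(3) tp1(1)] by blast
  show ?case unfolding exec.simps using tp2(1) reach_trans[OF tp1(2) tp2(2)] by blast
next
  case (CLoop v c)
  have v: "v < K" "v \<notin> writes c" "wf_com K c" using CLoop.prems by auto
  have s: "3 \<le> s" and d0: "delta M s = (\<lambda>a. if a < 16 then (s + 2, a, DL)
         else if bit (a - 16) v then (s + 1, a, DL) else (s, a, DR))"
    and d1: "delta M (s + 1) = rewind K (s + 1) (s + 3)"
    and d2: "delta M (s + 2) = rewind K (s + 2) e"
    and hd: "has_code M (s + 3) (dec_code K v (s + 3) (s + 5))"
    and hc: "has_code M (s + 5) (code K c (s + 5) s)"
    using CLoop.prems(2) 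
    by (auto simp: has_code_Cons has_code_append has_code_Nil dec_code_def eval_nat_numeral)
  let ?F = "\<lambda>\<sigma>. exec (2 ^ W) c (\<sigma>(v := \<sigma> v - 1))"
  \<comment> \<open>Induction on the counter value. Valuation and tape are generalised because the
    body changes both in every round.\<close>
  have "\<exists>tp'. tape_rep K W ((?F ^^ n) \<sigma>) tp' \<and> reach M W (s, tp, 0) (e, tp', 0)"
    if "\<sigma> v = n" "tape_rep K W \<sigma> tp" "\<And>v. \<sigma> v < 2 ^ W" for n \<sigma> tp
    using that
  proof (induction n arbitrary: \<sigma> tp)
    case 0
    have "reach M W (s, tp, 0) (s, tp, W)"
      using 0 s v(1) by (intro reach_right) (auto simp: d0 tape_rep_def)
    also have "reach M W \<dots> (s + 2, tp, W - 1)"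
      using 0 s reach_step_same[of s M tp W "s + 2" DL W] by (auto simp: d0 tape_rep_def)
    also have "reach M W \<dots> (e, tp, 0)" using reach_rewind[OF 0(2) _ d2] s \<open>0 < W\<close> by simp
    finally show ?case using 0 by auto
  next
    case (Suc n)
    obtain i where "i < W" and i: "bit (\<sigma> v) i" and il: "\<And>j. j < i \<Longrightarrow> \<not> bit (\<sigma> v) j"
      using lowest_bit[of "\<sigma> v" W] Suc.prems(1) Suc.prems(3)[of v] by auto
    have "reach M W (s, tp, 0) (s, tp, i)"
    proof (rule reach_right)
      fix j assume "0 \<le> j" "j < i"
      then show "delta M s (tp j) = (s, tp j, DR)"
        using tape_repD(1,2)[OF Suc.prems(2), of j] \<open>i < W\<close> v(1) il by (simp add: d0)
    qed (use s \<open>i < W\<close> in auto)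
    also have "reach M W \<dots> (s + 1, tp, i - 1)"
      using reach_step_same[of s M tp i "s + 1" DL W] tape_repD(1,2)[OF Suc.prems(2), of i] s v(1) i \<open>i < W\<close>
      by (simp add: d0)
    also have "reach M W \<dots> (s + 3, tp, 0)"
      using reach_rewind[OF Suc.prems(2) _ d1] s \<open>i < W\<close> by simp
    finally have r1: "reach M W (s, tp, 0) (s + 3, tp, 0)" .
    \<comment> \<open>The counter is nonzero here, so the modular decrement on the tape agrees with
      the \<open>- 1\<close> in \<open>exec\<close>.\<close>
    have dec: "(\<sigma> v + 2 ^ W - 1) mod 2 ^ W = \<sigma> v - 1"
      using Suc.prems(1) by (intro pred_mod Suc.prems(3)) simp
    obtain tp1 where tp1: "tape_rep K W (\<sigma>(v := \<sigma> v - 1)) tp1" "reach M W (s + 3, tp, 0) (s + 5, tp1, 0)"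
      using reach_dec[OF hd v(1) \<open>0 < W\<close> Suc.prems(2,3)] dec by metis
    have lt: "(\<sigma>(v := \<sigma> v - 1)) u < 2 ^ W" for u
      using Suc.prems(3) by (simp add: less_imp_diff_less)
    obtain tp2 where tp2: "tape_rep K W (?F \<sigma>) tp2" "reach M W (s + 5, tp1, 0) (s, tp2, 0)"
      using CLoop.IH[OF v(3) hc \<open>0 < W\<close> tp1(1) lt] by blast
    have "?F \<sigma> v = n" using Suc.prems(1) exec_unwritten[OF v(2)] by simp
    moreover have "?F \<sigma> u < 2 ^ W" for u 
    proof (rule exec_less)
      show "(\<sigma>(v := \<sigma> v - 1)) u < 2 ^ W" for u by (rule lt)
    qed simp
    ultimately obtain tp3 where "tape_rep K W ((?F ^^ n) (?F \<sigma>)) tp3" "reach M W (s, tp2, 0) (e, tp3, 0)"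
      using Suc.IH tp2(1) by blast
    then show ?case unfolding funpow_Suc_right comp_apply
      using reach_trans[OF reach_trans[OF r1 tp1(2)] reach_trans[OF tp2(2)]] by blast
  qed
  then show ?case using CLoop.prems by simp
qed

text \<open>The machine must lay out \<open>(C + 1) * length w\<close> register cells without being
  able to count to \<open>length w\<close>. It converts one token at a time into a register cell and
  after each conversion appends \<open>C\<close> zero cells (symbol 16) at the right end. State 0
  marks the first cell and rejects the empty input, state 3 runs to the right end, the states from 5
  on append, state 4 returns, and state \<open>6 + C\<close> looks for the next unconverted
  token.\<close>

definition init_code :: "nat \<Rightarrow> nat \<Rightarrow> (nat \<Rightarrow> nat \<times> nat \<times> dir) list" where
  "init_code K C =
    [\<lambda>a. if a = 0 \<or> 16 \<le> a then (2, a, DS) else (3, 16 + a + 2 ^ K, DS),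
     \<lambda>a. (1, a, DS), \<lambda>a. (2, a, DS),
     \<lambda>a. if a = 0 then (5, a, DS) else (3, a, DR),
     rewind K 4 (6 + C)] @
    map (\<lambda>j a. (6 + j, 16, DR)) [0..<C] @
    [\<lambda>a. (4, a, DL),
     \<lambda>a. if a = 0 then (7 + C, a, DL) else if a < 16 then (3, 16 + a, DS) else (6 + C, a, DR),
     rewind K (7 + C) (8 + C)]"

definition accept_code :: "nat \<Rightarrow> nat \<Rightarrow> nat \<Rightarrow> nat \<times> nat \<times> dir" where
  "accept_code out s = (\<lambda>a. if a < 16 then (2, a, DS) else if bit (a - 16) out then (1, a, DS) else (s, a, DR))"

definition prog :: "nat \<Rightarrow> nat \<Rightarrow> com \<Rightarrow> nat \<Rightarrow> (nat \<Rightarrow> nat \<times> nat \<times> dir) list" where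
  "prog K C c out = init_code K C @ code K c (8 + C) (8 + C + csize c) @ [accept_code out (8 + C + csize c)]"

definition machine :: "nat \<Rightarrow> nat \<Rightarrow> com \<Rightarrow> nat \<Rightarrow> tm" where
  "machine K C c out = \<lparr>nst = 9 + C + csize c, nsym = 16 + 2 ^ Suc K,
     delta = (\<lambda>q. if q < length (prog K C c out) then prog K C c out ! q else (\<lambda>a. (2, a, DS)))\<rparr>"

lemma length_init_code [simp]: "length (init_code K C) = 8 + C"
  by (simp add: init_code_def)

lemma length_prog [simp]: "length (prog K C c out) = 9 + C + csize c"
  by (simp add: prog_def)

definition wf_trans :: "nat \<Rightarrow> nat \<Rightarrow> (nat \<Rightarrow> nat \<times> nat \<times> dir) \<Rightarrow> bool" where
  "wf_trans N K f \<longleftrightarrow> (\<forall>a < 16 + 2 ^ Suc K. case f a of (q', s', d) \<Rightarrow> q' < N \<and> s' < 16 + 2 ^ Suc K)"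

lemma flip_bit_less:
  fixes a :: nat
  assumes "a < 2 ^ n" "v < n" shows "flip_bit v a < 2 ^ n"
proof -
  have "take_bit n a = a" using assms by (simp add: take_bit_nat_eq_self_iff)
  then have "take_bit n (flip_bit v a) = flip_bit v a"
    using assms(2) by (metis (no_types, lifting) bit_eqI bit_flip_bit_iff bit_take_bit_iff)
  then show ?thesis by (simp only: take_bit_nat_eq_self_iff)
qed

lemma wf_trans_rewind: "s < N \<Longrightarrow> e < N \<Longrightarrow> wf_trans N K (rewind K s e)"
  by (auto simp: wf_trans_def rewind_def)

lemma flip_less:
  assumes "16 \<le> a" "a < 16 + 2 ^ Suc K" "v < K" shows "flip v a < 16 + 2 ^ Suc K"
  using flip_bit_less[of "a - 16" "Suc K" v] assms by (simp add: flip_def)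

lemma wf_trans_dec_code:
  "v < K \<Longrightarrow> s + 2 \<le> N \<Longrightarrow> e < N \<Longrightarrow> f \<in> set (dec_code K v s e) \<Longrightarrow> wf_trans N K f"
  using flip_less[of _ K v]
  by (auto simp: dec_code_def wf_trans_rewind) (auto simp: wf_trans_def)

lemma wf_trans_code:
  "wf_com K c \<Longrightarrow> s + csize c \<le> N \<Longrightarrow> e < N \<Longrightarrow> f \<in> set (code K c s e) \<Longrightarrow> wf_trans N K f"
proof (induction c arbitrary: s e)
  case CSkip then show ?case by (auto simp: wf_trans_def)
next
  case (CDec v) then show ?case using wf_trans_dec_code[of v K s N e f] by simp
next
  case (CSeq c d)
  have "0 < csize d" by (induction d) auto
  then show ?case using CSeq.prems CSeq.IH(1)[of s "s + csize c"] CSeq.IH(2)[of "s + csize c" e] by auto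
next
  case (CLoop v c)
  have "0 < csize c" by (induction c) auto
  then show ?case using CLoop wf_trans_dec_code[of v K "s + 3" N "s + 5" f] CLoop.IH[of "s + 5" s]
    by (auto simp: wf_trans_rewind) (auto simp: wf_trans_def)
qed

lemma wf_machine:
  assumes "wf_com K c" "out < K" "4 < K"
  shows "wf_tm (machine K C c out)"
proof -
  let ?N = "9 + C + csize c"
  \<comment> \<open>Token codes are below 16, so this keeps the marked first symbol
    \<open>16 + a + 2 ^ K\<close> inside the alphabet.\<close>
  have "(2::nat) ^ 4 \<le> 2 ^ K" using assms(3) by (intro power_increasing) auto
  then have K: "16 \<le> (2::nat) ^ K" by simp
  have "wf_trans ?N K f" if "f \<in> set (prog K C c out)" for f
  proof -
    consider "f \<in> set (init_code K C)" | "f \<in> set (code K c (8 + C) (8 + C + csize c))"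
      | "f = accept_code out (8 + C + csize c)" using \<open>f \<in> _\<close> by (auto simp: prog_def)
    then show ?thesis
    proof cases
      case 1 then show ?thesis using K unfolding init_code_def
        by (auto simp: wf_trans_rewind) (auto simp: wf_trans_def)
    next
      case 2 then show ?thesis using wf_trans_code[of K c "8 + C" ?N "8 + C + csize c" f] assms by simp
    next
      case 3 then show ?thesis by (auto simp: wf_trans_def accept_code_def)
    qed
  qed
  then have "wf_trans ?N K (delta (machine K C c out) q)" if "q < ?N" for q
    using that by (simp add: machine_def)
  moreover have "16 < 16 + (2::nat) ^ Suc K" by simp
  ultimately show ?thesis by (simp add: wf_tm_def wf_trans_def machine_def del: power_Suc)
qed

text \<open>Turning a token code \<open>a\<close> into the symbol \<open>16 + a\<close> already
  stores its four bits in registers 0 to 3. The input thus arrives bit-sliced: register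
  \<open>v\<close> collects bit \<open>v\<close> of all tokens.\<close>

definition input_reg :: "token list \<Rightarrow> nat \<Rightarrow> nat" where
  "input_reg w v = (if v < 4 then horner_sum of_bool 2 (map (\<lambda>t. bit (tok_code t) v) w) else 0)"

lemma bit_input_reg: "bit (input_reg w v) i \<longleftrightarrow> v < 4 \<and> i < length w \<and> bit (tok_code (w ! i)) v"
  by (auto simp: input_reg_def bit_horner_sum_bit_iff)

lemma tok_code_bounds: "0 < tok_code t" "tok_code t < 16"
  by (cases t; simp)+

lemma not_bit_small: "x < 16 \<Longrightarrow> 4 \<le> v \<Longrightarrow> \<not> bit (x::nat) v"
  using bit_take_bit_iff[of 4 x v] take_bit_nat_eq_self_iff[of 4 x] by simp

lemma bit_add_flag: "x < 16 \<Longrightarrow> 4 \<le> K \<Longrightarrow> bit (x + 2 ^ K :: nat) v \<longleftrightarrow> bit x v \<or> v = K"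
proof -
  assume "x < 16" "4 \<le> K"
  then have "x + 2 ^ K = or x (2 ^ K)"
    by (intro disjunctive_add) (auto simp: bit_exp_iff not_bit_small)
  then show ?thesis by (simp add: bit_or_iff bit_exp_iff)
qed

lemma reach_setup:
  fixes w :: "token list" and K C :: nat and M :: tm
  assumes M: "M = machine K C c out" and K: "4 < K" and w: "w \<noteq> []"
  defines "W \<equiv> (C + 1) * length w"
  shows "\<exists>tp. tape_rep K W (input_reg w) tp \<and> reach M W (init_config w) (8 + C, tp, 0)"
proof -
  define n where "n = length w"
  have n: "0 < n" "W = n + n * C" using w by (auto simp: n_def W_def)
  \<comment> \<open>The tape with \<open>m\<close> tokens converted and \<open>r\<close> cells
    appended; the first cell also carries the mark.\<close>
  define T where "T m r i = (if i < m then 16 + (tok_code (w ! i) + (if i = 0 then 2 ^ K else 0))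
     else if i < n then tok_code (w ! i) else if i < n + r then 16 else 0)" for m r i
  have dl: "delta M q = prog K C c out ! q" if "q < 9 + C + csize c" for q
    using that by (simp add: M machine_def)
  have d: "delta M q = init_code K C ! q" if "q < 8 + C" for q
    using dl that by (simp add: prog_def nth_append)
  have d0: "delta M 0 = (\<lambda>a. if a = 0 \<or> 16 \<le> a then (2, a, DS) else (3, 16 + a + 2 ^ K, DS))"
    and d3: "delta M 3 = (\<lambda>a. if a = 0 then (5, a, DS) else (3, a, DR))"
    and d4: "delta M 4 = rewind K 4 (6 + C)"
    by (simp_all add: d init_code_def nth_append)
  have d5: "delta M (5 + j) = (\<lambda>a. (6 + j, 16, DR))" if "j < C" for j
    using that by (simp add: d init_code_def nth_append)
  have d5C: "delta M (5 + C) = (\<lambda>a. (4, a, DL))"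
    and d6: "delta M (6 + C) = (\<lambda>a. if a = 0 then (7 + C, a, DL) else if a < 16 then (3, 16 + a, DS) else (6 + C, a, DR))"
    and d7: "delta M (7 + C) = rewind K (7 + C) (8 + C)"
    by (simp_all add: d init_code_def nth_append)
  have T0: "0 < T m r i" if "i < n + r" for m r i using that tok_code_bounds by (auto simp: T_def)
  have rw: "rewind K s e (T m r 0) = (e, T m r 0, DS)"
    "0 < i \<Longrightarrow> rewind K s e (T m r i) = (s, T m r i, DL)" if "0 < m" for s e i m r
    using that K tok_code_bounds[of "w ! i"] tok_code_bounds[of "w ! 0"]
    by (auto simp: T_def rewind_def bit_add_flag not_bit_small)
  have round: "reach M W (3, T m r, h) (6 + C, T m (r + C), 0)"
    if "0 < m" "m \<le> n" "h \<le> n + r" "n + r + C \<le> W" for m r h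
  proof -
    have "reach M W (3, T m r, h) (3, T m r, n + r)"
      using that T0[of _ r m] by (intro reach_right) (auto simp: d3)
    also have "reach M W \<dots> (5, T m r, n + r)"
      using reach_step_same[of 3 M "T m r" "n + r" 5 DS W] that by (simp add: d3 T_def)
    also have "reach M W \<dots> (5 + C, T m (r + C), n + r + C)"
    proof -
      have "reach M W (5, T m r, n + r) (5 + j, T m (r + j), n + r + j)" if "j \<le> C" for j
        using that
      proof (induction j)
        case 0 then show ?case using \<open>n + r + C \<le> W\<close> by (simp add: reach_refl)
      next
        case (Suc j)
        have "reach M W (5, T m r, n + r) (5 + j, T m (r + j), n + r + j)" using Suc by simp
        also have "reach M W \<dots> (6 + j, (T m (r + j))(n + r + j := 16), move DR (n + r + j))"
          using \<open>n + r + C \<le> W\<close> Suc.prems by (intro reach_step) (auto simp: d5)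
        also have "(T m (r + j))(n + r + j := 16) = T m (r + Suc j)"
          using \<open>m \<le> n\<close> by (auto simp: T_def)
        finally show ?case by simp
      qed
      then show ?thesis by simp
    qed
    also have "reach M W \<dots> (4, T m (r + C), n + r + C - 1)"
      using reach_step_same[of "5 + C" M "T m (r + C)" "n + r + C" 4 DL W] that by (simp add: d5C)
    also have "reach M W \<dots> (6 + C, T m (r + C), 0)"
      using that rw[of m] by (intro reach_left) (auto simp: d4)
    finally show ?thesis .
  qed
  have start: "reach M W (init_config w) (3, T m ((m - 1) * C), m - 1)" if "0 < m" "m \<le> n" for m
    using that
  proof (induction m rule: nat_induct_non_zero)
    case 1
    define tp where "tp = (\<lambda>i. if i < length w then tok_code (w ! i) else 0)"
    have i: "init_config w = (0, tp, 0)" by (simp add: init_config_def tp_def)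
    have "reach M W (0, tp, 0) (3, tp(0 := 16 + tp 0 + 2 ^ K), move DS 0)"
      using tok_code_bounds[of "w ! 0"] n(1) by (intro reach_step) (auto simp: d0 tp_def n_def)
    also have "tp(0 := 16 + tp 0 + 2 ^ K) = T 1 0"
      using n(1) by (auto simp: T_def tp_def n_def)
    finally show ?case by (simp add: i)
  next
    case (Suc m)
    have r: "(m - 1) * C + C = m * C" using Suc.hyps by (cases m) auto
    have le: "Suc m * C \<le> n * C" using Suc.prems by (rule mult_le_mono1)
    have "reach M W (init_config w) (3, T m ((m - 1) * C), m - 1)" using Suc by simp
    also have "reach M W \<dots> (6 + C, T m (m * C), 0)"
      using round[of m "m - 1" "(m - 1) * C"] Suc.hyps Suc.prems r le n(2) by (simp add: add.assoc)
    also have "reach M W \<dots> (6 + C, T m (m * C), m)"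
      using Suc.prems n(2) by (intro reach_right) (auto simp: d6 T_def)
    also have "reach M W \<dots> (3, (T m (m * C))(m := 16 + T m (m * C) m), move DS m)"
      using Suc.prems Suc.hyps n(2) tok_code_bounds[of "w ! m"] by (intro reach_step) (auto simp: d6 T_def)
    also have "(T m (m * C))(m := 16 + T m (m * C) m) = T (Suc m) (m * C)"
      using Suc.prems Suc.hyps by (auto simp: T_def)
    finally show ?case by simp
  qed
  have r: "(n - 1) * C + C = n * C" using n(1) by (cases n) auto
  have "reach M W (init_config w) (3, T n ((n - 1) * C), n - 1)" using start n(1) by simp
  also have "reach M W \<dots> (6 + C, T n (n * C), 0)"
    using round[of n "n - 1" "(n - 1) * C"] n r by (simp add: add.assoc)
  also have "reach M W \<dots> (6 + C, T n (n * C), W)"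
    using n by (intro reach_right) (auto simp: d6 T_def)
  also have "reach M W \<dots> (7 + C, T n (n * C), W - 1)"
    using reach_step_same[of "6 + C" M "T n (n * C)" W "7 + C" DL W] n by (simp add: d6 T_def)
  also have "reach M W \<dots> (8 + C, T n (n * C), 0)"
    using n(1) rw[of n] by (intro reach_left) (auto simp: d7)
  finally have r: "reach M W (init_config w) (8 + C, T n (n * C), 0)" .
  have "bit (tok_code t) v \<Longrightarrow> v < 4" for t v
    using not_bit_small[OF tok_code_bounds(2), of v t] by linarith
  then have "tape_rep K W (input_reg w) (T n (n * C))"
    using K tok_code_bounds
    by (auto simp: tape_rep_def T_def n bit_input_reg n_def bit_add_flag not_bit_small)
  then show ?thesis using r by blast
qed

lemma decides_machine:
  assumes c: "wf_com K c" and K: "out < K" "4 < K"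
  shows "decides_in_space (machine K C c out)
    {w. w \<noteq> [] \<and> exec (2 ^ ((C + 1) * length w)) c (input_reg w) out \<noteq> 0} (\<lambda>n. (C + 2) * (n + 1) ^ 1)"
  unfolding decides_in_space_def
proof
  fix w :: "token list"
  let ?M = "machine K C c out" and ?W = "(C + 1) * length w"
  let ?yes = "w \<noteq> [] \<and> exec (2 ^ ?W) c (input_reg w) out \<noteq> 0"
  have "\<exists>tp h. reach ?M ?W (init_config w) (if ?yes then 1 else 2, tp, h)"
  proof (cases "w = []")
    case True
    then have "reach ?M ?W (init_config w) (2, \<lambda>_. 0, 0)"
      using reach_step_same[of 0 ?M "\<lambda>_. 0" 0 2 DS ?W]
      by (simp add: init_config_def machine_def prog_def init_code_def nth_append)
    then show ?thesis using True by auto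
  next
    case False
    then have W: "0 < ?W" by simp
    obtain tp where tp: "tape_rep K ?W (input_reg w) tp" "reach ?M ?W (init_config w) (8 + C, tp, 0)"
      using reach_setup[OF refl K(2) False] by blast
    have dl: "delta ?M q = prog K C c out ! q" if "q < 9 + C + csize c" for q
      using that by (simp add: machine_def)
    have "has_code ?M (8 + C) (code K c (8 + C) (8 + C + csize c))"
      unfolding has_code_def by (auto simp: dl prog_def nth_append)
    moreover have "input_reg w v < 2 ^ ?W" for v
    proof -
      have "take_bit ?W (input_reg w v) = input_reg w v"
        by (rule bit_eqI) (auto simp: bit_take_bit_iff bit_input_reg)
      then show ?thesis by (simp only: take_bit_nat_eq_self_iff)
    qed
    ultimately obtain tq where tq: "tape_rep K ?W (exec (2 ^ ?W) c (input_reg w)) tq"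
      "reach ?M ?W (8 + C, tp, 0) (8 + C + csize c, tq, 0)"
      using reach_code[OF c _ W tp(1)] by blast
    define x where "x = exec (2 ^ ?W) c (input_reg w) out"
    have x: "x < 2 ^ ?W" unfolding x_def
      by (rule exec_less) (use \<open>\<And>v. input_reg w v < 2 ^ ?W\<close> in auto)
    let ?s = "8 + C + csize c"
    have d: "delta ?M ?s = accept_code out ?s" by (simp add: dl prog_def nth_append)
    have "\<exists>h. reach ?M ?W (?s, tq, 0) (if x \<noteq> 0 then 1 else 2, tq, h)"
    proof (cases "x = 0")
      case True
      have "reach ?M ?W (?s, tq, 0) (?s, tq, ?W)"
      proof (rule reach_right)
        fix i assume "0 \<le> i" "i < ?W"
        then show "delta ?M ?s (tq i) = (?s, tq i, DR)"
          using tape_repD(1,2)[OF tq(1), of i] K(1) True by (simp add: d accept_code_def x_def)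
      qed auto
      also have "reach ?M ?W \<dots> (2, tq, ?W)"
        using reach_step_same[of ?s ?M tq ?W 2 DS ?W] tape_repD(4)[OF tq(1), of ?W] by (simp add: d accept_code_def)
      finally show ?thesis using True by auto
    next
      case False
      then obtain i where i: "i < ?W" "bit x i" "\<And>j. j < i \<Longrightarrow> \<not> bit x j"
        using lowest_bit x by blast
      have "reach ?M ?W (?s, tq, 0) (?s, tq, i)"
      proof (rule reach_right)
        fix j assume "0 \<le> j" "j < i"
        then show "delta ?M ?s (tq j) = (?s, tq j, DR)"
          using tape_repD(1,2)[OF tq(1), of j] K(1) i by (simp add: d accept_code_def x_def)
      qed (use i(1) in auto)
      also have "reach ?M ?W \<dots> (1, tq, i)"
        using reach_step_same[of ?s ?M tq i 1 DS ?W] tape_repD(1,2)[OF tq(1), of i] K(1) i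
        by (simp add: d accept_code_def x_def)
      finally show ?thesis using False by auto
    qed
    then obtain h where "reach ?M ?W (?s, tq, 0) (if x \<noteq> 0 then 1 else 2, tq, h)" by blast
    from reach_trans[OF tp(2) reach_trans[OF tq(2) this]] have "reach ?M ?W (init_config w) (if ?yes then 1 else 2, tq, h)" using False unfolding x_def by simp
    then show ?thesis by blast
  qed
  then obtain t tp h where t: "(step ?M ^^ t) (init_config w) = (if ?yes then 1 else 2, tp, h)"
    and b: "\<And>t'. t' \<le> t \<Longrightarrow> snd (snd ((step ?M ^^ t') (init_config w))) \<le> ?W"
    unfolding reach_def by blast
  have rt: "fst (run ?M w t) = (if ?yes then 1 else 2)" using t by (simp add: run_def)
  \<comment> \<open>A halting configuration is a fixed point of \<open>step\<close>, so what is
    known up to time \<open>t\<close> extends to all times.\<close>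
  have stay: "run ?M w (s + u) = run ?M w s" if "halting (fst (run ?M w s))" for s u
  proof (induction u)
    case (Suc u)
    then show ?case using that
      by (auto simp: run_def step_def split: prod.splits)
  qed simp
  have hlt: "halting (fst (run ?M w t))" using rt by (simp add: halting_def)
  have "(\<exists>t. fst (run ?M w t) = 1) \<longleftrightarrow> ?yes"
  proof
    assume "\<exists>t. fst (run ?M w t) = 1"
    then obtain u where u: "fst (run ?M w u) = 1" by blast
    have "run ?M w (u + t) = run ?M w u" using stay[of u t] u by (simp add: halting_def)
    moreover have "run ?M w (t + u) = run ?M w t" using stay[OF hlt] .
    ultimately show ?yes using u rt by (metis add.commute one_eq_numeral_iff semiring_norm(85))
  next
    assume ?yes then show "\<exists>t. fst (run ?M w t) = 1" using rt by auto
  qed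
  \<comment> \<open>The head gets at most to the first blank at \<open>(C + 1) * length w\<close>;
    the larger factor and the \<open>+ 1\<close> make the bound strict, also for the empty
    input.\<close>
  moreover have "snd (snd (run ?M w u)) < (C + 2) * (length w + 1) ^ 1" for u
  proof -
    have "run ?M w u = run ?M w (min u t)"
      using stay[OF hlt, of "u - t"] by (cases "u \<le> t") (auto simp: min_def)
    then have "snd (snd (run ?M w u)) \<le> ?W" using b[of "min u t"] by (simp add: run_def)
    then show ?thesis by (simp add: algebra_simps)
  qed
  ultimately show "(\<exists>t. halting (fst (run ?M w t))) \<and>
      ((\<exists>t. fst (run ?M w t) = 1) \<longleftrightarrow> w \<in> {w. w \<noteq> [] \<and> exec (2 ^ ((C + 1) * length w)) c (input_reg w) out \<noteq> 0}) \<and>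
      (\<forall>t. snd (snd (run ?M w t)) < (C + 2) * (length w + 1) ^ 1)"
    using hlt by blast
qed

lemma in_PSPACE_com:
  assumes "wf_com K c" "out < K" "4 < K"
  shows "in_PSPACE {w. w \<noteq> [] \<and> exec (2 ^ ((C + 1) * length w)) c (input_reg w) out \<noteq> 0}"
  unfolding in_PSPACE_def using wf_machine[OF assms] decides_machine[OF assms] by blast

section \<open>Terms\<close>

text \<open>Terms replace destructive programs by values. An iteration carries a pair, bound as
  variables 0 and 1 in \<open>f\<close> and \<open>g\<close>, so that a loop can maintain a counter
  or an auxiliary value next to its result without a pairing function.\<close>

datatype trm = TVar nat | TZero | TDec trm | TIter trm trm trm trm trm

definition ext2 :: "nat \<Rightarrow> nat \<Rightarrow> (nat \<Rightarrow> nat) \<Rightarrow> nat \<Rightarrow> nat" where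
  "ext2 x y \<rho> = case_nat x (case_nat y \<rho>)"

fun eval :: "nat \<Rightarrow> trm \<Rightarrow> (nat \<Rightarrow> nat) \<Rightarrow> nat" where
  "eval B (TVar i) \<rho> = \<rho> i"
| "eval B TZero \<rho> = 0"
| "eval B (TDec t) \<rho> = (eval B t \<rho> + B - 1) mod B"
| "eval B (TIter n a b f g) \<rho> =
    fst (((\<lambda>(x, y). (eval B f (ext2 x y \<rho>), eval B g (ext2 x y \<rho>))) ^^ eval B n \<rho>) (eval B a \<rho>, eval B b \<rho>))"

lemma ext2_less: "x < B \<Longrightarrow> y < B \<Longrightarrow> (\<And>i. \<rho> i < B) \<Longrightarrow> ext2 x y \<rho> i < B"
  by (auto simp: ext2_def split: nat.splits)

lemma iter2_less:
  fixes f g :: "nat \<Rightarrow> nat \<Rightarrow> nat"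
  assumes "x < B" "y < B" "\<And>x y. x < B \<Longrightarrow> y < B \<Longrightarrow> f x y < B \<and> g x y < B"
  shows "fst (((\<lambda>(x, y). (f x y, g x y)) ^^ n) (x, y)) < B \<and> snd (((\<lambda>(x, y). (f x y, g x y)) ^^ n) (x, y)) < B"
  by (induction n) (use assms in \<open>auto split: prod.splits\<close>)

lemma eval_less: "0 < B \<Longrightarrow> (\<And>i. \<rho> i < B) \<Longrightarrow> eval B t \<rho> < B"
proof (induction t arbitrary: \<rho>)
  case (TIter n a b f g)
  then show ?case by (simp add: iter2_less ext2_less)
qed auto

definition czero :: "nat \<Rightarrow> com" where
  "czero v = CLoop v CSkip"

text \<open>Decrements modulo \<open>B\<close> negate, so a register is copied by negating it twice.\<close>

definition cmove :: "nat \<Rightarrow> nat \<Rightarrow> nat \<Rightarrow> com" where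
  "cmove s t r = CSeq (czero r) (CSeq (czero t) (CSeq (CLoop s (CDec r)) (CLoop r (CDec t))))"

text \<open>A loop destroys its counter, hence two negated copies of \<open>v\<close>: one restores
  \<open>v\<close>, the other fills \<open>k\<close>.\<close>

definition ccopy :: "nat \<Rightarrow> nat \<Rightarrow> com" where
  "ccopy v k = CSeq (czero k) (CSeq (czero (k + 1)) (CSeq (czero (k + 2))
     (CSeq (CLoop v (CSeq (CDec (k + 1)) (CDec (k + 2)))) (CSeq (CLoop (k + 1) (CDec v)) (CLoop (k + 2) (CDec k))))))"

lemma exec_czero: "exec B (czero v) \<sigma> = \<sigma>(v := 0)"
proof -
  have "((\<lambda>\<sigma>. \<sigma>(v := \<sigma> v - 1)) ^^ i) \<sigma> = \<sigma>(v := \<sigma> v - i)" for i by (induction i) auto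
  from this[of "\<sigma> v"] show ?thesis unfolding czero_def exec.simps by simp
qed

lemma dec_neg: "0 < B \<Longrightarrow> i < B \<Longrightarrow> ((B - i) mod B + B - 1) mod B = (B - Suc i) mod (B::nat)"
  using pred_mod[of "B - i" B] by (cases "i = 0") auto

lemma neg_neg: "x < B \<Longrightarrow> (B - (B - x) mod B) mod B = (x::nat)"
  by (cases "x = 0") auto

lemma exec_loop_dec:
  assumes "v \<noteq> u" "\<sigma> v < B" "\<sigma> u = 0"
  shows "exec B (CLoop v (CDec u)) \<sigma> = \<sigma>(v := 0, u := (B - \<sigma> v) mod B)"
proof -
  have "((\<lambda>\<sigma>. exec B (CDec u) (\<sigma>(v := \<sigma> v - 1))) ^^ i) \<sigma> = \<sigma>(v := \<sigma> v - i, u := (B - i) mod B)"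
    if "i \<le> \<sigma> v" for i
    using that assms
  proof (induction i)
    case (Suc i)
    then show ?case using dec_neg[of B i] by (auto simp: fun_eq_iff)
  qed auto
  from this[of "\<sigma> v"] show ?thesis by (simp only: exec.simps) simp
qed

lemma exec_loop_dec2:
  assumes "v \<noteq> u" "v \<noteq> u'" "u \<noteq> u'" "\<sigma> v < B" "\<sigma> u = 0" "\<sigma> u' = 0"
  shows "exec B (CLoop v (CSeq (CDec u) (CDec u'))) \<sigma> = \<sigma>(v := 0, u := (B - \<sigma> v) mod B, u' := (B - \<sigma> v) mod B)"
proof -
  have "((\<lambda>\<sigma>. exec B (CSeq (CDec u) (CDec u')) (\<sigma>(v := \<sigma> v - 1))) ^^ i) \<sigma>
    = \<sigma>(v := \<sigma> v - i, u := (B - i) mod B, u' := (B - i) mod B)"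
    if "i \<le> \<sigma> v" for i
    using that assms
  proof (induction i)
    case (Suc i)
    then show ?case using dec_neg[of B i] by (auto simp: fun_eq_iff)
  qed auto
  from this[of "\<sigma> v"] show ?thesis by (simp only: exec.simps) simp
qed

lemma exec_cmove:
  assumes "\<sigma> s < B" "s \<noteq> t" "s \<noteq> r" "t \<noteq> r"
  shows "exec B (cmove s t r) \<sigma> = \<sigma>(s := 0, r := 0, t := \<sigma> s)"
proof -
  have "0 < B" using assms(1) by simp
  then show ?thesis using assms
    by (simp add: cmove_def exec_czero exec_loop_dec neg_neg fun_eq_iff del: exec.simps(2,4))
qed

lemma exec_ccopy:
  assumes "\<sigma> v < B" "v < k"
  shows "exec B (ccopy v k) \<sigma> = \<sigma>(k := \<sigma> v, k + 1 := 0, k + 2 := 0)"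
proof -
  have "0 < B" using assms(1) by simp
  then show ?thesis using assms
    by (simp add: ccopy_def exec_czero exec_loop_dec exec_loop_dec2 neg_neg fun_eq_iff del: exec.simps(2,4))
qed

text \<open>\<open>compile r k t\<close> computes \<open>t\<close> into register \<open>k\<close>, with variable \<open>i\<close> read from register \<open>r i < k\<close>
  and scratch space above \<open>k\<close>.\<close>

fun compile :: "(nat \<Rightarrow> nat) \<Rightarrow> nat \<Rightarrow> trm \<Rightarrow> com" where
  "compile r k (TVar i) = ccopy (r i) k"
| "compile r k TZero = czero k"
| "compile r k (TDec t) = CSeq (compile r k t) (CDec k)"
| "compile r k (TIter n a b f g) =
    CSeq (compile r k a) (CSeq (compile r (k + 1) b) (CSeq (compile r (k + 2) n)
      (CLoop (k + 2) (CSeq (compile (ext2 k (k + 1) r) (k + 3) f) (CSeq (compile (ext2 k (k + 1) r) (k + 4) g)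
        (CSeq (cmove (k + 3) k (k + 5)) (cmove (k + 4) (k + 1) (k + 5))))))))"

text \<open>A stack discipline: the result lands in register \<open>k\<close>, everything below is
  preserved, everything above is scratch space. Preservation is what allows the operands of
  \<open>TIter\<close> to be computed one after the other and its bodies to run on top of the loop
  state.\<close>

lemma exec_compile:
  "0 < B \<Longrightarrow> \<forall>v. \<sigma> v < B \<Longrightarrow> \<forall>i. r i < k \<Longrightarrow>
   exec B (compile r k t) \<sigma> k = eval B t (\<lambda>i. \<sigma> (r i)) \<and> (\<forall>u<k. exec B (compile r k t) \<sigma> u = \<sigma> u)"
proof (induction t arbitrary: r k \<sigma>)
  case (TVar i) then show ?case by (simp add: exec_ccopy)
next
  case TZero then show ?case by (simp add: exec_czero)
next
  case (TDec t) then show ?case by simp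
next
  case (TIter n a b f g)
  note B = TIter.prems(1) and lt = TIter.prems(2) and r = TIter.prems(3)
  define s1 where "s1 = exec B (compile r k a) \<sigma>"
  define s2 where "s2 = exec B (compile r (k + 1) b) s1"
  define s3 where "s3 = exec B (compile r (k + 2) n) s2"
  have l1: "\<forall>v. s1 v < B" unfolding s1_def using exec_less[OF B] lt by blast
  have l2: "\<forall>v. s2 v < B" unfolding s2_def using exec_less[OF B] l1 by blast
  have l3: "\<forall>v. s3 v < B" unfolding s3_def using exec_less[OF B] l2 by blast
  have r': "\<forall>i. r i < k + 1" "\<forall>i. r i < k + 2" using r by (auto intro: less_trans)
  let ?\<rho> = "\<lambda>i. \<sigma> (r i)"
  have 1: "s1 k = eval B a ?\<rho>" "\<And>u. u < k \<Longrightarrow> s1 u = \<sigma> u"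
    using TIter.IH(2)[OF B lt r] by (auto simp: s1_def)
  have 2: "s2 (k + 1) = eval B b ?\<rho>" "\<And>u. u < k + 1 \<Longrightarrow> s2 u = s1 u"
    using TIter.IH(3)[OF B l1 r'(1)] 1(2) r by (auto simp: s2_def)
  have 3: "s3 (k + 2) = eval B n ?\<rho>" "\<And>u. u < k + 2 \<Longrightarrow> s3 u = s2 u"
    using TIter.IH(1)[OF B l2 r'(2)] 1(2) 2(2) r by (auto simp: s3_def less_Suc_eq)
  \<comment> \<open>Both new components are computed from the old pair before either of them is
    overwritten, as the simultaneous update demands.\<close>
  define c where "c = CSeq (compile (ext2 k (k + 1) r) (k + 3) f) (CSeq (compile (ext2 k (k + 1) r) (k + 4) g)
        (CSeq (cmove (k + 3) k (k + 5)) (cmove (k + 4) (k + 1) (k + 5))))"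
  define F where "F = (\<lambda>\<sigma>. exec B c (\<sigma>(k + 2 := \<sigma> (k + 2) - 1)))"
  define G where "G = (\<lambda>(x, y). (eval B f (ext2 x y ?\<rho>), eval B g (ext2 x y ?\<rho>)))"
  have ext: "(\<lambda>i. \<tau> (ext2 k (k + 1) r i)) = ext2 (\<tau> k) (\<tau> (k + 1)) ?\<rho>"
    if "\<And>u. u < k \<Longrightarrow> \<tau> u = \<sigma> u" for \<tau>
    using that r by (auto simp: ext2_def fun_eq_iff split: nat.splits)
  have er: "\<forall>i. ext2 k (k + 1) r i < k + 3" "\<forall>i. ext2 k (k + 1) r i < k + 4"
    using r by (auto simp: ext2_def split: nat.splits intro: trans_less_add1)
  have Fstep: "(\<forall>v. F \<tau> v < B) \<and> (\<forall>u<k. F \<tau> u = \<sigma> u) \<and> (F \<tau> k, F \<tau> (k + 1)) = G (\<tau> k, \<tau> (k + 1))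
      \<and> F \<tau> (k + 2) = \<tau> (k + 2) - 1"
    if \<tau>: "\<forall>v. \<tau> v < B" "\<forall>u<k. \<tau> u = \<sigma> u" for \<tau>
  proof -
    define t0 where "t0 = \<tau>(k + 2 := \<tau> (k + 2) - 1)"
    define t1 where "t1 = exec B (compile (ext2 k (k + 1) r) (k + 3) f) t0"
    define t2 where "t2 = exec B (compile (ext2 k (k + 1) r) (k + 4) g) t1"
    have t0: "\<And>u. u < k \<Longrightarrow> t0 u = \<sigma> u" "t0 k = \<tau> k" "t0 (k + 1) = \<tau> (k + 1)" "t0 (k + 2) = \<tau> (k + 2) - 1"
      using \<tau>(2) by (auto simp: t0_def)
    have m0: "\<forall>v. t0 v < B" using \<tau> by (simp add: t0_def less_imp_diff_less)
    have m1: "\<forall>v. t1 v < B" unfolding t1_def using exec_less[OF B] m0 by blast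
    have m2: "\<forall>v. t2 v < B" unfolding t2_def using exec_less[OF B] m1 by blast
    have e1: "t1 (k + 3) = eval B f (ext2 (\<tau> k) (\<tau> (k + 1)) ?\<rho>)" "\<And>u. u < k + 3 \<Longrightarrow> t1 u = t0 u"
      using TIter.IH(4)[OF B m0 er(1)] ext[of t0, OF t0(1)] t0(2,3) by (simp_all add: t1_def)
    have e2: "t2 (k + 4) = eval B g (ext2 (\<tau> k) (\<tau> (k + 1)) ?\<rho>)" "\<And>u. u < k + 4 \<Longrightarrow> t2 u = t1 u"
      using TIter.IH(5)[OF B m1 er(2)] ext[of t1] e1(2) t0(1-3) by (simp_all add: t2_def)
    have F: "F \<tau> = t2(k + 3 := 0, k + 5 := 0, k := t2 (k + 3), k + 4 := 0, k + 1 := t2 (k + 4))"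
      unfolding F_def c_def exec.simps(3) t0_def[symmetric] t1_def[symmetric] t2_def[symmetric]
      using m2 B by (auto simp: exec_cmove fun_eq_iff)
    have "\<forall>v. F \<tau> v < B" unfolding F using m2 B by auto
    moreover have "(\<forall>u<k. F \<tau> u = \<sigma> u) \<and> (F \<tau> k, F \<tau> (k + 1)) = G (\<tau> k, \<tau> (k + 1))
      \<and> F \<tau> (k + 2) = \<tau> (k + 2) - 1"
      unfolding F using e1 e2 t0 by (auto simp: G_def)
    ultimately show ?thesis by blast
  qed
  have "(\<forall>v. (F ^^ i) s3 v < B) \<and> (\<forall>u<k. (F ^^ i) s3 u = \<sigma> u) \<and>
      ((F ^^ i) s3 k, (F ^^ i) s3 (k + 1)) = (G ^^ i) (eval B a ?\<rho>, eval B b ?\<rho>)" for i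
  proof (induction i)
    case 0
    then show ?case using 1 2 3 l3 by auto
  next
    case (Suc i)
    then show ?case using Fstep[of "(F ^^ i) s3"] by simp
  qed
  note inv = this[of "eval B n ?\<rho>"]
  have "exec B (compile r k (TIter n a b f g)) \<sigma> = (F ^^ eval B n ?\<rho>) s3"
    unfolding compile.simps exec.simps(3) s1_def[symmetric] s2_def[symmetric] s3_def[symmetric] c_def[symmetric]
    unfolding exec.simps(4) F_def[symmetric] 3(1) ..
  then show ?case using inv unfolding eval.simps G_def[symmetric] by (metis fst_conv)
qed

lemma writes_czero: "writes (czero v) = {v}" by (simp add: czero_def)

text \<open>\<open>ccopy\<close> empties the register of a variable for a moment and refills it, so
  \<open>range r\<close> counts as written although its values survive. The loop counter
  \<open>k + 2\<close> of \<open>TIter\<close> is neither the register of a variable nor at or above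
  \<open>k + 3\<close>; hence the bodies do not write it.\<close>

lemma writes_compile: "(\<And>i. r i < k) \<Longrightarrow> writes (compile r k t) \<subseteq> {k..} \<union> range r"
proof (induction t arbitrary: r k)
  case (TIter n a b f g)
  have r: "r i < k + 1" "r i < k + 2" for i using TIter.prems[of i] by auto
  have er: "ext2 k (k + 1) r i < k + 3" "ext2 k (k + 1) r i < k + 4" for i
    using TIter.prems by (auto simp: ext2_def split: nat.splits intro: trans_less_add1)
  have rg: "range (ext2 k (k + 1) r) \<subseteq> {k..} \<union> range r"
    by (auto simp: ext2_def split: nat.splits)
  let ?S = "{k..} \<union> range r"
  have sub: "A \<subseteq> ?S" if "A \<subseteq> {k + j..} \<union> range r'" "range r' \<subseteq> ?S" for A j r'
    using that by (meson Un_least Un_upper1 atLeast_subset_iff le_add1 order_trans)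
  have "writes (compile r k a) \<subseteq> ?S" "writes (compile r (k + 1) b) \<subseteq> ?S" "writes (compile r (k + 2) n) \<subseteq> ?S"
    using TIter.IH(2)[OF TIter.prems] sub[OF TIter.IH(3)[OF r(1)]] sub[OF TIter.IH(1)[OF r(2)]] by auto
  moreover have "writes (compile (ext2 k (k + 1) r) (k + 3) f) \<subseteq> ?S"
    "writes (compile (ext2 k (k + 1) r) (k + 4) g) \<subseteq> ?S"
    using sub[OF TIter.IH(4)[OF er(1)] rg] sub[OF TIter.IH(5)[OF er(2)] rg] by auto
  ultimately show ?case by (simp add: cmove_def writes_czero)
qed (auto simp: ccopy_def writes_czero)

lemma wf_com_mono: "wf_com K c \<Longrightarrow> K \<le> K' \<Longrightarrow> wf_com K' c"
  by (induction c) auto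

lemma wf_compile: "(\<And>i. r i < k) \<Longrightarrow> \<exists>K. wf_com K (compile r k t)"
proof (induction t arbitrary: r k)
  case (TVar i)
  then have "r i < k" by simp
  then show ?case by (intro exI[of _ "k + 3"]) (auto simp: ccopy_def czero_def)
next
  case TZero then show ?case by (intro exI[of _ "k + 1"]) (auto simp: czero_def)
next
  case (TDec t)
  then obtain K where "wf_com K (compile r k t)" by blast
  then show ?case by (intro exI[of _ "K + k + 1"]) (auto intro: wf_com_mono)
next
  case (TIter n a b f g)
  have r: "r i < k + 1" "r i < k + 2" for i using TIter.prems[of i] by auto
  have er: "ext2 k (k + 1) r i < k + 3" "ext2 k (k + 1) r i < k + 4" "ext2 k (k + 1) r i < k + 2" for i
    using TIter.prems by (auto simp: ext2_def split: nat.splits intro: trans_less_add1 less_SucI)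
  obtain K1 K2 K3 K4 K5 where K: "wf_com K1 (compile r k a)" "wf_com K2 (compile r (k + 1) b)"
    "wf_com K3 (compile r (k + 2) n)" "wf_com K4 (compile (ext2 k (k + 1) r) (k + 3) f)"
    "wf_com K5 (compile (ext2 k (k + 1) r) (k + 4) g)"
    using TIter.IH TIter.prems r er by metis
  have "k + 2 \<notin> writes (compile (ext2 k (k + 1) r) (k + 3) f)"
    "k + 2 \<notin> writes (compile (ext2 k (k + 1) r) (k + 4) g)"
    using writes_compile[of "ext2 k (k + 1) r" "k + 3" f] writes_compile[of "ext2 k (k + 1) r" "k + 4" g] er
    by fastforce+
  then show ?case using K
    by (intro exI[of _ "K1 + K2 + K3 + K4 + K5 + k + 6"])
       (auto simp: cmove_def czero_def intro: wf_com_mono)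
qed

text \<open>Only four registers hold input. Variables from 4 on are read from register 0, since the
  compiler wants every variable below the result register 4.\<close>

lemma in_PSPACE_trm:
  "in_PSPACE {w. w \<noteq> [] \<and> eval (2 ^ ((C + 1) * length w)) t (\<lambda>i. input_reg w (if i < 4 then i else 0)) \<noteq> 0}"
proof -
  define r where "r i = (if i < 4 then i else 0)" for i :: nat
  have r: "r i < 4" for i by (simp add: r_def)
  then obtain K where "wf_com K (compile r 4 t)" using wf_compile[of r 4 t] by blast
  then have K: "wf_com (K + 5) (compile r 4 t)" by (rule wf_com_mono) simp
  have "exec (2 ^ ((C + 1) * length w)) (compile r 4 t) (input_reg w) 4
      = eval (2 ^ ((C + 1) * length w)) t (\<lambda>i. input_reg w (r i))" for w
  proof -
    have "input_reg w v < 2 ^ ((C + 1) * length w)" for v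
    proof -
      have "take_bit ((C + 1) * length w) (input_reg w v) = input_reg w v"
        by (rule bit_eqI) (auto simp: bit_take_bit_iff bit_input_reg)
      then show ?thesis by (simp only: take_bit_nat_eq_self_iff)
    qed
    then show ?thesis using exec_compile[of "2 ^ ((C + 1) * length w)" "input_reg w" r 4 t] r by simp
  qed
  then show ?thesis using in_PSPACE_com[OF K, of 4 C] unfolding r_def by simp
qed

section \<open>Renaming and substitution of terms\<close>

fun rename :: "(nat \<Rightarrow> nat) \<Rightarrow> trm \<Rightarrow> trm" where
  "rename r (TVar i) = TVar (r i)"
| "rename r TZero = TZero"
| "rename r (TDec t) = TDec (rename r t)"
| "rename r (TIter n a b f g) = TIter (rename r n) (rename r a) (rename r b)
     (rename (ext2 0 1 (\<lambda>i. r i + 2)) f) (rename (ext2 0 1 (\<lambda>i. r i + 2)) g)"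

lemma ext2_rename: "(\<lambda>i. ext2 x y \<rho> (ext2 0 1 (\<lambda>i. r i + 2) i)) = ext2 x y (\<lambda>i. \<rho> (r i))"
  by (auto simp: ext2_def fun_eq_iff split: nat.splits)

lemma eval_rename: "eval B (rename r t) \<rho> = eval B t (\<lambda>i. \<rho> (r i))"
  by (induction t arbitrary: r \<rho>) (simp_all add: ext2_rename[simplified])

definition lift_sub :: "(nat \<Rightarrow> trm) \<Rightarrow> nat \<Rightarrow> trm" where
  "lift_sub s = case_nat (TVar 0) (case_nat (TVar 1) (\<lambda>i. rename (\<lambda>j. j + 2) (s i)))"

fun subst :: "(nat \<Rightarrow> trm) \<Rightarrow> trm \<Rightarrow> trm" where
  "subst s (TVar i) = s i"
| "subst s TZero = TZero"
| "subst s (TDec t) = TDec (subst s t)"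
| "subst s (TIter n a b f g) = TIter (subst s n) (subst s a) (subst s b) (subst (lift_sub s) f) (subst (lift_sub s) g)"

lemma ext2_lift_sub: "(\<lambda>i. eval B (lift_sub s i) (ext2 x y \<rho>)) = ext2 x y (\<lambda>i. eval B (s i) \<rho>)"
  by (auto simp: ext2_def lift_sub_def fun_eq_iff eval_rename split: nat.splits)

lemma eval_subst: "eval B (subst s t) \<rho> = eval B t (\<lambda>i. eval B (s i) \<rho>)"
  by (induction t arbitrary: s \<rho>) (simp_all add: ext2_lift_sub)

section \<open>Functions computable in polynomial space\<close>

text \<open>The functions computable in polynomial space, shallowly embedded: \<open>B\<close> bounds all registers and the
  environment holds the arguments.  Small \<open>B\<close> are excluded so that numeric constants fit.\<close>

definition psp :: "(nat \<Rightarrow> (nat \<Rightarrow> nat) \<Rightarrow> nat) \<Rightarrow> bool" where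
  "psp f \<longleftrightarrow> (\<exists>t. \<forall>B \<rho>. 1024 \<le> B \<longrightarrow> (\<forall>i. \<rho> i < B) \<longrightarrow> eval B t \<rho> = f B \<rho>)"

abbreviation pspP :: "(nat \<Rightarrow> (nat \<Rightarrow> nat) \<Rightarrow> bool) \<Rightarrow> bool" where
  "pspP P \<equiv> psp (\<lambda>B \<rho>. of_bool (P B \<rho>))"

named_theorems psp_intros

lemma pspI: "(\<And>B \<rho>. 1024 \<le> B \<Longrightarrow> \<forall>i. \<rho> i < B \<Longrightarrow> eval B t \<rho> = f B \<rho>) \<Longrightarrow> psp f"
  unfolding psp_def by blast

lemma pspE:
  assumes "psp f"
  obtains t where "\<And>B \<rho>. 1024 \<le> B \<Longrightarrow> \<forall>i. \<rho> i < B \<Longrightarrow> eval B t \<rho> = f B \<rho>"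
  using assms unfolding psp_def by blast

text \<open>The value is that of a term, and terms evaluate below \<open>B\<close>; closure lemmas
  therefore need no hypotheses about the size of their operands.\<close>

lemma psp_less: "psp f \<Longrightarrow> 1024 \<le> B \<Longrightarrow> \<forall>i. \<rho> i < B \<Longrightarrow> f B \<rho> < B"
  by (metis pspE eval_less less_le_trans zero_less_numeral)

lemma psp_cong:
  assumes "psp f" "\<And>B \<rho>. 1024 \<le> B \<Longrightarrow> \<forall>i. \<rho> i < B \<Longrightarrow> f B \<rho> = g B \<rho>"
  shows "psp g"
  using assms unfolding psp_def by metis

lemma psp_var [psp_intros]: "psp (\<lambda>B \<rho>. \<rho> i)"
  by (rule pspI[of "TVar i"]) simp

lemma psp_zero [psp_intros]: "psp (\<lambda>B \<rho>. 0)"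
  by (rule pspI[of TZero]) simp

lemma psp_subst:
  assumes "psp h" "\<And>i. psp (F i)"
  shows "psp (\<lambda>B \<rho>. h B (\<lambda>i. F i B \<rho>))"
proof -
  obtain t where t: "\<And>B \<rho>. 1024 \<le> B \<Longrightarrow> \<forall>i. \<rho> i < B \<Longrightarrow> eval B t \<rho> = h B \<rho>"
    using assms(1) by (rule pspE) blast
  obtain s where s: "\<And>i B \<rho>. 1024 \<le> B \<Longrightarrow> \<forall>i. \<rho> i < B \<Longrightarrow> eval B (s i) \<rho> = F i B \<rho>"
    using assms(2) unfolding psp_def by metis
  show ?thesis
  proof (rule pspI[of "subst s t"])
    fix B :: nat and \<rho> :: "nat \<Rightarrow> nat" assume B: "1024 \<le> B" "\<forall>i. \<rho> i < B"
    then have "\<forall>i. F i B \<rho> < B" using psp_less[OF assms(2)] by simp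
    then show "eval B (subst s t) \<rho> = h B (\<lambda>i. F i B \<rho>)"
      using t[OF B(1), of "\<lambda>i. F i B \<rho>"] by (simp add: eval_subst s[OF B])
  qed
qed

lemma psp_weaken: "psp f \<Longrightarrow> psp (\<lambda>B \<rho>. f B (\<lambda>i. \<rho> (r i)))"
  by (rule psp_subst[where F = "\<lambda>i B \<rho>. \<rho> (r i)"]) (auto intro: psp_intros)

lemma psp_subst1:
  "psp (\<lambda>B \<rho>. h B (\<rho> 0)) \<Longrightarrow> psp f \<Longrightarrow> psp (\<lambda>B \<rho>. h B (f B \<rho>))"
  by (drule psp_subst[where F = "\<lambda>_. f"])

text \<open>A function of several arguments can thus be treated with variables as arguments first.
  Under a binder a variable only has its index shifted, whereas an arbitrary argument would have to
  be weakened in each nested iteration.\<close>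

lemma psp_subst_list:
  assumes "psp (\<lambda>B \<rho>. h B \<rho>)" "list_all psp fs"
  shows "psp (\<lambda>B \<rho>. h B (\<lambda>i. if i < length fs then (fs ! i) B \<rho> else 0))"
proof -
  have "psp (if i < length fs then fs ! i else (\<lambda>B \<rho>. 0))" for i
    using assms(2) by (auto simp: list_all_length intro: psp_intros)
  from psp_subst[OF assms(1) this] show ?thesis
    by (rule psp_cong) (auto intro!: arg_cong[where f = "h _"])
qed

lemma psp_subst3:
  assumes "psp (\<lambda>B \<rho>. h B (\<rho> 0) (\<rho> (Suc 0)) (\<rho> 2))" "psp f" "psp g" "psp k"
  shows "psp (\<lambda>B \<rho>. h B (f B \<rho>) (g B \<rho>) (k B \<rho>))"
  using psp_subst_list[OF assms(1), of "[f, g, k]"] assms(2-) by simp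

text \<open>The conclusion determines \<open>f\<close> and \<open>g\<close> by higher-order
  matching. In the premises the bound pair then occupies variables 0 and 1 and the outer environment
  appears shifted by two, ready for further introduction rules.\<close>

lemma psp_iter2:
  assumes "psp n" "psp a" "psp b"
    "psp (\<lambda>B \<rho>. f B (\<lambda>i. \<rho> (Suc (Suc i))) (\<rho> 0) (\<rho> (Suc 0)))"
    "psp (\<lambda>B \<rho>. g B (\<lambda>i. \<rho> (Suc (Suc i))) (\<rho> 0) (\<rho> (Suc 0)))"
  shows "psp (\<lambda>B \<rho>. fst (((\<lambda>(x, y). (f B \<rho> x y, g B \<rho> x y)) ^^ n B \<rho>) (a B \<rho>, b B \<rho>)))"
proof -
  obtain tn where tn: "\<And>B \<rho>. 1024 \<le> B \<Longrightarrow> \<forall>i. \<rho> i < B \<Longrightarrow> eval B tn \<rho> = n B \<rho>"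
    using assms(1) by (rule pspE) blast
  obtain ta where ta: "\<And>B \<rho>. 1024 \<le> B \<Longrightarrow> \<forall>i. \<rho> i < B \<Longrightarrow> eval B ta \<rho> = a B \<rho>"
    using assms(2) by (rule pspE) blast
  obtain tb where tb: "\<And>B \<rho>. 1024 \<le> B \<Longrightarrow> \<forall>i. \<rho> i < B \<Longrightarrow> eval B tb \<rho> = b B \<rho>"
    using assms(3) by (rule pspE) blast
  obtain tf where tf: "\<And>B \<rho>. 1024 \<le> B \<Longrightarrow> \<forall>i. \<rho> i < B \<Longrightarrow> eval B tf \<rho> = f B (\<lambda>i. \<rho> (Suc (Suc i))) (\<rho> 0) (\<rho> (Suc 0))"
    using assms(4) by (rule pspE) blast
  obtain tg where tg: "\<And>B \<rho>. 1024 \<le> B \<Longrightarrow> \<forall>i. \<rho> i < B \<Longrightarrow> eval B tg \<rho> = g B (\<lambda>i. \<rho> (Suc (Suc i))) (\<rho> 0) (\<rho> (Suc 0))"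
    using assms(5) by (rule pspE) blast
  show ?thesis
  proof (rule pspI[of "TIter tn ta tb tf tg"])
    fix B :: nat and \<rho> :: "nat \<Rightarrow> nat" assume B: "1024 \<le> B" "\<forall>i. \<rho> i < B"
    then have "0 < B" by simp
    define F where "F = (\<lambda>(x, y). (eval B tf (ext2 x y \<rho>), eval B tg (ext2 x y \<rho>)))"
    define G where "G = (\<lambda>(x, y). (f B \<rho> x y, g B \<rho> x y))"
    have ab: "eval B ta \<rho> < B" "eval B tb \<rho> < B" using B \<open>0 < B\<close> by (auto intro: eval_less)
    have "(F ^^ i) (eval B ta \<rho>, eval B tb \<rho>) = (G ^^ i) (eval B ta \<rho>, eval B tb \<rho>)
      \<and> fst ((F ^^ i) (eval B ta \<rho>, eval B tb \<rho>)) < B \<and> snd ((F ^^ i) (eval B ta \<rho>, eval B tb \<rho>)) < B" for i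
    proof (induction i)
      case (Suc i)
      obtain x y where xy: "(F ^^ i) (eval B ta \<rho>, eval B tb \<rho>) = (x, y)" by fastforce
      then have "x < B" "y < B" using Suc by auto
      then have e: "\<forall>i. ext2 x y \<rho> i < B" using ext2_less B(2) by blast
      have [simp]: "ext2 x y \<rho> 0 = x" "ext2 x y \<rho> (Suc 0) = y" "(\<lambda>i. ext2 x y \<rho> (Suc (Suc i))) = \<rho>"
        by (auto simp: ext2_def)
      have "F (x, y) = G (x, y)" unfolding F_def G_def using tf[OF B(1) e] tg[OF B(1) e] by simp
      moreover have "fst (F (x, y)) < B" "snd (F (x, y)) < B"
        unfolding F_def using e \<open>0 < B\<close> by (auto intro: eval_less)
      ultimately show ?case using Suc xy by simp
    qed (use ab in simp)
    then show "eval B (TIter tn ta tb tf tg) \<rho> = fst (((\<lambda>(x, y). (f B \<rho> x y, g B \<rho> x y)) ^^ n B \<rho>) (a B \<rho>, b B \<rho>))"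
      using tn[OF B] ta[OF B] tb[OF B] unfolding eval.simps F_def[symmetric] G_def[symmetric] by simp
  qed
qed

text \<open>Exchanging the two components reduces the second projection to the first.\<close>

lemma psp_iter2_snd:
  assumes "psp n" "psp a" "psp b"
    "psp (\<lambda>B \<rho>. f B (\<lambda>i. \<rho> (Suc (Suc i))) (\<rho> 0) (\<rho> (Suc 0)))"
    "psp (\<lambda>B \<rho>. g B (\<lambda>i. \<rho> (Suc (Suc i))) (\<rho> 0) (\<rho> (Suc 0)))"
  shows "psp (\<lambda>B \<rho>. snd (((\<lambda>(x, y). (f B \<rho> x y, g B \<rho> x y)) ^^ n B \<rho>) (a B \<rho>, b B \<rho>)))"
proof -
  let ?r = "\<lambda>i. if i = 0 then Suc 0 else if i = Suc 0 then 0 else i"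
  have swap: "fst (((\<lambda>(y, x). (g x y, f x y)) ^^ m) (y, x)) = snd (((\<lambda>(x, y). (f x y, g x y)) ^^ m) (x, y)) \<and>
      snd (((\<lambda>(y, x). (g x y, f x y)) ^^ m) (y, x)) = fst (((\<lambda>(x, y). (f x y, g x y)) ^^ m) (x, y))"
    for f g :: "nat \<Rightarrow> nat \<Rightarrow> nat" and m x y
    by (induction m) (auto split: prod.splits)
  have "psp (\<lambda>B \<rho>. fst (((\<lambda>(y, x). (g B \<rho> x y, f B \<rho> x y)) ^^ n B \<rho>) (b B \<rho>, a B \<rho>)))"
    by (rule psp_iter2[where f = "\<lambda>B \<rho> y x. g B \<rho> x y" and g = "\<lambda>B \<rho> y x. f B \<rho> x y", OF assms(1,3,2)
        psp_weaken[OF assms(5), of ?r, simplified] psp_weaken[OF assms(4), of ?r, simplified]])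
  then show ?thesis by (rule psp_cong) (rule conjunct1[OF swap])
qed

lemma psp_iter:
  assumes "psp n" "psp a" "psp (\<lambda>B \<rho>. f B (\<lambda>i. \<rho> (Suc i)) (\<rho> 0))"
  shows "psp (\<lambda>B \<rho>. (f B \<rho> ^^ n B \<rho>) (a B \<rho>))"
proof -
  let ?r = "\<lambda>i. if i = 0 then 0 else Suc i"
  have "psp (\<lambda>B \<rho>. fst (((\<lambda>(x, y). (f B \<rho> x, 0 :: nat)) ^^ n B \<rho>) (a B \<rho>, 0 :: nat)))"
    by (rule psp_iter2[where f = "\<lambda>B \<rho> x y. f B \<rho> x" and g = "\<lambda>B \<rho> x y. 0", OF assms(1,2) psp_zero
        psp_weaken[OF assms(3), of ?r, simplified] psp_zero])
  moreover have "fst (((\<lambda>(x, y). (h x, 0 :: nat)) ^^ m) (x, y)) = (h ^^ m) x" for h :: "nat \<Rightarrow> nat" and m x and y :: nat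
    by (induction m) (auto split: prod.splits)
  ultimately show ?thesis by simp
qed

text \<open>Iterating the constant function with value \<open>g\<close> zero times leaves
  \<open>f\<close>, and any positive number of times gives \<open>g\<close>.\<close>

lemma psp_if_zero:
  assumes "psp c" "psp f" "psp g"
  shows "psp (\<lambda>B \<rho>. if c B \<rho> = 0 then f B \<rho> else g B \<rho>)"
proof -
  have "psp (\<lambda>B \<rho>. ((\<lambda>_. g B \<rho>) ^^ c B \<rho>) (f B \<rho>))"
    by (rule psp_iter[where f = "\<lambda>B \<rho> _. g B \<rho>", OF assms(1,2) psp_weaken[OF assms(3)]])
  moreover have "((\<lambda>_. y) ^^ m) x = (if m = 0 then x else y)" for m and x y :: nat
    by (cases m) auto
  ultimately show ?thesis by simp
qed

section \<open>Arithmetic, comparisons and logical connectives\<close>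

lemma psp_dec:
  assumes "psp f" shows "psp (\<lambda>B \<rho>. (f B \<rho> + B - 1) mod B)"
proof -
  obtain t where "\<And>B \<rho>. 1024 \<le> B \<Longrightarrow> \<forall>i. \<rho> i < B \<Longrightarrow> eval B t \<rho> = f B \<rho>"
    using assms by (rule pspE) blast
  then show ?thesis by (intro pspI[of "TDec t"]) simp
qed

lemma psp_top [psp_intros]: "psp (\<lambda>B \<rho>. B - 1)"
  by (rule psp_cong[OF psp_dec[OF psp_zero]]) simp

lemma psp_sub_mod:
  assumes "psp f" "psp g" shows "psp (\<lambda>B \<rho>. (f B \<rho> + B - g B \<rho>) mod B)"
proof (rule psp_cong)
  show "psp (\<lambda>B \<rho>. ((\<lambda>x. (x + B - 1) mod B) ^^ g B \<rho>) (f B \<rho>))"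
    by (rule psp_iter[OF assms(2,1)]) (rule psp_dec[OF psp_var])
  fix B :: nat and \<rho> :: "nat \<Rightarrow> nat" assume B: "1024 \<le> B" "\<forall>i. \<rho> i < B"
  have "((\<lambda>x. (x + B - 1) mod B) ^^ m) x = (x + B - m) mod B" if "x < B" "m \<le> B" for x m
    using that
  proof (induction m)
    case (Suc m)
    have "((x + B - m) mod B + B - 1) mod B = ((x + B - m) mod B + (B - 1)) mod B" using B(1) by simp
    also have "\<dots> = ((x + B - m) + (B - 1)) mod B" by (rule mod_add_left_eq)
    also have "(x + B - m) + (B - 1) = (x + B - Suc m) + B" using Suc.prems B(1) by linarith
    finally have "((x + B - m) mod B + B - 1) mod B = (x + B - Suc m) mod B" by (simp only: mod_add_self2)
    then show ?case using Suc by (simp only: funpow.simps comp_apply Suc_leD)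
  qed simp
  then show "((\<lambda>x. (x + B - 1) mod B) ^^ g B \<rho>) (f B \<rho>) = (f B \<rho> + B - g B \<rho>) mod B"
    using psp_less[OF assms(1) B] psp_less[OF assms(2) B] by simp
qed

lemma psp_add:
  assumes "psp f" "psp g" shows "psp (\<lambda>B \<rho>. (f B \<rho> + g B \<rho>) mod B)"
proof (rule psp_cong)
  show "psp (\<lambda>B \<rho>. (f B \<rho> + B - (0 + B - g B \<rho>) mod B) mod B)"
    by (intro psp_sub_mod assms psp_zero)
  fix B :: nat and \<rho> :: "nat \<Rightarrow> nat" assume B: "1024 \<le> B" "\<forall>i. \<rho> i < B"
  show "(f B \<rho> + B - (0 + B - g B \<rho>) mod B) mod B = (f B \<rho> + g B \<rho>) mod B"
    using psp_less[OF assms(1) B] psp_less[OF assms(2) B] by (cases "g B \<rho> = 0") auto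
qed

text \<open>1 is \<open>0 - (B - 1)\<close> modulo \<open>B\<close>, and larger constants are
  repeated sums; \<open>c < 1024 \<le> B\<close> excludes a wrap-around.\<close>

lemma psp_const: "c < 1024 \<Longrightarrow> psp (\<lambda>B \<rho>. c)"
proof (induction c)
  case 0 show ?case by (rule psp_zero)
next
  case (Suc c)
  have 1: "psp (\<lambda>B \<rho>. 1)"
    by (rule psp_cong[OF psp_sub_mod[OF psp_zero psp_top]]) simp
  have "psp (\<lambda>B \<rho>. (c + 1) mod B)" by (rule psp_add[OF _ 1]) (use Suc in auto)
  then show ?case by (rule psp_cong) (use Suc in auto)
qed

lemma psp_one [psp_intros]: "psp (\<lambda>B \<rho>. 1)" "psp (\<lambda>B \<rho>. Suc 0)"
  using psp_const[of 1] by simp_all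

lemma psp_numeral [psp_intros]: "numeral n < (1024::nat) \<Longrightarrow> psp (\<lambda>B \<rho>. numeral n)"
  by (rule psp_const)

lemma psp_not [psp_intros]: "pspP P \<Longrightarrow> pspP (\<lambda>B \<rho>. \<not> P B \<rho>)"
  by (rule psp_cong[OF psp_if_zero[OF _ psp_one(1) psp_zero]]) auto

lemma psp_if [psp_intros]:
  "pspP P \<Longrightarrow> psp f \<Longrightarrow> psp g \<Longrightarrow> psp (\<lambda>B \<rho>. if P B \<rho> then f B \<rho> else g B \<rho>)"
  by (rule psp_cong[OF psp_if_zero[of "\<lambda>B \<rho>. of_bool (P B \<rho>)" g f]]) auto

lemma psp_conj [psp_intros]: "pspP P \<Longrightarrow> pspP Q \<Longrightarrow> pspP (\<lambda>B \<rho>. P B \<rho> \<and> Q B \<rho>)"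
  by (rule psp_cong[OF psp_if[of P "\<lambda>B \<rho>. of_bool (Q B \<rho>)", OF _ _ psp_zero]]) auto

lemma psp_disj [psp_intros]: "pspP P \<Longrightarrow> pspP Q \<Longrightarrow> pspP (\<lambda>B \<rho>. P B \<rho> \<or> Q B \<rho>)"
  by (rule psp_cong[OF psp_if[of P _ "\<lambda>B \<rho>. of_bool (Q B \<rho>)", OF _ psp_one(1)]]) auto

lemma psp_imp [psp_intros]: "pspP P \<Longrightarrow> pspP Q \<Longrightarrow> pspP (\<lambda>B \<rho>. P B \<rho> \<longrightarrow> Q B \<rho>)"
  by (rule psp_cong[OF psp_disj[of "\<lambda>B \<rho>. \<not> P B \<rho>" Q, OF psp_not]]) auto

lemma psp_monus [psp_intros]:
  assumes "psp f" "psp g" shows "psp (\<lambda>B \<rho>. f B \<rho> - g B \<rho>)"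
proof -
  have pred: "psp (\<lambda>B \<rho>. h B \<rho> - 1)" if "psp h" for h
  proof (rule psp_cong[OF psp_if_zero[OF that psp_zero psp_dec[OF that]]])
    fix B :: nat and \<rho> :: "nat \<Rightarrow> nat" assume B: "1024 \<le> B" "\<forall>i. \<rho> i < B"
    show "(if h B \<rho> = 0 then 0 else (h B \<rho> + B - 1) mod B) = h B \<rho> - 1"
      using pred_mod[OF _ psp_less[OF that B]] by simp
  qed
  have "psp (\<lambda>B \<rho>. ((\<lambda>x. x - 1) ^^ g B \<rho>) (f B \<rho>))"
    by (rule psp_iter[OF assms(2,1)]) (rule pred[OF psp_var])
  moreover have "((\<lambda>x. x - 1) ^^ m) x = x - m" for x m :: nat by (induction m) auto
  ultimately show ?thesis by simp
qed

lemma psp_le [psp_intros]: "psp f \<Longrightarrow> psp g \<Longrightarrow> pspP (\<lambda>B \<rho>. f B \<rho> \<le> g B \<rho>)"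
  by (rule psp_cong[OF psp_if_zero[OF psp_monus[of f g] psp_one(1) psp_zero]]) auto

lemma psp_less_than [psp_intros]: "psp f \<Longrightarrow> psp g \<Longrightarrow> pspP (\<lambda>B \<rho>. f B \<rho> < g B \<rho>)"
  by (rule psp_cong[OF psp_not[OF psp_le[of g f]]]) (auto simp: not_le)

lemma psp_eq [psp_intros]: "psp f \<Longrightarrow> psp g \<Longrightarrow> pspP (\<lambda>B \<rho>. f B \<rho> = g B \<rho>)"
  by (rule psp_cong[OF psp_conj[OF psp_le[of f g] psp_le[of g f]]]) auto

declare psp_add [psp_intros]

lemma psp_mult [psp_intros]:
  assumes "psp f" "psp g" shows "psp (\<lambda>B \<rho>. (f B \<rho> * g B \<rho>) mod B)"
proof -
  have "psp (\<lambda>B \<rho>. ((\<lambda>x. (x + g B \<rho>) mod B) ^^ f B \<rho>) 0)"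
    by (rule psp_iter[where f = "\<lambda>B \<rho> x. (x + g B \<rho>) mod B"])
       (intro assms psp_zero psp_add psp_var psp_weaken[OF assms(2), of Suc])+
  moreover have "((\<lambda>x. (x + y) mod B) ^^ m) 0 = (m * y) mod B" for B m y :: nat
    by (induction m) (simp_all add: mod_simps add.commute)
  ultimately show ?thesis by simp
qed

text \<open>Counting up to \<open>x\<close> with a carry at \<open>d\<close>. For
  \<open>d = 0\<close> the carry never occurs, because \<open>r + 1\<close> stays positive below
  \<open>B\<close>; the result is quotient 0 and remainder \<open>x\<close>, in agreement with the
  convention of HOL.\<close>

lemma divmod_iter:
  fixes d B :: nat
  assumes "x < B"
  shows "((\<lambda>(q, r). if (r + 1) mod B = d then ((q + 1) mod B, 0) else (q, (r + 1) mod B)) ^^ x) (0 :: nat, 0 :: nat) = (x div d, x mod d)"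
  using assms
proof (induction x)
  case (Suc x)
  have "x mod d + 1 < B" using Suc.prems mod_less_eq_dividend[of x d] by linarith
  moreover have "x div d + 1 < B" using Suc.prems div_le_dividend[of x d] by linarith
  ultimately show ?case using Suc by (auto simp: div_Suc mod_Suc)
qed simp

lemma psp_div_mod:
  assumes "psp f" "psp g"
  shows psp_div: "psp (\<lambda>B \<rho>. f B \<rho> div g B \<rho>)" and psp_mod: "psp (\<lambda>B \<rho>. f B \<rho> mod g B \<rho>)"
proof -
  note w = psp_weaken[OF assms(2), of "\<lambda>i. Suc (Suc i)"]
  let ?q = "\<lambda>(B::nat) d q r. if (r + 1) mod B = d then (q + 1) mod B else q :: nat"
  let ?r = "\<lambda>(B::nat) d q r. if (r + 1) mod B = d then 0 else (r + 1) mod B :: nat"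
  have eq: "((\<lambda>(q, r). (?q B d q r, ?r B d q r)) ^^ x) (0 :: nat, 0 :: nat) = (x div d, x mod d)" if "x < B" for B d x :: nat
  proof -
    have "(\<lambda>(q, r). (?q B d q r, ?r B d q r)) = (\<lambda>(q, r). if (r + 1) mod B = d then ((q + 1) mod B, 0) else (q, (r + 1) mod B))"
      by (auto simp: fun_eq_iff)
    then show ?thesis using divmod_iter[OF that] by simp
  qed
  have "psp (\<lambda>B \<rho>. fst (((\<lambda>(q, r). (?q B (g B \<rho>) q r, ?r B (g B \<rho>) q r)) ^^ f B \<rho>) (0 :: nat, 0 :: nat)))"
    by (rule psp_iter2; (intro psp_intros assms w)?)
  then show "psp (\<lambda>B \<rho>. f B \<rho> div g B \<rho>)"
    by (rule psp_cong) (subst eq, erule (1) psp_less[OF assms(1)], simp only: fst_conv snd_conv)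
  have "psp (\<lambda>B \<rho>. snd (((\<lambda>(q, r). (?q B (g B \<rho>) q r, ?r B (g B \<rho>) q r)) ^^ f B \<rho>) (0 :: nat, 0 :: nat)))"
    by (rule psp_iter2_snd; (intro psp_intros assms w)?)
  then show "psp (\<lambda>B \<rho>. f B \<rho> mod g B \<rho>)"
    by (rule psp_cong) (subst eq, erule (1) psp_less[OF assms(1)], simp only: fst_conv snd_conv)
qed

lemma psp_dvd [psp_intros]: "psp f \<Longrightarrow> psp g \<Longrightarrow> pspP (\<lambda>B \<rho>. f B \<rho> dvd g B \<rho>)"
  by (rule psp_cong[OF psp_eq[OF psp_mod[of g f] psp_zero]]) (auto simp: mod_eq_0_iff_dvd)

text \<open>The search state is a flag and the current candidate. The bound is a register value,
  hence below \<open>B\<close>, so the candidate does not wrap around.\<close>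

lemma psp_ex [psp_intros]:
  assumes m: "psp m" and P: "pspP (\<lambda>B \<rho>. P B (\<lambda>i. \<rho> (Suc i)) (\<rho> 0))"
  shows "pspP (\<lambda>B \<rho>. \<exists>y<m B \<rho>. P B \<rho> y)"
proof (rule psp_cong)
  let ?r = "\<lambda>i. if i = 0 then Suc 0 else Suc i"
  have P': "pspP (\<lambda>B \<rho>. P B (\<lambda>i. \<rho> (Suc (Suc i))) (\<rho> (Suc 0)))"
    using psp_weaken[OF P, of ?r] by simp
  show "psp (\<lambda>B \<rho>. fst (((\<lambda>(x, y). (of_bool (x = 1 \<or> P B \<rho> y) :: nat, (y + 1) mod B)) ^^ m B \<rho>) (0 :: nat, 0)))"
    by (rule psp_iter2; intro psp_intros m P')
  fix B :: nat and \<rho> :: "nat \<Rightarrow> nat" assume B: "1024 \<le> B" "\<forall>i. \<rho> i < B"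
  have "((\<lambda>(x, y). (of_bool (x = 1 \<or> P B \<rho> y) :: nat, (y + 1) mod B)) ^^ k) (0 :: nat, 0) = (of_bool (\<exists>y<k. P B \<rho> y), k)"
    if "k < B" for k
    using that by (induction k) (auto simp: less_Suc_eq)
  from this[OF psp_less[OF m B]]
  show "fst (((\<lambda>(x, y). (of_bool (x = 1 \<or> P B \<rho> y) :: nat, (y + 1) mod B)) ^^ m B \<rho>) (0 :: nat, 0)) = of_bool (\<exists>y<m B \<rho>. P B \<rho> y)"
    by simp
qed

lemma psp_all [psp_intros]:
  assumes m: "psp m" and P: "pspP (\<lambda>B \<rho>. P B (\<lambda>i. \<rho> (Suc i)) (\<rho> 0))"
  shows "pspP (\<lambda>B \<rho>. \<forall>y<m B \<rho>. P B \<rho> y)"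
  by (rule psp_cong[OF psp_not[OF psp_ex[OF m psp_not[OF P]]]]) auto

text \<open>The power may be far above \<open>B\<close>; dividing by \<open>d\<close> repeatedly
  avoids computing it.\<close>

lemma psp_funpow_div: "psp f \<Longrightarrow> psp g \<Longrightarrow> 0 < d \<Longrightarrow> d < 1024 \<Longrightarrow> psp (\<lambda>B \<rho>. f B \<rho> div d ^ g B \<rho>)"
proof -
  assume a: "psp f" "psp g" "0 < d" "d < 1024"
  have "psp (\<lambda>B \<rho>. ((\<lambda>x. x div d) ^^ g B \<rho>) (f B \<rho>))"
    by (rule psp_iter; intro psp_intros psp_div psp_const a)
  moreover have "((\<lambda>x. x div d) ^^ m) x = x div d ^ m" for m x :: nat
    by (induction m) (simp_all add: div_mult2_eq[symmetric] mult.commute)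
  ultimately show ?thesis by simp
qed

lemma psp_bit [psp_intros]: "psp f \<Longrightarrow> psp g \<Longrightarrow> pspP (\<lambda>B \<rho>. bit (f B \<rho>) (g B \<rho>))"
  by (rule psp_cong[OF psp_mod[OF psp_funpow_div[of f g 2] psp_const[of 2]]])
     (auto simp: bit_iff_odd mod_2_eq_odd)

text \<open>Horner's scheme from the top digit down, so the powers of \<open>c\<close>, which may
  exceed \<open>B\<close>, never occur. The counter starts at \<open>m\<close>, and digit
  \<open>q - 1\<close> is read at counter value \<open>q\<close>.\<close>

lemma psp_digits:
  assumes m: "psp m" and c: "c < 1024" and f: "psp (\<lambda>B \<rho>. f B (\<lambda>i. \<rho> (Suc i)) (\<rho> 0))"
  shows "psp (\<lambda>B \<rho>. (\<Sum>q<m B \<rho>. c ^ q * f B \<rho> q) mod B)"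
proof (rule psp_cong)
  have dec: "psp (\<lambda>B \<rho>. f B (\<lambda>i. \<rho> (Suc (Suc i))) (\<rho> (Suc 0) - 1))"
  proof -
    have "psp (\<lambda>B \<rho>. f B (\<lambda>i. (if Suc i = 0 then \<rho> (Suc 0) - 1 else \<rho> (Suc (Suc i))))
        (if (0::nat) = 0 then \<rho> (Suc 0) - 1 else \<rho> (Suc 0)))"
      by (rule psp_subst[OF f, where F = "\<lambda>i B \<rho>. if i = 0 then \<rho> (Suc 0) - 1 else \<rho> (Suc i)"])
         (intro psp_intros psp_const, auto intro: psp_intros)
    then show ?thesis by simp
  qed
  show "psp (\<lambda>B \<rho>. fst (((\<lambda>(a, q). (((c * a) mod B + f B \<rho> (q - 1)) mod B, q - 1)) ^^ m B \<rho>) (0, m B \<rho>)))"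
    by (rule psp_iter2; intro psp_intros m dec psp_const c)
  fix B :: nat and \<rho> :: "nat \<Rightarrow> nat" assume B: "1024 \<le> B" "\<forall>i. \<rho> i < B"
  define M where "M = m B \<rho>"
  have "((\<lambda>(a, q). (((c * a) mod B + f B \<rho> (q - 1)) mod B, q - 1)) ^^ i) (0, M)
      = ((\<Sum>q<i. c ^ q * f B \<rho> (M - i + q)) mod B, M - i)" if "i \<le> M" for i
    using that
  proof (induction i)
    case (Suc i)
    have "(\<Sum>q<Suc i. c ^ q * h q) = h 0 + c * (\<Sum>q<i. c ^ q * h (Suc q))" for h
      by (simp add: sum.lessThan_Suc_shift sum_distrib_left mult.assoc del: sum.lessThan_Suc)
    from this[of "\<lambda>q. f B \<rho> (M - Suc i + q)"]
    have "(\<Sum>q<Suc i. c ^ q * f B \<rho> (M - Suc i + q))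
        = f B \<rho> (M - Suc i) + c * (\<Sum>q<i. c ^ q * f B \<rho> (M - Suc i + Suc q))" by simp
    moreover have "(\<Sum>q<i. c ^ q * f B \<rho> (M - Suc i + Suc q)) = (\<Sum>q<i. c ^ q * f B \<rho> (M - i + q))"
    proof (rule sum.cong[OF refl])
      fix q
      have "M - Suc i + Suc q = M - i + q" using Suc.prems by linarith
      then show "c ^ q * f B \<rho> (M - Suc i + Suc q) = c ^ q * f B \<rho> (M - i + q)" by (simp only:)
    qed
    ultimately have "(\<Sum>q<Suc i. c ^ q * f B \<rho> (M - Suc i + q)) mod B
        = (f B \<rho> (M - Suc i) + c * (\<Sum>q<i. c ^ q * f B \<rho> (M - i + q))) mod B" by (simp only:)
    also have "\<dots> = ((c * ((\<Sum>q<i. c ^ q * f B \<rho> (M - i + q)) mod B)) mod B + f B \<rho> (M - i - 1)) mod B"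
      by (simp add: mod_simps add.commute)
    finally have "(\<Sum>q<Suc i. c ^ q * f B \<rho> (M - Suc i + q)) mod B
        = ((c * ((\<Sum>q<i. c ^ q * f B \<rho> (M - i + q)) mod B)) mod B + f B \<rho> (M - i - 1)) mod B" .
    moreover have "M - i - 1 = M - Suc i" by simp
    ultimately show ?case using Suc by (simp only: funpow.simps comp_apply Suc_leD prod.case)
  qed simp
  from this[of M]
  show "fst (((\<lambda>(a, q). (((c * a) mod B + f B \<rho> (q - 1)) mod B, q - 1)) ^^ m B \<rho>) (0, m B \<rho>))
      = (\<Sum>q<m B \<rho>. c ^ q * f B \<rho> q) mod B"
    by (simp add: M_def)
qed

section \<open>The automaton of an omega-regular expression\<close>

definition tok_at :: "token list \<Rightarrow> nat \<Rightarrow> nat" where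
  "tok_at w i = (if i < length w then tok_code (w ! i) else 0)"

definition conc :: "'a list set \<Rightarrow> 'a list set \<Rightarrow> 'a list set" where
  "conc A B = {u @ v | u v. u \<in> A \<and> v \<in> B}"

text \<open>The Thompson automaton of an expression in prefix notation: nodes \<open>2 i\<close> and \<open>2 i + 1\<close> are the
  entry and the exit of the subexpression starting at position \<open>i\<close>, whose first operand starts at \<open>j = i + 1\<close>
  and whose second operand starts at \<open>k\<close>.  The label \<open>x\<close> is 0 for a silent move, 1 for \<open>La\<close>, 2 for \<open>Lb\<close>.\<close>

definition gen :: "nat \<Rightarrow> nat \<Rightarrow> nat \<Rightarrow> nat \<Rightarrow> nat \<Rightarrow> nat \<Rightarrow> nat \<Rightarrow> bool" where
  "gen c i j k p x q \<longleftrightarrow>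
    (let pin = (\<lambda>m. p div 2 = m \<and> p mod 2 = 0); pout = (\<lambda>m. p div 2 = m \<and> p mod 2 = 1);
         qin = (\<lambda>m. q div 2 = m \<and> q mod 2 = 0); qout = (\<lambda>m. q div 2 = m \<and> q mod 2 = 1)
     in (x = 0 \<and>
          (c = 9 \<and> pin i \<and> qout i \<or>
           c = 10 \<and> (pin i \<and> qin j \<or> pin i \<and> qin k \<or> pout j \<and> qout i \<or> pout k \<and> qout i) \<or>
           c = 11 \<and> (pin i \<and> qin j \<or> pout j \<and> qin k \<or> pout k \<and> qout i) \<or>
           c = 12 \<and> (pin i \<and> qout i \<or> pin i \<and> qin j \<or> pout j \<and> qin i) \<or>
           c = 13 \<and> (pin i \<and> qin j \<or> pout j \<and> qin i) \<or>
           c = 14 \<and> (pin i \<and> qin j \<or> pout j \<and> qin k) \<or>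
           c = 15 \<and> (pin i \<and> qin j \<or> pin i \<and> qin k))) \<or>
        x = 1 \<and> c = 6 \<and> pin i \<and> qout i \<or>
        x = 2 \<and> c = 7 \<and> pin i \<and> qout i)"

fun letter_code :: "letter \<Rightarrow> nat" where
  "letter_code La = 1" | "letter_code Lb = 2"

definition xcons :: "nat \<Rightarrow> letter list \<Rightarrow> letter list" where
  "xcons x u = (if x = 1 then La # u else if x = 2 then Lb # u else u)"

lemma drop_ConsD:
  assumes "drop i w = t # v"
  shows "i < length w" "w ! i = t" "drop (Suc i) w = v"
proof -
  show "i < length w" using assms by (metis drop_all list.distinct(1) not_le)
  then show "w ! i = t" "drop (Suc i) w = v" using assms by (metis Cons_nth_drop_Suc list.inject)+
qed

lemma drop_appendD: "drop i w = u @ v \<Longrightarrow> drop (i + length u) w = v"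
  by (metis add.commute append_eq_conv_conj drop_drop)

lemma drop_appendD_less: "drop i w = u @ v \<Longrightarrow> 0 < length u \<Longrightarrow> i < length w"
  by (rule ccontr) simp

lemma rexp_enc_len: "0 < length (rexp_enc r)" by (induction r rule: rexp_enc.induct) auto
lemma oexp_enc_len: "0 < length (oexp_enc e)" by (induction e) auto

text \<open>Labelling every node with the words that lead from it to the continuation \<open>K\<close> turns soundness of
  the automaton into a local check of its edges.\<close>

fun lab :: "rexp \<Rightarrow> letter list set \<Rightarrow> (letter list set \<times> letter list set) list" where
  "lab REmpty K = [({}, K)]"
| "lab REps K = [(K, K)]"
| "lab (RSym x) K = [(conc {[x]} K, K)]"
| "lab (RPlus r s) K = (conc (lang (RPlus r s)) K, K) # lab r K @ lab s K"
| "lab (RTimes r s) K = (conc (lang (RTimes r s)) K, K) # lab r (conc (lang s) K) @ lab s K"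
| "lab (RStar r) K = (conc (lang (RStar r)) K, K) # lab r (conc (lang (RStar r)) K)"

text \<open>The words that lead from the entry of the expression at \<open>i\<close> to the entry of
  the omega operator at position \<open>t\<close>. Turns of its loop are included, whence the
  star.\<close>

fun pre :: "oexp \<Rightarrow> nat \<Rightarrow> nat \<Rightarrow> letter list set" where
  "pre (Omega r) i t = (if i = t then lang (RStar r) else {})"
| "pre (OConc r e) i t = conc (lang r) (pre e (Suc i + length (rexp_enc r)) t)"
| "pre (OPlus e f) i t = pre e (Suc i) t \<union> pre f (Suc i + length (oexp_enc e)) t"

text \<open>Labels relative to one accepting node \<open>2 * t\<close>. An omega expression is never
  left, so its exit node carries the empty language.\<close>

fun labo :: "oexp \<Rightarrow> nat \<Rightarrow> nat \<Rightarrow> (letter list set \<times> letter list set) list" where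
  "labo (Omega r) i t = (pre (Omega r) i t, {}) # lab r (pre (Omega r) i t)"
| "labo (OConc r e) i t = (pre (OConc r e) i t, {}) #
     lab r (pre e (Suc i + length (rexp_enc r)) t) @ labo e (Suc i + length (rexp_enc r)) t"
| "labo (OPlus e f) i t = (pre (OPlus e f) i t, {}) # labo e (Suc i) t @ labo f (Suc i + length (oexp_enc e)) t"

fun omegas :: "oexp \<Rightarrow> nat \<Rightarrow> (nat \<times> rexp) set" where
  "omegas (Omega r) i = {(i, r)}"
| "omegas (OConc r e) i = omegas e (Suc i + length (rexp_enc r))"
| "omegas (OPlus e f) i = omegas e (Suc i) \<union> omegas f (Suc i + length (oexp_enc e))"

lemma length_lab [simp]: "length (lab r K) = length (rexp_enc r)"
proof (induction r arbitrary: K)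
  case (RSym x) then show ?case by (cases x) auto
qed auto

lemma length_labo [simp]: "length (labo e i t) = length (oexp_enc e)"
  by (induction e arbitrary: i) auto

lemma lab_0: "lab r K ! 0 = (conc (lang r) K, K)"
  by (cases r) (auto simp: conc_def)

lemma labo_0: "fst (labo e i t ! 0) = pre e i t"
  by (cases e) auto

lemma star_Nil: "[] \<in> lang (RStar r)"
  using exI[of "\<lambda>ws. [] = concat ws \<and> set ws \<subseteq> lang r" "[]"] by simp

lemma star_append: "u \<in> lang (RStar r) \<Longrightarrow> v \<in> lang (RStar r) \<Longrightarrow> u @ v \<in> lang (RStar r)"
proof -
  assume "u \<in> lang (RStar r)" "v \<in> lang (RStar r)"
  then obtain us vs where "u = concat us" "set us \<subseteq> lang r" "v = concat vs" "set vs \<subseteq> lang r" by auto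
  then show ?thesis by (auto intro!: exI[of _ "us @ vs"])
qed

lemma star_single: "u \<in> lang r \<Longrightarrow> u \<in> lang (RStar r)"
  by (auto intro!: exI[of _ "[u]"])

lemma concI: "u \<in> A \<Longrightarrow> v \<in> B \<Longrightarrow> u @ v \<in> conc A B"
  by (auto simp: conc_def)

lemma conc_star_absorb: "conc (lang r) (conc (lang (RStar r)) K) \<subseteq> conc (lang (RStar r)) K"
proof
  fix x assume "x \<in> conc (lang r) (conc (lang (RStar r)) K)"
  then obtain u v k where "x = (u @ v) @ k" "u \<in> lang r" "v \<in> lang (RStar r)" "k \<in> K"
    unfolding conc_def by (force simp del: lang.simps)
  then show "x \<in> conc (lang (RStar r)) K"
    using star_append[OF star_single] concI by (metis (no_types))
qed

lemma conc_star_right: "conc (lang r) (lang (RStar r)) \<subseteq> lang (RStar r)"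
  using star_append[OF star_single] by (auto simp: conc_def simp del: lang.simps)

text \<open>\<open>E\<close> stands for the function that finds the end of a subexpression,
  specified only where one really starts. The expression is the part of \<open>w\<close> from
  \<open>k\<close> on; positions stay absolute so that the automaton can be read off the input in
  place.\<close>

locale nfa =
  fixes w :: "token list" and k :: nat and E :: "nat \<Rightarrow> nat"
  assumes E_rexp: "\<And>i r v. drop i w = rexp_enc r @ v \<Longrightarrow> E i = i + length (rexp_enc r)"
    and E_oexp: "\<And>i e v. drop i w = oexp_enc e @ v \<Longrightarrow> E i = i + length (oexp_enc e)"
begin

definition edge :: "nat \<Rightarrow> nat \<Rightarrow> nat \<Rightarrow> bool" where
  "edge p x q \<longleftrightarrow> p < 2 * length w \<and> q < 2 * length w \<and>
     (\<exists>i<length w. k \<le> i \<and> gen (tok_at w i) i (i + 1) (E (i + 1)) p x q)"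

inductive path :: "nat \<Rightarrow> letter list \<Rightarrow> nat \<Rightarrow> bool" where
  path_refl: "path p [] p"
| path_eps: "edge p 0 q \<Longrightarrow> path q u r \<Longrightarrow> path p u r"
| path_letter: "edge p (letter_code a) q \<Longrightarrow> path q u r \<Longrightarrow> path p (a # u) r"

lemma path_append: "path p u q \<Longrightarrow> path q v r \<Longrightarrow> path p (u @ v) r"
  by (induction rule: path.induct) (auto intro: path.intros)

lemma path_eps1: "edge p 0 q \<Longrightarrow> path p [] q"
  by (auto intro: path.intros)

lemma edgeI:
  "drop i w = t # v \<Longrightarrow> k \<le> i \<Longrightarrow> p < 2 * length w \<Longrightarrow> q < 2 * length w \<Longrightarrow>
   gen (tok_code t) i (i + 1) (E (i + 1)) p x q \<Longrightarrow> edge p x q"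
  using drop_ConsD[of i w t v] by (auto simp: edge_def tok_at_def)

section \<open>Completeness: words of the language label paths\<close>

lemma path_rexp:
  "drop i w = rexp_enc r @ v \<Longrightarrow> k \<le> i \<Longrightarrow> u \<in> lang r \<Longrightarrow> path (2 * i) u (2 * i + 1)"
proof (induction r arbitrary: i v u)
  case REmpty then show ?case by simp
next
  case REps
  then have "edge (2 * i) 0 (2 * i + 1)" using drop_ConsD(1)[of i w] by (auto intro!: edgeI simp: gen_def)
  then show ?case using REps path_eps1 by simp
next
  case (RSym x)
  then have "edge (2 * i) (letter_code x) (2 * i + 1)" 
    using drop_ConsD(1)[of i w] by (cases x) (auto intro!: edgeI simp: gen_def)
  then show ?case using RSym path_letter[OF _ path_refl] by simp
next
  case (RPlus r s)
  let ?k = "i + 1 + length (rexp_enc r)"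
  have d: "drop i w = TPlus # rexp_enc r @ rexp_enc s @ v" using RPlus.prems by simp
  have d1: "drop (i + 1) w = rexp_enc r @ rexp_enc s @ v" using drop_ConsD(3)[OF d] by simp
  have d2: "drop ?k w = rexp_enc s @ v" using drop_appendD[OF d1] by simp
  have lt: "i < length w" "i + 1 < length w" "?k < length w"
    using drop_ConsD(1)[OF d] drop_appendD_less[OF d1 rexp_enc_len] drop_appendD_less[OF d2 rexp_enc_len] by simp_all
  have Ei: "E (i + 1) = ?k" using E_rexp[OF d1] by simp
  note ed = edgeI[OF d RPlus.prems(2)]
  have e: "edge (2 * i) 0 (2 * (i + 1))" "edge (2 * i) 0 (2 * ?k)"
    "edge (2 * (i + 1) + 1) 0 (2 * i + 1)" "edge (2 * ?k + 1) 0 (2 * i + 1)"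
    by (rule ed, use lt in \<open>auto simp: gen_def Ei[simplified]\<close>)+
  from RPlus.prems(3) consider "u \<in> lang r" | "u \<in> lang s" by auto
  then show ?case
  proof cases
    case 1
    then have "path (2 * (i + 1)) u (2 * (i + 1) + 1)" using RPlus.IH(1)[OF d1] RPlus.prems by simp
    from path_append[OF path_eps[OF e(1) this] path_eps1[OF e(3)]] show ?thesis by simp
  next
    case 2
    then have "path (2 * ?k) u (2 * ?k + 1)" using RPlus.IH(2)[OF d2] RPlus.prems by simp
    from path_append[OF path_eps[OF e(2) this] path_eps1[OF e(4)]] show ?thesis by simp
  qed
next
  case (RTimes r s)
  let ?k = "i + 1 + length (rexp_enc r)"
  have d: "drop i w = TTimes # rexp_enc r @ rexp_enc s @ v" using RTimes.prems by simp
  have d1: "drop (i + 1) w = rexp_enc r @ rexp_enc s @ v" using drop_ConsD(3)[OF d] by simp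
  have d2: "drop ?k w = rexp_enc s @ v" using drop_appendD[OF d1] by simp
  have lt: "i < length w" "i + 1 < length w" "?k < length w"
    using drop_ConsD(1)[OF d] drop_appendD_less[OF d1 rexp_enc_len] drop_appendD_less[OF d2 rexp_enc_len] by simp_all
  have Ei: "E (i + 1) = ?k" using E_rexp[OF d1] by simp
  note ed = edgeI[OF d RTimes.prems(2)]
  have e: "edge (2 * i) 0 (2 * (i + 1))" "edge (2 * (i + 1) + 1) 0 (2 * ?k)" "edge (2 * ?k + 1) 0 (2 * i + 1)"
    by (rule ed, use lt in \<open>auto simp: gen_def Ei[simplified]\<close>)+
  from RTimes.prems(3) obtain a b where ab: "u = a @ b" "a \<in> lang r" "b \<in> lang s" by auto
  have "path (2 * (i + 1)) a (2 * (i + 1) + 1)" using RTimes.IH(1)[OF d1] RTimes.prems ab by simp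
  moreover have "path (2 * ?k) b (2 * ?k + 1)" using RTimes.IH(2)[OF d2] RTimes.prems ab by simp
  ultimately have "path (2 * i) (a @ (b @ [])) (2 * i + 1)"
    using path_append path_eps[OF e(1)] path_eps[OF e(2)] path_eps1[OF e(3)] by meson
  then show ?case using ab by simp
next
  case (RStar r)
  have d: "drop i w = TStar # rexp_enc r @ v" using RStar.prems by simp
  have d1: "drop (i + 1) w = rexp_enc r @ v" using drop_ConsD(3)[OF d] by simp
  have lt: "i < length w" "i + 1 < length w"
    using drop_ConsD(1)[OF d] drop_appendD_less[OF d1 rexp_enc_len] by simp_all
  note ed = edgeI[OF d RStar.prems(2)]
  have e: "edge (2 * i) 0 (2 * i + 1)" "edge (2 * i) 0 (2 * (i + 1))" "edge (2 * (i + 1) + 1) 0 (2 * i)"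
    by (rule ed, use lt in \<open>auto simp: gen_def\<close>)+
  from RStar.prems(3) obtain ws where ws: "u = concat ws" "set ws \<subseteq> lang r" by auto
  have "path (2 * i) (concat ws) (2 * i)" using ws(2)
  proof (induction ws)
    case (Cons a ws)
    then have "path (2 * (i + 1)) a (2 * (i + 1) + 1)" using RStar.IH[OF d1] RStar.prems by simp
    then have "path (2 * i) (a @ concat ws) (2 * i)"
      using path_append[OF path_eps[OF e(2)] path_eps[OF e(3)]] Cons by simp
    then show ?case by simp
  qed (simp add: path_refl)
  then show ?case using path_append[OF _ path_eps1[OF e(1)]] ws by fastforce
qed

lemma path_star:
  assumes d: "drop i w = TOmega # rexp_enc r @ v" and "k \<le> i" and u: "u \<in> lang (RStar r)"
  shows "path (2 * i) u (2 * i)"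
proof -
  have d1: "drop (i + 1) w = rexp_enc r @ v" using drop_ConsD(3)[OF d] by simp
  have lt: "i < length w" "i + 1 < length w"
    using drop_ConsD(1)[OF d] drop_appendD_less[OF d1 rexp_enc_len] by simp_all
  have e: "edge (2 * i) 0 (2 * (i + 1))" "edge (2 * (i + 1) + 1) 0 (2 * i)"
    by (rule edgeI[OF d \<open>k \<le> i\<close>], use lt in \<open>auto simp: gen_def\<close>)+
  from u obtain ws where ws: "u = concat ws" "set ws \<subseteq> lang r" by auto
  have "path (2 * i) (concat ws) (2 * i)" using ws(2)
  proof (induction ws)
    case (Cons a ws)
    then have "path (2 * (i + 1)) a (2 * (i + 1) + 1)" using path_rexp[OF d1] \<open>k \<le> i\<close> by simp
    then have "path (2 * i) (a @ concat ws) (2 * i)"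
      using path_append[OF path_eps[OF e(1)] path_eps[OF e(2)]] Cons by simp
    then show ?case by simp
  qed (simp add: path_refl)
  then show ?thesis using ws by simp
qed

lemma path_pre:
  "drop i w = oexp_enc e @ v \<Longrightarrow> k \<le> i \<Longrightarrow> u \<in> pre e i t \<Longrightarrow> path (2 * i) u (2 * t)"
proof (induction e arbitrary: i v u)
  case (Omega r)
  then show ?case using path_star[of i r v u] by (auto split: if_splits simp del: lang.simps)
next
  case (OConc r e)
  let ?k = "i + 1 + length (rexp_enc r)"
  have d: "drop i w = TConc # rexp_enc r @ oexp_enc e @ v" using OConc.prems by simp
  have d1: "drop (i + 1) w = rexp_enc r @ oexp_enc e @ v" using drop_ConsD(3)[OF d] by simp
  have d2: "drop ?k w = oexp_enc e @ v" using drop_appendD[OF d1] by simp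
  have lt: "i < length w" "i + 1 < length w" "?k < length w"
    using drop_ConsD(1)[OF d] drop_appendD_less[OF d1 rexp_enc_len] drop_appendD_less[OF d2 oexp_enc_len] by simp_all
  have Ei: "E (i + 1) = ?k" using E_rexp[OF d1] by simp
  have e: "edge (2 * i) 0 (2 * (i + 1))" "edge (2 * (i + 1) + 1) 0 (2 * ?k)"
    by (rule edgeI[OF d OConc.prems(2)], use lt in \<open>auto simp: gen_def Ei[simplified]\<close>)+
  from OConc.prems(3) obtain a b where ab: "u = a @ b" "a \<in> lang r" "b \<in> pre e ?k t"
    by (auto simp: conc_def)
  have "path (2 * (i + 1)) a (2 * (i + 1) + 1)" using path_rexp[OF d1] OConc.prems ab by simp
  moreover have "path (2 * ?k) b (2 * t)" using OConc.IH[OF d2] OConc.prems ab by simp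
  ultimately show ?case
    using path_append path_eps[OF e(1)] path_eps[OF e(2)] ab(1) by metis
next
  case (OPlus e f)
  let ?k = "i + 1 + length (oexp_enc e)"
  have d: "drop i w = TOPlus # oexp_enc e @ oexp_enc f @ v" using OPlus.prems by simp
  have d1: "drop (i + 1) w = oexp_enc e @ oexp_enc f @ v" using drop_ConsD(3)[OF d] by simp
  have d2: "drop ?k w = oexp_enc f @ v" using drop_appendD[OF d1] by simp
  have lt: "i < length w" "i + 1 < length w" "?k < length w"
    using drop_ConsD(1)[OF d] drop_appendD_less[OF d1 oexp_enc_len] drop_appendD_less[OF d2 oexp_enc_len] by simp_all
  have Ei: "E (i + 1) = ?k" using E_oexp[OF d1] by simp
  have e: "edge (2 * i) 0 (2 * (i + 1))" "edge (2 * i) 0 (2 * ?k)"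
    by (rule edgeI[OF d OPlus.prems(2)], use lt in \<open>auto simp: gen_def Ei[simplified]\<close>)+
  from OPlus.prems(3) consider "u \<in> pre e (i + 1) t" | "u \<in> pre f ?k t" by auto
  then show ?case
  proof cases
    case 1
    then have "path (2 * (i + 1)) u (2 * t)" using OPlus.IH(1)[OF d1] OPlus.prems by simp
    then show ?thesis using path_eps[OF e(1)] by blast
  next
    case 2
    then have "path (2 * ?k) u (2 * t)" using OPlus.IH(2)[OF d2] OPlus.prems by simp
    then show ?thesis using path_eps[OF e(2)] by blast
  qed
qed

end

section \<open>Soundness: paths spell words of the language\<close>

definition node_lab :: "(nat \<Rightarrow> letter list set \<times> letter list set) \<Rightarrow> nat \<Rightarrow> letter list set" where
  "node_lab L p = (if p mod 2 = 0 then fst (L (p div 2)) else snd (L (p div 2)))"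

lemma all_less_append:
  assumes "\<forall>j < length (xs @ ys). L (i + j) = (xs @ ys) ! j"
  shows "\<forall>j < length xs. L (i + j) = xs ! j" "\<forall>j < length ys. L (i + length xs + j) = ys ! j"
proof -
  show "\<forall>j < length xs. L (i + j) = xs ! j" using assms by (auto simp: nth_append)
  show "\<forall>j < length ys. L (i + length xs + j) = ys ! j"
  proof (intro allI impI)
    fix j assume "j < length ys"
    then show "L (i + length xs + j) = ys ! j"
      using assms[rule_format, of "length xs + j"] by (simp add: add.assoc)
  qed
qed

lemma all_less_Cons:
  assumes "\<forall>j < length (x # xs). L (i + j) = (x # xs) ! j"
  shows "L i = x" "\<forall>j < length xs. L (i + 1 + j) = xs ! j"
proof -
  show "L i = x" using assms[rule_format, of 0] by simp
  show "\<forall>j < length xs. L (i + 1 + j) = xs ! j"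
  proof (intro allI impI)
    fix j assume "j < length xs"
    then show "L (i + 1 + j) = xs ! j" using assms[rule_format, of "Suc j"] by simp
  qed
qed

lemma lab_first: "\<forall>j < length (lab r K). L (i + j) = lab r K ! j \<Longrightarrow> L i = (conc (lang r) K, K)"
  using lab_0[of r K] rexp_enc_len[of r] by (metis add.right_neutral length_lab)

lemma labo_first: "\<forall>j < length (labo e i t). L (i' + j) = labo e i t ! j \<Longrightarrow> fst (L i') = pre e i t"
  using labo_0[of e i t] oexp_enc_len[of e] by (metis add.right_neutral length_labo)

context nfa begin

text \<open>Each edge stems from the operator at one position \<open>i\<close>. In every case of the
  induction only the edges of the outermost operator are checked by hand, by comparing the labels at
  the first positions of its operands; all other edges lie inside an operand, whose continuation has
  been adapted.\<close>

lemma lab_sound: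
  assumes "drop o' w = rexp_enc r @ v" "\<forall>j < length (lab r K). L (o' + j) = lab r K ! j"
    "o' \<le> i" "i < o' + length (rexp_enc r)" "gen (tok_at w i) i (i + 1) (E (i + 1)) p x q" "u \<in> node_lab L q"
  shows "xcons x u \<in> node_lab L p"
  using assms
proof (induction r arbitrary: o' v K)
  case REmpty
  then have d: "drop o' w = TEmpty # v" and i: "i = o'" by simp_all
  then have "tok_at w i = 8" using drop_ConsD(1,2)[OF d] by (simp add: tok_at_def)
  then show ?case using REmpty.prems(5) by (simp add: gen_def)
next
  case REps
  then have d: "drop o' w = TEps # v" and i: "i = o'" by simp_all
  then have "tok_at w i = 9" using drop_ConsD(1,2)[OF d] by (simp add: tok_at_def)
  then show ?case using REps.prems(2,5,6) i by (auto simp: gen_def node_lab_def xcons_def)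
next
  case (RSym a)
  then have d: "drop o' w = (case a of La \<Rightarrow> TA | Lb \<Rightarrow> TB) # v" and i: "i = o'" by (cases a; simp)+
  then have "tok_at w i = (case a of La \<Rightarrow> 6 | Lb \<Rightarrow> 7)"
    using drop_ConsD(1,2)[OF d] by (cases a) (simp_all add: tok_at_def)
  then show ?case using RSym.prems(2,5,6) i
    by (cases a) (auto simp: gen_def node_lab_def xcons_def conc_def)
next
  case (RPlus r s)
  let ?k = "o' + 1 + length (rexp_enc r)"
  have d: "drop o' w = TPlus # rexp_enc r @ rexp_enc s @ v" using RPlus.prems by simp
  have d1: "drop (o' + 1) w = rexp_enc r @ rexp_enc s @ v" using drop_ConsD(3)[OF d] by simp
  have d2: "drop ?k w = rexp_enc s @ v" using drop_appendD[OF d1] by simp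
  have Ei: "E (o' + 1) = ?k" using E_rexp[OF d1] by simp
  note L = all_less_Cons[OF RPlus.prems(2)[unfolded lab.simps]]
  note L1 = all_less_append[OF L(2), simplified length_lab]
  have "i = o' \<or> (o' + 1 \<le> i \<and> i < o' + 1 + length (rexp_enc r)) \<or> (?k \<le> i \<and> i < ?k + length (rexp_enc s))"
    using RPlus.prems(3,4) by auto
  then consider "i = o'" | "o' + 1 \<le> i" "i < o' + 1 + length (rexp_enc r)" | "?k \<le> i" "i < ?k + length (rexp_enc s)"
    by blast
  then show ?case
  proof cases
    case 1
    have "tok_at w i = 10" using drop_ConsD(1,2)[OF d] 1 by (simp add: tok_at_def)
    moreover have "L (o' + 1) = (conc (lang r) K, K)" "L ?k = (conc (lang s) K, K)"
      using lab_first[of r K L "o' + 1"] lab_first[of s K L ?k] L1 by auto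
    moreover have "conc (lang (RPlus r s)) K = conc (lang r) K \<union> conc (lang s) K" by (auto simp: conc_def)
    ultimately show ?thesis using RPlus.prems(5,6) L(1) Ei 1
      by (auto simp: gen_def Let_def node_lab_def xcons_def)
  next
    case 2
    show ?thesis by (rule RPlus.IH(1)[unfolded length_lab, OF d1 L1(1) 2 RPlus.prems(5,6)])
  next
    case 3
    show ?thesis by (rule RPlus.IH(2)[unfolded length_lab, OF d2 L1(2) 3 RPlus.prems(5,6)])
  qed
next
  case (RTimes r s)
  let ?k = "o' + 1 + length (rexp_enc r)"
  have d: "drop o' w = TTimes # rexp_enc r @ rexp_enc s @ v" using RTimes.prems by simp
  have d1: "drop (o' + 1) w = rexp_enc r @ rexp_enc s @ v" using drop_ConsD(3)[OF d] by simp
  have d2: "drop ?k w = rexp_enc s @ v" using drop_appendD[OF d1] by simp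
  have Ei: "E (o' + 1) = ?k" using E_rexp[OF d1] by simp
  note L = all_less_Cons[OF RTimes.prems(2)[unfolded lab.simps]]
  note L1 = all_less_append[OF L(2), simplified length_lab]
  have "i = o' \<or> (o' + 1 \<le> i \<and> i < o' + 1 + length (rexp_enc r)) \<or> (?k \<le> i \<and> i < ?k + length (rexp_enc s))"
    using RTimes.prems(3,4) by auto
  then consider "i = o'" | "o' + 1 \<le> i" "i < o' + 1 + length (rexp_enc r)" | "?k \<le> i" "i < ?k + length (rexp_enc s)"
    by blast
  then show ?case
  proof cases
    case 1
    have "tok_at w i = 11" using drop_ConsD(1,2)[OF d] 1 by (simp add: tok_at_def)
    moreover have "L (o' + 1) = (conc (lang r) (conc (lang s) K), conc (lang s) K)" "L ?k = (conc (lang s) K, K)"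
      using lab_first[of r "conc (lang s) K" L "o' + 1"] lab_first[of s K L ?k] L1 by auto
    moreover have "conc (lang (RTimes r s)) K = conc (lang r) (conc (lang s) K)"
      by (auto simp: conc_def) (metis append.assoc)+
    ultimately show ?thesis using RTimes.prems(5,6) L(1) Ei 1
      by (auto simp: gen_def Let_def node_lab_def xcons_def)
  next
    case 2
    show ?thesis by (rule RTimes.IH(1)[unfolded length_lab, OF d1 L1(1) 2 RTimes.prems(5,6)])
  next
    case 3
    show ?thesis by (rule RTimes.IH(2)[unfolded length_lab, OF d2 L1(2) 3 RTimes.prems(5,6)])
  qed
next
  case (RStar r)
  have d: "drop o' w = TStar # rexp_enc r @ v" using RStar.prems by simp
  have d1: "drop (o' + 1) w = rexp_enc r @ v" using drop_ConsD(3)[OF d] by simp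
  let ?S = "conc (lang (RStar r)) K"
  note L = all_less_Cons[OF RStar.prems(2)[unfolded lab.simps]]
  have "i = o' \<or> (o' + 1 \<le> i \<and> i < o' + 1 + length (rexp_enc r))"
    using RStar.prems(3,4) by auto
  then consider "i = o'" | "o' + 1 \<le> i" "i < o' + 1 + length (rexp_enc r)" by blast
  then show ?case
  proof cases
    case 1
    have "tok_at w i = 12" using drop_ConsD(1,2)[OF d] 1 by (simp add: tok_at_def)
    moreover have "L (o' + 1) = (conc (lang r) ?S, ?S)"
      using lab_first[of r ?S L "o' + 1"] L(2) by auto
    moreover have "conc (lang r) ?S \<subseteq> ?S" by (rule conc_star_absorb)
    moreover have "K \<subseteq> ?S" using concI[OF star_Nil] by fastforce
    ultimately show ?thesis using RStar.prems(5,6) L(1) 1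
      by (auto simp: gen_def Let_def node_lab_def xcons_def simp del: lang.simps)
  next
    case 2
    show ?thesis by (rule RStar.IH[OF d1 L(2) 2 RStar.prems(5,6)])
  qed
qed

lemma labo_sound:
  assumes "drop o' w = oexp_enc e @ v" "\<forall>j < length (labo e o' t). L (o' + j) = labo e o' t ! j"
    "o' \<le> i" "i < o' + length (oexp_enc e)" "gen (tok_at w i) i (i + 1) (E (i + 1)) p x q" "u \<in> node_lab L q"
  shows "xcons x u \<in> node_lab L p"
  using assms
proof (induction e arbitrary: o' v)
  case (Omega r)
  have d: "drop o' w = TOmega # rexp_enc r @ v" using Omega.prems by simp
  have d1: "drop (o' + 1) w = rexp_enc r @ v" using drop_ConsD(3)[OF d] by simp
  let ?S = "pre (Omega r) o' t"
  note L = all_less_Cons[OF Omega.prems(2)[unfolded labo.simps]]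
  have "i = o' \<or> (o' + 1 \<le> i \<and> i < o' + 1 + length (rexp_enc r))"
    using Omega.prems(3,4) by auto
  then consider "i = o'" | "o' + 1 \<le> i" "i < o' + 1 + length (rexp_enc r)" by blast
  then show ?case
  proof cases
    case 1
    have "tok_at w i = 13" using drop_ConsD(1,2)[OF d] 1 by (simp add: tok_at_def)
    moreover have "L (o' + 1) = (conc (lang r) ?S, ?S)"
      using lab_first[of r ?S L "o' + 1"] L(2) by auto
    \<comment> \<open>The back edge is sound because \<open>pre\<close> absorbs further turns of the
      loop; if \<open>t\<close> is a different position, both sides are empty.\<close>
    moreover have "conc (lang r) ?S \<subseteq> ?S" using conc_star_right[of r] by (auto simp: conc_def simp del: lang.simps)
    ultimately show ?thesis using Omega.prems(5,6) L(1) 1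
      by (auto simp: gen_def Let_def node_lab_def xcons_def simp del: lang.simps pre.simps)
  next
    case 2
    then show ?thesis using lab_sound[OF d1 _ 2] L(2) Omega.prems(5,6) by blast
  qed
next
  case (OConc r e)
  let ?k = "o' + 1 + length (rexp_enc r)"
  have d: "drop o' w = TConc # rexp_enc r @ oexp_enc e @ v" using OConc.prems by simp
  have d1: "drop (o' + 1) w = rexp_enc r @ oexp_enc e @ v" using drop_ConsD(3)[OF d] by simp
  have d2: "drop ?k w = oexp_enc e @ v" using drop_appendD[OF d1] by simp
  have Ei: "E (o' + 1) = ?k" using E_rexp[OF d1] by simp
  have k': "Suc o' + length (rexp_enc r) = ?k" by simp
  note L = all_less_Cons[OF OConc.prems(2)[unfolded labo.simps k']]
  note L1 = all_less_append[OF L(2), simplified length_lab]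
  have "i = o' \<or> (o' + 1 \<le> i \<and> i < o' + 1 + length (rexp_enc r)) \<or> (?k \<le> i \<and> i < ?k + length (oexp_enc e))"
    using OConc.prems(3,4) by auto
  then consider "i = o'" | "o' + 1 \<le> i" "i < o' + 1 + length (rexp_enc r)" | "?k \<le> i" "i < ?k + length (oexp_enc e)"
    by blast
  then show ?case
  proof cases
    case 1
    have "tok_at w i = 14" using drop_ConsD(1,2)[OF d] 1 by (simp add: tok_at_def)
    moreover have "L (o' + 1) = (conc (lang r) (pre e ?k t), pre e ?k t)"
      using lab_first[of r "pre e ?k t" L "o' + 1"] L1 by auto
    moreover have "fst (L ?k) = pre e ?k t" using labo_first[of e ?k t L ?k] L1(2) by simp
    ultimately show ?thesis using OConc.prems(5,6) L(1) Ei 1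
      by (auto simp: gen_def Let_def node_lab_def xcons_def)
  next
    case 2
    have "\<forall>j<length (lab r (pre e ?k t)). L (o' + 1 + j) = lab r (pre e ?k t) ! j" using L1(1) by simp
    then show ?thesis using lab_sound[OF d1 _ 2] OConc.prems(5,6) by blast
  next
    case 3
    then show ?thesis using OConc.IH[OF d2 _ 3] L1(2) OConc.prems(5,6) by blast
  qed
next
  case (OPlus e f)
  let ?k = "o' + 1 + length (oexp_enc e)"
  have d: "drop o' w = TOPlus # oexp_enc e @ oexp_enc f @ v" using OPlus.prems by simp
  have d1: "drop (o' + 1) w = oexp_enc e @ oexp_enc f @ v" using drop_ConsD(3)[OF d] by simp
  have d2: "drop ?k w = oexp_enc f @ v" using drop_appendD[OF d1] by simp
  have Ei: "E (o' + 1) = ?k" using E_oexp[OF d1] by simp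
  have k': "Suc o' + length (oexp_enc e) = ?k" "Suc o' = o' + 1" by simp_all
  note L = all_less_Cons[OF OPlus.prems(2)[unfolded labo.simps k']]
  note L1 = all_less_append[OF L(2)[unfolded k'], unfolded length_labo[of e]]
  have "i = o' \<or> (o' + 1 \<le> i \<and> i < o' + 1 + length (oexp_enc e)) \<or> (?k \<le> i \<and> i < ?k + length (oexp_enc f))"
    using OPlus.prems(3,4) by auto
  then consider "i = o'" | "o' + 1 \<le> i" "i < o' + 1 + length (oexp_enc e)" | "?k \<le> i" "i < ?k + length (oexp_enc f)"
    by blast
  then show ?case
  proof cases
    case 1
    have "tok_at w i = 15" using drop_ConsD(1,2)[OF d] 1 by (simp add: tok_at_def)
    moreover have "fst (L (o' + 1)) = pre e (o' + 1) t" using labo_first[of e "o' + 1" t L "o' + 1"] L1(1) by simp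
    moreover have "fst (L ?k) = pre f ?k t" using labo_first[of f ?k t L ?k] L1(2) by simp
    ultimately show ?thesis using OPlus.prems(5,6) L(1) Ei 1
      by (auto simp: gen_def Let_def node_lab_def xcons_def)
  next
    case 2
    have "\<forall>j<length (labo e (o' + 1) t). L (o' + 1 + j) = labo e (o' + 1) t ! j" using L1(1) by simp
    then show ?thesis using OPlus.IH(1)[OF d1 _ 2] OPlus.prems(5,6) by blast
  next
    case 3
    then show ?thesis using OPlus.IH(2)[OF d2 _ 3] L1(2) OPlus.prems(5,6) by blast
  qed
qed

end

section \<open>Occurrences of the omega operator and factorisations of infinite words\<close>

lemma omegas_range: "(t, r) \<in> omegas e i \<Longrightarrow> i \<le> t \<and> t < i + length (oexp_enc e)"
  by (induction e arbitrary: i) force+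

lemma labo_omegas: "(t, r) \<in> omegas e i \<Longrightarrow> fst (labo e i t ! (t - i)) = lang (RStar r)"
proof (induction e arbitrary: i)
  case (Omega r) then show ?case by simp
next
  case (OConc s e)
  let ?k = "Suc i + length (rexp_enc s)"
  have "(t, r) \<in> omegas e ?k" using OConc.prems by simp
  then have "?k \<le> t" "fst (labo e ?k t ! (t - ?k)) = lang (RStar r)"
    using omegas_range[of t r e ?k] OConc.IH by auto
  moreover from this have "t - i = Suc (length (lab s (pre e ?k t)) + (t - ?k))" by simp
  ultimately show ?case by (simp only: labo.simps nth_Cons_Suc nth_append_length_plus)
next
  case (OPlus e f)
  let ?k = "Suc i + length (oexp_enc e)"
  from OPlus.prems consider "(t, r) \<in> omegas e (Suc i)" | "(t, r) \<in> omegas f ?k" by auto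
  then show ?case
  proof cases
    case 1
    then have "Suc i \<le> t" "t < ?k" using omegas_range[of t r e "Suc i"] by auto
    moreover from this have "t - i = Suc (t - Suc i)" "t - Suc i < length (labo e (Suc i) t)" by auto
    ultimately show ?thesis using OPlus.IH(1)[OF 1] by (simp only: labo.simps nth_Cons_Suc nth_append if_True)
  next
    case 2
    then have "?k \<le> t" using omegas_range[of t r f ?k] by auto
    moreover from this have "t - i = Suc (length (labo e (Suc i) t) + (t - ?k))" by simp
    ultimately show ?thesis using OPlus.IH(2)[OF 2] by (simp only: labo.simps nth_Cons_Suc nth_append_length_plus)
  qed
qed

lemma rexp_enc_no_omega: "TOmega \<notin> set (rexp_enc r)"
  by (induction r rule: rexp_enc.induct) auto

text \<open>Regular expressions contain no \<open>TOmega\<close>, so every such token heads an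
  \<open>Omega\<close> subexpression.\<close>

lemma omegas_exist:
  "j < length (oexp_enc e) \<Longrightarrow> oexp_enc e ! j = TOmega \<Longrightarrow> \<exists>r. (i + j, r) \<in> omegas e i"
proof (induction e arbitrary: i j)
  case (Omega r)
  then show ?case
  proof (cases j)
    case (Suc m)
    then have "TOmega \<in> set (rexp_enc r)" using Omega nth_mem[of m "rexp_enc r"] by simp
    then show ?thesis using rexp_enc_no_omega by blast
  qed simp
next
  case (OConc r e)
  then obtain m where m: "j = Suc m" by (cases j) auto
  show ?case
  proof (cases "m < length (rexp_enc r)")
    case True
    then have "TOmega \<in> set (rexp_enc r)" using OConc.prems m nth_mem[of m "rexp_enc r"] by (simp add: nth_append)
    then show ?thesis using rexp_enc_no_omega by blast
  next
    case False
    let ?k = "Suc i + length (rexp_enc r)"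
    have "m - length (rexp_enc r) < length (oexp_enc e)" "oexp_enc e ! (m - length (rexp_enc r)) = TOmega"
      using OConc.prems m False by (auto simp: nth_append)
    then obtain s where "(?k + (m - length (rexp_enc r)), s) \<in> omegas e ?k" using OConc.IH by blast
    moreover have "?k + (m - length (rexp_enc r)) = i + j" using m False by simp
    ultimately have "(i + j, s) \<in> omegas e ?k" by (simp only:)
    then show ?thesis by auto
  qed
next
  case (OPlus e f)
  then obtain m where m: "j = Suc m" by (cases j) auto
  show ?case
  proof (cases "m < length (oexp_enc e)")
    case True
    then have "oexp_enc e ! m = TOmega" using OPlus.prems m by (simp add: nth_append)
    then obtain s where "(Suc i + m, s) \<in> omegas e (Suc i)" using OPlus.IH(1)[OF True] by blast
    then show ?thesis using m by auto
  next
    case False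
    let ?k = "Suc i + length (oexp_enc e)"
    have "m - length (oexp_enc e) < length (oexp_enc f)" "oexp_enc f ! (m - length (oexp_enc e)) = TOmega"
      using OPlus.prems m False by (auto simp: nth_append)
    then obtain s where "(?k + (m - length (oexp_enc e)), s) \<in> omegas f ?k" using OPlus.IH(2) by blast
    moreover have "?k + (m - length (oexp_enc e)) = i + j" using m False by simp
    ultimately have "(i + j, s) \<in> omegas f ?k" by (simp only:)
    then show ?thesis by auto
  qed
qed

lemma omegas_drop:
  "(t, r) \<in> omegas e i \<Longrightarrow> drop i w = oexp_enc e @ v \<Longrightarrow> \<exists>v'. drop t w = TOmega # rexp_enc r @ v'"
proof (induction e arbitrary: i v)
  case (Omega r) then show ?case by auto
next
  case (OConc s e)
  have d1: "drop (Suc i) w = rexp_enc s @ oexp_enc e @ v"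
    using drop_ConsD(3)[of i w TConc "rexp_enc s @ oexp_enc e @ v"] OConc.prems by simp
  then show ?case using OConc.IH[of "Suc i + length (rexp_enc s)" v] drop_appendD[OF d1] OConc.prems by simp
next
  case (OPlus e f)
  have d1: "drop (Suc i) w = oexp_enc e @ oexp_enc f @ v"
    using drop_ConsD(3)[of i w TOPlus "oexp_enc e @ oexp_enc f @ v"] OPlus.prems by simp
  then show ?case
    using OPlus.IH(1)[of "Suc i" "oexp_enc f @ v"] OPlus.IH(2)[of "Suc i + length (oexp_enc e)" v]
      drop_appendD[OF d1] OPlus.prems by auto
qed

lemma map_upt_append: "a \<le> b \<Longrightarrow> b \<le> c \<Longrightarrow> map w [a..<b] @ map w [b..<c] = map w [a..<c]"
  by (metis le_Suc_ex map_append upt_add_eq_append)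

lemma map_upt_eq_append:
  assumes "map w [a..<c] = u @ v" "a \<le> c"
  shows "u = map w [a..<a + length u]" "v = map w [a + length u..<c]" "a + length u \<le> c"
proof -
  have l: "length u + length v = c - a" using arg_cong[OF assms(1), of length] by simp
  then show le: "a + length u \<le> c" using assms(2) by linarith
  have "map w [a..<a + length u] @ map w [a + length u..<c] = u @ v"
    using map_upt_append[of a "a + length u" c w] le assms(1) by simp
  then show "u = map w [a..<a + length u]" "v = map w [a + length u..<c]"
    by (simp_all add: append_eq_append_conv)
qed

text \<open>The automaton delivers blocks in the star of \<open>lang r\<close>, whereas
  \<open>olang\<close> wants nonempty words of \<open>lang r\<close>, so the blocks have to be
  refined.\<close>

lemma omega_powerI:
  assumes h: "strict_mono h" "map w [0..<h 0] \<in> lang (RStar r)"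
    "\<And>i. map w [h i..<h (Suc i)] \<in> lang (RStar r)"
  shows "w \<in> olang (Omega r)"
proof -
  \<comment> \<open>The invariant for choosing cuts one by one: from \<open>n\<close> some cut
    \<open>h i\<close> is reached by a word of the star. It survives the removal of the first
    nonempty factor.\<close>
  define Q where "Q n \<longleftrightarrow> (\<exists>i. n \<le> h i \<and> map w [n..<h i] \<in> lang (RStar r))" for n
  have "\<exists>f. \<forall>n. (Q (f n) \<and> (n = 0 \<longrightarrow> f n = 0)) \<and> (f n < f (Suc n) \<and> map w [f n..<f (Suc n)] \<in> lang r)"
  proof (rule dependent_nat_choice)
    show "\<exists>x. Q x \<and> ((0::nat) = 0 \<longrightarrow> x = 0)" using h(2) by (auto simp: Q_def simp del: lang.simps)
  next
    fix x n :: nat assume "Q x \<and> (n = 0 \<longrightarrow> x = 0)"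
    then obtain i0 where i0: "x \<le> h i0" "map w [x..<h i0] \<in> lang (RStar r)" by (auto simp: Q_def simp del: lang.simps)
    \<comment> \<open>If \<open>x\<close> is a cut itself, the next block is taken instead, so that
      a nonempty word is available.\<close>
    obtain i where i: "x < h i" "map w [x..<h i] \<in> lang (RStar r)"
    proof (cases "x = h i0")
      case True
      then have "x < h (Suc i0)" using h(1) by (simp add: strict_mono_def)
      then show thesis using that h(3)[of i0] True by blast
    next
      case False
      then have "x < h i0" using i0(1) by simp
      then show thesis using that i0(2) by blast
    qed
    then obtain ws where ws: "map w [x..<h i] = concat ws" "set ws \<subseteq> lang r" by auto
    have "\<exists>u v. map w [x..<h i] = u @ v \<and> u \<noteq> [] \<and> u \<in> lang r \<and> v \<in> lang (RStar r)"
    proof -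
      have "concat ws \<noteq> []" using ws(1) i(1) by (metis length_0_conv length_map length_upt less_numeral_extra(3) zero_less_diff)
      then have "\<exists>u v. concat ws = u @ v \<and> u \<noteq> [] \<and> u \<in> lang r \<and> v \<in> lang (RStar r)"
        using ws(2)
      proof (induction ws)
        case (Cons a ws)
        show ?case
        proof (cases "a = []")
          case True then show ?thesis using Cons by simp
        next
          case False
          have "concat ws \<in> lang (RStar r)" using Cons.prems(2) by auto
          then show ?thesis using False Cons.prems(2) by (intro exI[of _ a] exI[of _ "concat ws"]) (simp del: lang.simps)
        qed
      qed simp
      then show ?thesis using ws(1) by simp
    qed
    then obtain u v where uv: "map w [x..<h i] = u @ v" "u \<noteq> []" "u \<in> lang r" "v \<in> lang (RStar r)" by blast
    note s = map_upt_eq_append[OF uv(1) less_imp_le[OF i(1)]]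
    have "Q (x + length u)" unfolding Q_def using s(2,3) uv(4) by (intro exI[of _ i]) (simp del: lang.simps)
    then show "\<exists>y. (Q y \<and> (Suc n = 0 \<longrightarrow> y = 0)) \<and> x < y \<and> map w [x..<y] \<in> lang r"
      using s(1) uv(2,3) by (intro exI[of _ "x + length u"]) auto
  qed
  then obtain f where f: "\<And>n. f n < f (Suc n)" "f 0 = 0" "\<And>n. map w [f n..<f (Suc n)] \<in> lang r" by blast
  have "strict_mono f" using f(1) by (simp add: strict_mono_Suc_iff)
  then show ?thesis using f by auto
qed

lemma map_shift: "map (\<lambda>i. w (n + i)) [a..<b] = map w [n + a..<n + b]"
  by (rule nth_equalityI) (auto simp: add.assoc)

lemma olang_omegasI:
  assumes "(t, r) \<in> omegas e i" "strict_mono h" "map w [0..<h 0] \<in> pre e i t"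
    "\<And>i. map w [h i..<h (Suc i)] \<in> lang (RStar r)"
  shows "w \<in> olang e"
  using assms
proof (induction e arbitrary: i w h)
  case (Omega s)
  then have "s = r" "i = t" by auto
  then show ?case using omega_powerI[of h w r] Omega.prems by (simp del: lang.simps olang.simps)
next
  case (OConc s e)
  let ?k = "Suc i + length (rexp_enc s)"
  obtain a b where ab: "map w [0..<h 0] = a @ b" "a \<in> lang s" "b \<in> pre e ?k t"
    using OConc.prems(3) by (auto simp: conc_def)
  define n where "n = length a"
  note s = map_upt_eq_append[OF ab(1), simplified, folded n_def]
  have ge: "n \<le> h j" for j
  proof -
    have "h 0 \<le> h j" using OConc.prems(2) by (simp add: strict_mono_less_eq)
    then show ?thesis using s(3) by simp
  qed
  have "strict_mono (\<lambda>j. h j - n)" using OConc.prems(2) ge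
    by (auto simp: strict_mono_def intro: diff_less_mono)
  then have "(\<lambda>i. w (n + i)) \<in> olang e"
    using OConc.prems ab s ge
    by (intro OConc.IH[of ?k "\<lambda>j. h j - n"]) (auto simp: map_shift simp del: lang.simps)
  then show ?case using s(1) ab(2) by auto
next
  case (OPlus e f)
  let ?k = "Suc i + length (oexp_enc e)"
  \<comment> \<open>Position \<open>t\<close> lies in the range of one operand only, and
    \<open>pre\<close> of the other operand is empty; hence the prefix and the loop belong to the
    same branch.\<close>
  have "(t, r) \<notin> omegas f ?k \<and> t < ?k \<or> (t, r) \<notin> omegas e (Suc i) \<and> ?k \<le> t"
    using omegas_range[of t r e "Suc i"] omegas_range[of t r f ?k] by auto
  moreover have "pre f j t = {}" if "t < j" for j f
    using that by (induction f arbitrary: j) (auto simp: conc_def)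
  moreover have "pre e j t = {}" if "j + length (oexp_enc e) \<le> t" for j e
    using that
  proof (induction e arbitrary: j)
    case (Omega r) then show ?case using rexp_enc_len[of r] by auto
  qed (auto simp: conc_def)
  ultimately consider "(t, r) \<in> omegas e (Suc i)" "map w [0..<h 0] \<in> pre e (Suc i) t"
    | "(t, r) \<in> omegas f ?k" "map w [0..<h 0] \<in> pre f ?k t"
    using OPlus.prems(1,3) by auto
  then show ?case using OPlus.IH OPlus.prems(2,4) by cases auto
qed

lemma olang_omegasD:
  assumes "w \<in> olang e"
  obtains t r h where "(t, r) \<in> omegas e i" "strict_mono h" "map w [0..<h 0] \<in> pre e i t"
    "\<And>i. map w [h i..<h (Suc i)] \<in> lang (RStar r)"
  using assms
proof (induction e arbitrary: i w thesis)
  case (Omega r)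
  from Omega.prems(2) obtain f where f: "strict_mono f" "f 0 = 0" "\<And>i. map w [f i..<f (Suc i)] \<in> lang r" by auto
  show ?case
    by (rule Omega.prems(1)[of i r f]) (use f star_Nil[of r] star_single in \<open>auto simp del: lang.simps\<close>)
next
  case (OConc s e)
  let ?k = "Suc i + length (rexp_enc s)"
  from OConc.prems(2) obtain n where n: "map w [0..<n] \<in> lang s" "(\<lambda>i. w (n + i)) \<in> olang e" by auto
  from OConc.IH[OF _ n(2), of ?k] obtain t r h where h: "(t, r) \<in> omegas e ?k" "strict_mono h"
    "map (\<lambda>i. w (n + i)) [0..<h 0] \<in> pre e ?k t"
    "\<And>i. map (\<lambda>i. w (n + i)) [h i..<h (Suc i)] \<in> lang (RStar r)" by metis
  show ?case
  proof (rule OConc.prems(1)[of t r "\<lambda>j. n + h j"])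
    show "strict_mono (\<lambda>j. n + h j)" using h(2) by (simp add: strict_mono_def)
    have "map w [0..<n + h 0] = map w [0..<n] @ map w [n..<n + h 0]" by (simp add: map_upt_append)
    then show "map w [0..<n + h 0] \<in> pre (OConc s e) i t"
      using n(1) h(3) by (auto simp: map_shift intro: concI)
    show "map w [n + h i..<n + h (Suc i)] \<in> lang (RStar r)" for i
      using h(4) by (simp add: map_shift del: lang.simps)
  qed (use h in simp)
next
  case (OPlus e f)
  let ?k = "Suc i + length (oexp_enc e)"
  from OPlus.prems(2) consider "w \<in> olang e" | "w \<in> olang f" by auto
  then show ?case
  proof cases
    case 1
    show ?thesis by (rule OPlus.IH(1)[OF _ 1, of "Suc i"], rule OPlus.prems(1)) (auto simp del: lang.simps)
  next
    case 2
    show ?thesis by (rule OPlus.IH(2)[OF _ 2, of ?k], rule OPlus.prems(1)) (auto simp del: lang.simps)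
  qed
qed

context nfa begin

text \<open>A path that ends at \<open>2 * t\<close> spells a word of the label of its first node,
  because the label of \<open>2 * t\<close> contains the empty word. That label is
  \<open>lang (RStar r)\<close>, which settles the closed paths.\<close>

lemma path_sound:
  assumes e: "drop k w = oexp_enc e" and t: "(t, r) \<in> omegas e k"
  shows path_pre_sound: "path (2 * k) u (2 * t) \<Longrightarrow> u \<in> pre e k t"
    and path_star_sound: "path (2 * t) u (2 * t) \<Longrightarrow> u \<in> lang (RStar r)"
proof -
  define L where "L m = labo e k t ! (m - k)" for m
  have L: "\<forall>j < length (labo e k t). L (k + j) = labo e k t ! j" by (simp add: L_def)
  have len: "length w \<le> k + length (oexp_enc e)" using arg_cong[OF e, of length] by simp
  have step: "xcons x u \<in> node_lab L p" if "edge p x q" "u \<in> node_lab L q" for p x q u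
  proof -
    from that(1) obtain i where i: "i < length w" "k \<le> i" "gen (tok_at w i) i (i + 1) (E (i + 1)) p x q"
      by (auto simp: edge_def)
    show ?thesis using labo_sound[of k e "[]" t L i p x q u] e L i len that(2) by simp
  qed
  have sound: "u @ v \<in> node_lab L p" if "path p u q" "v \<in> node_lab L q" for p u q v
    using that
  proof (induction rule: path.induct)
    case (path_eps p q u r)
    then show ?case using step[of p 0 q "u @ v"] by (simp add: xcons_def)
  next
    case (path_letter p a q u r)
    then show ?case using step[of p "letter_code a" q "u @ v"] by (cases a) (simp_all add: xcons_def)
  qed simp
  have t2: "node_lab L (2 * t) = lang (RStar r)"
    using labo_omegas[OF t] by (simp add: node_lab_def L_def del: lang.simps)
  then have nil: "[] \<in> node_lab L (2 * t)" using star_Nil by blast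
  have "node_lab L (2 * k) = pre e k t" using labo_0 by (simp add: node_lab_def L_def)
  then show "u \<in> pre e k t" if "path (2 * k) u (2 * t)" using sound[OF that nil] by simp
  show "u \<in> lang (RStar r)" if "path (2 * t) u (2 * t)"
    using sound[OF that nil] unfolding t2 by (simp only: append_Nil2)
qed

text \<open>Buechi acceptance, with the entries of omega operators (token code 13) as accepting
  nodes. One such node can be fixed in advance because a word commits to a single omega
  operator.\<close>

theorem olang_iff_path:
  assumes e: "drop k w = oexp_enc e"
  shows "x \<in> olang e \<longleftrightarrow> (\<exists>t<length w. k \<le> t \<and> tok_at w t = 13 \<and>
     (\<exists>h. strict_mono h \<and> path (2 * k) (map x [0..<h 0]) (2 * t) \<and>
        (\<forall>i. path (2 * t) (map x [h i..<h (Suc i)]) (2 * t))))" (is "?l \<longleftrightarrow> ?r")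
proof
  assume ?l
  then obtain t r h where h: "(t, r) \<in> omegas e k" "strict_mono h" "map x [0..<h 0] \<in> pre e k t"
    "\<And>i. map x [h i..<h (Suc i)] \<in> lang (RStar r)" by (rule olang_omegasD[of x e k]) blast
  obtain v where v: "drop t w = TOmega # rexp_enc r @ v" using omegas_drop[OF h(1), of w "[]"] e by auto
  have "k \<le> t" using omegas_range[OF h(1)] by simp
  moreover have "t < length w" "tok_at w t = 13" using drop_ConsD[OF v] by (auto simp: tok_at_def)
  moreover have "path (2 * k) (map x [0..<h 0]) (2 * t)" using path_pre[of k e "[]"] e h(3) by simp
  moreover have "path (2 * t) (map x [h i..<h (Suc i)]) (2 * t)" for i
    using path_star[OF v \<open>k \<le> t\<close> h(4)] .
  ultimately show ?r using h(2) by blast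
next
  assume ?r
  then obtain t h where t: "t < length w" "k \<le> t" "tok_at w t = 13" and h: "strict_mono h"
    "path (2 * k) (map x [0..<h 0]) (2 * t)" "\<And>i. path (2 * t) (map x [h i..<h (Suc i)]) (2 * t)" by blast
  have "tok_code y = 13 \<Longrightarrow> y = TOmega" for y by (cases y) auto
  then have "w ! t = TOmega" using t by (simp add: tok_at_def)
  moreover have "w ! t = oexp_enc e ! (t - k)" using t e[symmetric] by simp
  moreover have "t - k < length (oexp_enc e)" using arg_cong[OF e, of length] t by simp
  ultimately obtain r where "(k + (t - k), r) \<in> omegas e k" using omegas_exist[of "t - k" e k] by auto
  then have r: "(t, r) \<in> omegas e k" using t by simp
  show ?l using olang_omegasI[OF r h(1)] path_sound[OF e r] h(2,3) by blast
qed

end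

section \<open>Residuals of the target\<close>

text \<open>For \<open>\<lambda> = 1/n\<close> the equation becomes \<open>Q * (\<Sum>i | w i = Lb. n ^ - i) = P\<close>; the residual \<open>R\<close> is the
  rescaled part of \<open>P\<close> that the remaining letters still have to produce.\<close>

fun nx :: "nat \<Rightarrow> nat \<Rightarrow> letter \<Rightarrow> nat \<Rightarrow> nat" where
  "nx n Q La R = n * R"
| "nx n Q Lb R = n * (R - Q)"

text \<open>The remaining letters produce at least 0 and at most \<open>Q * n / (n - 1)\<close>, the
  value of the word that is \<open>Lb\<close> throughout. A letter is possible iff the next residual
  stays in this range; a common factor \<open>n\<close> is cancelled.\<close>

fun ok :: "nat \<Rightarrow> nat \<Rightarrow> letter \<Rightarrow> nat \<Rightarrow> bool" where
  "ok n Q La R \<longleftrightarrow> R * (n - 1) \<le> Q"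
| "ok n Q Lb R \<longleftrightarrow> Q \<le> R \<and> (R - Q) * (n - 1) \<le> Q"

fun other :: "letter \<Rightarrow> letter" where
  "other La = Lb" | "other Lb = La"

text \<open>With neither letter possible the residual stays put. This preserves the bound in
  \<open>rstep_bound\<close>, and \<open>allowed\<close> then rejects both letters.\<close>

definition rstep :: "nat \<Rightarrow> nat \<Rightarrow> letter \<Rightarrow> nat \<Rightarrow> nat" where
  "rstep n Q m R = (if ok n Q m R then nx n Q m R else if ok n Q (other m) R then nx n Q (other m) R else R)"

text \<open>A letter is judged by its effect on the residual, not by its identity: for
  \<open>Q = 0\<close>, that is for equal weights, both letters lead to the same residual and the
  automaton has to be offered both.\<close>

definition allowed :: "nat \<Rightarrow> nat \<Rightarrow> letter \<Rightarrow> nat \<Rightarrow> letter \<Rightarrow> bool" where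
  "allowed n Q m R x \<longleftrightarrow> ok n Q x R \<and> nx n Q x R = rstep n Q m R"

definition valid_seq :: "nat \<Rightarrow> nat \<Rightarrow> nat \<Rightarrow> (nat \<Rightarrow> letter) \<Rightarrow> bool" where
  "valid_seq n Q P w \<longleftrightarrow> (\<exists>r. r 0 = P \<and> (\<forall>i. r i * (n - 1) \<le> n * Q \<and> (w i = Lb \<longrightarrow> Q \<le> r i) \<and> r (Suc i) = nx n Q (w i) (r i)))"

lemma ok_iff: "0 < n \<Longrightarrow> ok n Q x R \<longleftrightarrow> (x = Lb \<longrightarrow> Q \<le> R) \<and> nx n Q x R * (n - 1) \<le> n * Q"
  by (cases x) (auto simp: mult.assoc)

lemma rstep_bound: "0 < n \<Longrightarrow> R * (n - 1) \<le> n * Q \<Longrightarrow> rstep n Q m R * (n - 1) \<le> n * Q"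
  using ok_iff[of n Q _ R] by (auto simp: rstep_def)

text \<open>Both letters are possible only if \<open>n = 2\<close> and \<open>R = Q\<close>, and then the residual is stuck at \<open>0\<close> or \<open>2 Q\<close>
  forever: so fixing the preferred letter once and for all loses nothing.\<close>

lemma allowed_fail:
  assumes "2 \<le> n" "ok n Q x R" "\<not> allowed n Q (other x) R x"
  shows "n = 2" "R = Q" "0 < Q"
proof -
  have both: "ok n Q (other x) R" "nx n Q x R \<noteq> nx n Q (other x) R"
    using assms by (cases x; auto simp: allowed_def rstep_def split: if_splits)+
  then have 1: "R * (n - 1) \<le> Q" "Q \<le> R" using assms(2) by (cases x; auto)+
  then have "R * (n - 1) \<le> R * 1" using order_trans[OF 1] by (simp only: mult_1_right)
  then have "R = 0 \<or> n = 2" using assms(1) by (auto simp del: mult_1_right)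
  moreover have "R \<noteq> 0" using both 1 by (cases x) auto
  ultimately show "n = 2" by simp
  then show "R = Q" using 1 by simp
  then show "0 < Q" using \<open>R \<noteq> 0\<close> by simp
qed

lemma valid_seq_iff:
  assumes n: "2 \<le> n"
  shows "valid_seq n Q P w \<longleftrightarrow> P * (n - 1) \<le> n * Q \<and> (\<exists>m. \<forall>i. allowed n Q m ((rstep n Q m ^^ i) P) (w i))"
proof
  assume "valid_seq n Q P w"
  then obtain r where r: "r 0 = P" "\<And>i. r i * (n - 1) \<le> n * Q" "\<And>i. w i = Lb \<Longrightarrow> Q \<le> r i"
    "\<And>i. r (Suc i) = nx n Q (w i) (r i)" unfolding valid_seq_def by metis
  have ok: "ok n Q (w i) (r i)" for i using ok_iff[of n] n r(2)[of "Suc i"] r(3,4)[of i] by simp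
  have it: "\<forall>i. allowed n Q m ((rstep n Q m ^^ i) P) (w i)" if "\<And>i. allowed n Q m (r i) (w i)" for m
  proof -
    have "r i = (rstep n Q m ^^ i) P" for i
    proof (induction i)
      case (Suc i)
      then show ?case using that[of i] by (simp add: r(4) allowed_def)
    qed (simp add: r(1))
    then show ?thesis using that by simp
  qed
  have same: "allowed n Q x R x" if "ok n Q x R" for x R using that by (simp add: allowed_def rstep_def)
  have "\<exists>m. \<forall>i. allowed n Q m (r i) (w i)"
  proof (rule ccontr)
    assume "\<not> ?thesis"
    \<comment> \<open>If both preferences fail, \<open>Lb\<close> is read at residual
      \<open>Q\<close> at time \<open>i\<close> and \<open>La\<close> at residual \<open>Q\<close>
      at time \<open>j\<close>. After \<open>i\<close> the residual is 0 for good, after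
      \<open>j\<close> it is \<open>2 * Q\<close> for good, so the earlier event rules out the later
      one.\<close>
    then obtain i j where i: "\<not> allowed n Q La (r i) (w i)" and j: "\<not> allowed n Q Lb (r j) (w j)" by blast
    have wi: "w i = Lb" using i same[OF ok[of i]] by (cases "w i") auto
    have wj: "w j = La" using j same[OF ok[of j]] by (cases "w j") auto
    have i': "n = 2" "r i = Q" "0 < Q" using allowed_fail[OF n ok[of i]] i wi by simp_all
    have j': "r j = Q" using allowed_fail[OF n ok[of j]] j wj by simp_all
    have z: "r (Suc i + d) = 0" for d
    proof (induction d)
      case 0 then show ?case using r(4)[of i] wi i' by simp
    next
      case (Suc d)
      then have "w (Suc i + d) = La" using r(3)[of "Suc i + d"] i'(3) by (cases "w (Suc i + d)") auto
      then show ?case using r(4)[of "Suc i + d"] Suc by simp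
    qed
    have y: "r (Suc j + d) = 2 * Q" for d
    proof (induction d)
      case 0 then show ?case using r(4)[of j] wj i' j' by simp
    next
      case (Suc d)
      then have "w (Suc j + d) = Lb" using ok[of "Suc j + d"] i' by (cases "w (Suc j + d)") auto
      then show ?case using r(4)[of "Suc j + d"] Suc i' by simp
    qed
    have "i \<noteq> j" using wi wj by auto
    then have "(\<exists>d. j = Suc i + d) \<or> (\<exists>d. i = Suc j + d)"
      using less_imp_Suc_add[of i j] less_imp_Suc_add[of j i] by (cases i j rule: linorder_cases) auto
    then show False
    proof (elim disjE exE)
      fix d assume "j = Suc i + d"
      then show False using z[of d] i' j' by simp
    next
      fix d assume "i = Suc j + d"
      then show False using y[of d] i' by simp
    qed
  qed
  then show "P * (n - 1) \<le> n * Q \<and> (\<exists>m. \<forall>i. allowed n Q m ((rstep n Q m ^^ i) P) (w i))"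
    using it r(1) r(2)[of 0] by metis
next
  assume "P * (n - 1) \<le> n * Q \<and> (\<exists>m. \<forall>i. allowed n Q m ((rstep n Q m ^^ i) P) (w i))"
  then obtain m where m: "P * (n - 1) \<le> n * Q" "\<And>i. allowed n Q m ((rstep n Q m ^^ i) P) (w i)" by blast
  let ?r = "\<lambda>i. (rstep n Q m ^^ i) P"
  have b: "?r i * (n - 1) \<le> n * Q" for i
    using n m(1) by (induction i) (simp_all add: rstep_bound[simplified])
  moreover have "w i = Lb \<Longrightarrow> Q \<le> ?r i" for i using m(2)[of i] by (auto simp: allowed_def)
  moreover have "?r (Suc i) = nx n Q (w i) (?r i)" for i using m(2)[of i] by (simp add: allowed_def)
  ultimately show "valid_seq n Q P w" unfolding valid_seq_def by (intro exI[of _ ?r]) simp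
qed

section \<open>Residual sequences and the real series\<close>

definition ind :: "(nat \<Rightarrow> letter) \<Rightarrow> nat \<Rightarrow> real" where
  "ind w i = of_bool (w i = Lb)"

lemma geometric_inverse: "2 \<le> n \<Longrightarrow> (\<lambda>i. (1 / real n) ^ i) sums (real n / (real n - 1))"
proof -
  assume "2 \<le> n"
  then have "(\<lambda>i. (1 / real n) ^ i) sums (1 / (1 - 1 / real n))" by (intro geometric_sums) simp
  moreover have "1 / (1 - 1 / real n) = real n / (real n - 1)" using \<open>2 \<le> n\<close> by (simp add: field_simps)
  ultimately show ?thesis by simp
qed

lemma summable_ind: "2 \<le> n \<Longrightarrow> summable (\<lambda>i. ind w i * (1 / real n) ^ i)"
  by (rule summable_comparison_test'[of "\<lambda>i. (1 / real n) ^ i" 0])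
     (auto simp: ind_def intro: sums_summable geometric_inverse)

text \<open>The residual is a rescaled tail: \<open>r k = Q * s k\<close>, where \<open>s k\<close>
  is the tail of the series times \<open>n ^ k\<close>. Bounded residuals make the error
  \<open>r k / n ^ k\<close> of the partial sums vanish; conversely tails lie between 0 and
  \<open>n / (n - 1)\<close>, which gives the bound on the residuals.\<close>

lemma valid_seq_sums:
  assumes n: "2 \<le> n"
  shows "valid_seq n Q P w \<longleftrightarrow> real Q * (\<Sum>i. ind w i * (1 / real n) ^ i) = real P"
proof
  assume "valid_seq n Q P w"
  then obtain r where r: "r 0 = P" "\<And>i. r i * (n - 1) \<le> n * Q" "\<And>i. w i = Lb \<Longrightarrow> Q \<le> r i"
    "\<And>i. r (Suc i) = nx n Q (w i) (r i)" unfolding valid_seq_def by metis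
  have rec: "real (r (Suc i)) = real n * (real (r i) - real Q * ind w i)" for i
    using r(3,4)[of i] by (cases "w i") (auto simp: ind_def of_nat_diff)
  have part: "real Q * (\<Sum>i<k. ind w i * (1 / real n) ^ i) = real P - real (r k) * (1 / real n) ^ k" for k
  proof (induction k)
    case (Suc k)
    have "real (r (Suc k)) * (1 / real n) ^ Suc k = (real (r k) - real Q * ind w k) * (1 / real n) ^ k"
      using rec[of k] n by simp
    then show ?case using Suc by (simp add: algebra_simps)
  qed (simp add: r(1))
  have le: "real (r k) \<le> real (n * Q)" for k
  proof -
    have "r k * 1 \<le> r k * (n - 1)" using n by (intro mult_le_mono2) simp
    then show ?thesis using r(2)[of k] by linarith
  qed
  have "(\<lambda>k. real (r k) * (1 / real n) ^ k) \<longlonglongrightarrow> 0"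
  proof (rule tendsto_sandwich[of "\<lambda>_. 0" _ _ "\<lambda>k. real (n * Q) * (1 / real n) ^ k"])
    show "(\<lambda>k. real (n * Q) * (1 / real n) ^ k) \<longlonglongrightarrow> 0"
      using n by (intro tendsto_mult_right_zero LIMSEQ_power_zero) simp
  qed (use le in \<open>auto intro!: always_eventually mult_right_mono\<close>)
  then have "(\<lambda>k. real P - real (r k) * (1 / real n) ^ k) \<longlonglongrightarrow> real P - 0"
    by (intro tendsto_intros)
  then have "(\<lambda>k. real Q * (\<Sum>i<k. ind w i * (1 / real n) ^ i)) \<longlonglongrightarrow> real P" by (simp add: part)
  moreover have "(\<lambda>k. real Q * (\<Sum>i<k. ind w i * (1 / real n) ^ i)) \<longlonglongrightarrow> real Q * (\<Sum>i. ind w i * (1 / real n) ^ i)"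
    using summable_LIMSEQ[OF summable_ind[OF n]] by (intro tendsto_mult_left)
  ultimately show "real Q * (\<Sum>i. ind w i * (1 / real n) ^ i) = real P" using LIMSEQ_unique by blast
next
  assume eq: "real Q * (\<Sum>i. ind w i * (1 / real n) ^ i) = real P"
  define s where "s k = (\<Sum>i. ind w (k + i) * (1 / real n) ^ i)" for k
  have sm: "summable (\<lambda>i. ind w (k + i) * (1 / real n) ^ i)" for k
    using summable_ind[OF n, of "\<lambda>i. w (k + i)"] by (simp add: ind_def)
  have s_rec: "s k = ind w k + s (Suc k) / real n" for k
  proof -
    have "s k = (\<Sum>i. ind w (k + Suc i) * (1 / real n) ^ Suc i) + ind w k"
      using suminf_split_head[OF sm[of k]] unfolding s_def by simp
    also have "(\<Sum>i. ind w (k + Suc i) * (1 / real n) ^ Suc i) = (\<Sum>i. (1 / real n) * (ind w (Suc k + i) * (1 / real n) ^ i))"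
      by (simp add: mult_ac)
    also have "\<dots> = (1 / real n) * s (Suc k)" unfolding s_def by (rule suminf_mult[OF sm])
    finally show ?thesis by simp
  qed
  have s0: "0 \<le> s k" for k unfolding s_def by (rule suminf_nonneg[OF sm]) (simp add: ind_def)
  have s1: "s k \<le> real n / (real n - 1)" for k
  proof -
    have "s k \<le> (\<Sum>i. (1 / real n) ^ i)" unfolding s_def
      by (rule suminf_le[OF _ sm sums_summable[OF geometric_inverse[OF n]]]) (simp add: ind_def)
    then show ?thesis using sums_unique[OF geometric_inverse[OF n]] by simp
  qed
  define r where "r = rec_nat P (\<lambda>i R. nx n Q (w i) R)"
  have r: "real (r k) = real Q * s k" for k
  proof (induction k)
    case 0 then show ?case using eq by (simp add: r_def s_def)
  next
    case (Suc k)
    have e: "real n * (real (r k) - real Q * ind w k) = real Q * s (Suc k)"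
      using Suc s_rec[of k] n by (simp add: field_simps)
    show ?case
    proof (cases "w k")
      case La then show ?thesis using e by (simp add: r_def ind_def)
    next
      case Lb
      have "0 \<le> real n * (real (r k) - real Q)" using e s0[of "Suc k"] Lb by (simp add: ind_def)
      then have "Q \<le> r k" using n by (simp add: zero_le_mult_iff)
      then show ?thesis using e Lb by (simp add: r_def ind_def of_nat_diff)
    qed
  qed
  have "r k * (n - 1) \<le> n * Q" for k
  proof -
    have "s k * (real n - 1) \<le> real n" using s1[of k] n by (simp add: field_simps)
    then have "real Q * (s k * (real n - 1)) \<le> real Q * real n" by (rule mult_left_mono) simp
    then have "real (r k) * (real n - 1) \<le> real Q * real n" by (simp add: r mult.assoc)
    then have "real (r k * (n - 1)) \<le> real (n * Q)" using n by (simp add: of_nat_diff mult.commute)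
    then show ?thesis by linarith
  qed
  moreover have "Q \<le> r k" if "w k = Lb" for k
  proof -
    have "1 \<le> s k" using s_rec[of k] s0[of "Suc k"] that n by (simp add: ind_def)
    then have "real Q * 1 \<le> real Q * s k" by (intro mult_left_mono) auto
    then show ?thesis using r[of k] by simp
  qed
  ultimately show "valid_seq n Q P w" unfolding valid_seq_def
    by (intro exI[of _ r]) (simp add: r_def)
qed

text \<open>The sum is \<open>(A * n / (n - 1) + (B - A) * s) / D\<close> with \<open>s\<close> the
  series over the positions of \<open>Lb\<close>. Multiplication by \<open>D * (n - 1)\<close>
  leaves integers, and since \<open>s\<close> is nonnegative the two sides share their sign;
  dividing it out gives the natural numbers \<open>P\<close> and \<open>Q\<close>.\<close>

lemma discounted_sum_iff:
  fixes t a b :: rat and T A B D :: int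
  assumes n: "2 \<le> n" and D: "0 < D" and t: "t = of_int T / of_int D" and a: "a = of_int A / of_int D"
    and b: "b = of_int B / of_int D"
  shows "discounted_sum_is (1 / of_nat n) a b w t \<longleftrightarrow>
    (\<exists>P Q. ((int n - 1) * T - int n * A = int P \<and> (int n - 1) * (B - A) = int Q \<or>
            (int n - 1) * T - int n * A = - int P \<and> (int n - 1) * (B - A) = - int Q) \<and> valid_seq n Q P w)"
proof -
  define s where "s = (\<Sum>i. ind w i * (1 / real n) ^ i)"
  have s: "(\<lambda>i. ind w i * (1 / real n) ^ i) sums s" unfolding s_def using summable_ind[OF n] by (rule summable_sums)
  have s0: "0 \<le> s" unfolding s_def by (rule suminf_nonneg[OF summable_ind[OF n]]) (simp add: ind_def)
  have lam: "of_rat (1 / of_nat n) = 1 / real n" by (simp add: of_rat_divide)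
  have a': "of_rat a = real_of_int A / real_of_int D" and b': "of_rat b = real_of_int B / real_of_int D"
    and t': "of_rat t = real_of_int T / real_of_int D" by (simp_all add: a b t of_rat_divide)
  define c where "c = real_of_int A / real_of_int D * (real n / (real n - 1)) + (real_of_int B - real_of_int A) / real_of_int D * s"
  have "(\<lambda>i. of_rat a * (1 / real n) ^ i + (of_rat b - of_rat a) * (ind w i * (1 / real n) ^ i)) sums c"
    unfolding c_def a' b' diff_divide_distrib
    by (intro sums_add sums_mult geometric_inverse[OF n] s)
  moreover have "(\<lambda>i. of_rat a * (1 / real n) ^ i + (of_rat b - of_rat a) * (ind w i * (1 / real n) ^ i))
      = (\<lambda>i. wval a b (w i) * (1 / real n) ^ i)"
    by (rule ext, rename_tac i, case_tac "w i") (simp_all add: wval_def ind_def algebra_simps)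
  ultimately have "(\<lambda>i. wval a b (w i) * of_rat (1 / of_nat n) ^ i) sums c" unfolding lam by simp
  then have "discounted_sum_is (1 / of_nat n) a b w t \<longleftrightarrow> c = of_rat t"
    unfolding discounted_sum_is_def using sums_unique2 by blast
  also have "\<dots> \<longleftrightarrow> (real n - 1) * (real_of_int B - real_of_int A) * s = (real n - 1) * real_of_int T - real n * real_of_int A"
  proof -
    define d where "d = real_of_int D * (real n - 1)"
    have 1: "c * d = real_of_int A * real n + (real_of_int B - real_of_int A) * s * (real n - 1)"
      unfolding c_def d_def using n D by (simp add: distrib_right)
    have 2: "of_rat t * d = real_of_int T * (real n - 1)" unfolding t' d_def using D by simp
    have "c = of_rat t \<longleftrightarrow> c * d = of_rat t * d" using n D by (simp add: d_def)
    then show ?thesis unfolding 1 2 by (auto simp: algebra_simps)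
  qed
  also have "\<dots> \<longleftrightarrow> real_of_int ((int n - 1) * (B - A)) * s = real_of_int ((int n - 1) * T - int n * A)" by simp
  also have "\<dots> \<longleftrightarrow> (\<exists>P Q. ((int n - 1) * T - int n * A = int P \<and> (int n - 1) * (B - A) = int Q \<or>
            (int n - 1) * T - int n * A = - int P \<and> (int n - 1) * (B - A) = - int Q) \<and> real Q * s = real P)"
  proof -
    define X Y where "X = (int n - 1) * T - int n * A" and "Y = (int n - 1) * (B - A)"
    have "real_of_int Y * s = real_of_int X \<longleftrightarrow> (\<exists>P Q. (X = int P \<and> Y = int Q \<or> X = - int P \<and> Y = - int Q) \<and> real Q * s = real P)"
    proof
      assume e: "real_of_int Y * s = real_of_int X"
      show "\<exists>P Q. (X = int P \<and> Y = int Q \<or> X = - int P \<and> Y = - int Q) \<and> real Q * s = real P"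
      proof (cases "0 \<le> Y")
        case True
        then have "0 \<le> real_of_int X" unfolding e[symmetric] using s0 by (intro mult_nonneg_nonneg) auto
        then show ?thesis using True e by (intro exI[of _ "nat X"] exI[of _ "nat Y"]) auto
      next
        case False
        then have "real_of_int X \<le> 0" unfolding e[symmetric] using s0 by (intro mult_nonpos_nonneg) auto
        then show ?thesis using False e by (intro exI[of _ "nat (- X)"] exI[of _ "nat (- Y)"]) auto
      qed
    next
      assume "\<exists>P Q. (X = int P \<and> Y = int Q \<or> X = - int P \<and> Y = - int Q) \<and> real Q * s = real P"
      then show "real_of_int Y * s = real_of_int X" by auto
    qed
    then show ?thesis unfolding X_def Y_def .
  qed
  finally show ?thesis unfolding valid_seq_sums[OF n, of _ _ w] s_def[symmetric] .
qed

section \<open>The product of residuals and automaton\<close>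

context nfa begin

definition eclo :: "nat set \<Rightarrow> nat set" where
  "eclo S = {q. \<exists>p\<in>S. path p [] q}"

definition pstep :: "nat \<Rightarrow> nat \<Rightarrow> letter \<Rightarrow> nat \<times> nat set \<Rightarrow> nat \<times> nat set" where
  "pstep n Q m = (\<lambda>(R, S). (rstep n Q m R,
     eclo {q. \<exists>x p. allowed n Q m R x \<and> p \<in> S \<and> edge p (letter_code x) q}))"

lemma path_Cons_iff:
  "path p (x # u) q \<longleftrightarrow> (\<exists>p' p''. path p [] p' \<and> edge p' (letter_code x) p'' \<and> path p'' u q)"
proof
  show "\<exists>p' p''. path p [] p' \<and> edge p' (letter_code x) p'' \<and> path p'' u q" if "path p (x # u) q"
    using that
  proof (induction p "x # u" q rule: path.induct)
    case (path_eps p q r)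
    then show ?case using path.path_eps by blast
  next
    case (path_letter p q r)
    then show ?case using path_refl by blast
  qed
next
  assume "\<exists>p' p''. path p [] p' \<and> edge p' (letter_code x) p'' \<and> path p'' u q"
  then show "path p (x # u) q" using path_append[of p "[]"] path_letter by fastforce
qed

lemma path_append_iff: "path p (u @ v) q \<longleftrightarrow> (\<exists>p'. path p u p' \<and> path p' v q)"
proof
  show "\<exists>p'. path p u p' \<and> path p' v q" if "path p (u @ v) q"
    using that
  proof (induction u arbitrary: p)
    case Nil then show ?case using path_refl by auto
  next
    case (Cons x u)
    then show ?case by (simp add: path_Cons_iff) blast
  qed
qed (auto intro: path_append)

lemma path_snoc_iff:
  "path p (u @ [x]) q \<longleftrightarrow> (\<exists>p' p''. path p u p' \<and> edge p' (letter_code x) p'' \<and> path p'' [] q)"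
  unfolding path_append_iff path_Cons_iff using path_append[of p u] path_refl by fastforce

lemma fst_pstep: "fst ((pstep n Q m ^^ i) (R, S)) = (rstep n Q m ^^ i) R"
  by (induction i) (auto simp: pstep_def split: prod.splits)

text \<open>The start set is the closure of a single node, so membership speaks of paths from that
  very node. This is what makes a return to \<open>2 * t\<close> a closed path although only sets
  are tracked.\<close>

lemma snd_pstep:
  "snd ((pstep n Q m ^^ i) (R, eclo {p})) =
    {q. \<exists>u. length u = i \<and> (\<forall>j<i. allowed n Q m ((rstep n Q m ^^ j) R) (u ! j)) \<and> path p u q}"
proof (induction i)
  case 0 then show ?case by (simp add: eclo_def)
next
  case (Suc i)
  define S where "S = snd ((pstep n Q m ^^ i) (R, eclo {p}))"
  have eq: "(pstep n Q m ^^ i) (R, eclo {p}) = ((rstep n Q m ^^ i) R, S)"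
    using fst_pstep[of i n Q m R "eclo {p}"] S_def by (metis prod.collapse)
  have "snd ((pstep n Q m ^^ Suc i) (R, eclo {p})) =
      eclo {q. \<exists>x p. allowed n Q m ((rstep n Q m ^^ i) R) x \<and> p \<in> S \<and> edge p (letter_code x) q}"
    unfolding funpow.simps comp_apply eq by (simp add: pstep_def)
  also have "\<dots> = {q. \<exists>u x. length u = i \<and> (\<forall>j<i. allowed n Q m ((rstep n Q m ^^ j) R) (u ! j)) \<and>
      allowed n Q m ((rstep n Q m ^^ i) R) x \<and> path p (u @ [x]) q}"
    unfolding S_def Suc.IH unfolding path_snoc_iff eclo_def by blast
  also have "\<dots> = {q. \<exists>u. length u = Suc i \<and> (\<forall>j<Suc i. allowed n Q m ((rstep n Q m ^^ j) R) (u ! j)) \<and> path p u q}"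
    (is "?A = ?B")
  proof
    show "?A \<subseteq> ?B"
    proof
      fix q assume "q \<in> ?A"
      then obtain u x where u: "length u = i" "\<forall>j<i. allowed n Q m ((rstep n Q m ^^ j) R) (u ! j)"
        "allowed n Q m ((rstep n Q m ^^ i) R) x" "path p (u @ [x]) q" by blast
      then show "q \<in> ?B" by (intro CollectI exI[of _ "u @ [x]"]) (auto simp: nth_append less_Suc_eq)
    qed
    show "?B \<subseteq> ?A"
    proof
      fix q assume "q \<in> ?B"
      then obtain u where u: "length u = Suc i" "\<forall>j<Suc i. allowed n Q m ((rstep n Q m ^^ j) R) (u ! j)" "path p u q"
        by blast
      obtain v x where v: "u = v @ [x]" using u(1) by (cases u rule: rev_cases) auto
      have "\<forall>j<i. allowed n Q m ((rstep n Q m ^^ j) R) (v ! j)"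
      proof (intro allI impI)
        fix j assume "j < i"
        then show "allowed n Q m ((rstep n Q m ^^ j) R) (v ! j)" using u(2)[rule_format, of j] u(1) v by (simp add: nth_append)
      qed
      moreover have "allowed n Q m ((rstep n Q m ^^ i) R) x" using u(1) u(2)[rule_format, of i] v by (simp add: nth_append)
      ultimately show "q \<in> ?A" using u(1,3) v by (intro CollectI exI[of _ v] exI[of _ x]) auto
    qed
  qed
  finally show ?case .
qed

lemma path_segments:
  assumes "strict_mono h" "\<And>i. path q (map x [h i..<h (Suc i)]) q" "i \<le> j"
  shows "path q (map x [h i..<h j]) q"
  using assms(3)
proof (induction j rule: dec_induct)
  case base then show ?case by (simp add: path_refl)
next
  case (step j)
  have "h i \<le> h j" "h j \<le> h (Suc j)" using assms(1) step.hyps by (auto simp: strict_mono_less_eq)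
  then show ?case using path_append[OF step.IH assms(2)[of j]] by (simp add: map_upt_append)
qed

theorem lasso_iff:
  assumes e: "drop k w = oexp_enc e" and n: "2 \<le> n" and P: "P * (n - 1) \<le> n * Q"
  shows "(\<exists>x. x \<in> olang e \<and> (\<forall>i. allowed n Q m ((rstep n Q m ^^ i) P) (x i))) \<longleftrightarrow>
    (\<exists>t<length w. k \<le> t \<and> tok_at w t = 13 \<and> (\<exists>i l. 2 * t \<in> snd ((pstep n Q m ^^ i) (P, eclo {2 * k})) \<and>
       (rstep n Q m ^^ Suc l) ((rstep n Q m ^^ i) P) = (rstep n Q m ^^ i) P \<and>
       2 * t \<in> snd ((pstep n Q m ^^ Suc l) ((rstep n Q m ^^ i) P, eclo {2 * t}))))"
proof
  let ?f = "rstep n Q m"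
  assume "\<exists>x. x \<in> olang e \<and> (\<forall>i. allowed n Q m ((?f ^^ i) P) (x i))"
  then obtain x where x: "x \<in> olang e" "\<And>i. allowed n Q m ((?f ^^ i) P) (x i)" by blast
  obtain t h where t: "t < length w" "k \<le> t" "tok_at w t = 13" and h: "strict_mono h"
    "path (2 * k) (map x [0..<h 0]) (2 * t)" "\<And>i. path (2 * t) (map x [h i..<h (Suc i)]) (2 * t)"
    using x(1) unfolding olang_iff_path[OF e] by blast
  have b: "(?f ^^ i) P * (n - 1) \<le> n * Q" for i
    using n P by (induction i) (simp_all add: rstep_bound[simplified])
  have "(?f ^^ i) P \<le> n * Q" for i
  proof -
    have "(?f ^^ i) P * 1 \<le> (?f ^^ i) P * (n - 1)" using n by (intro mult_le_mono2) simp
    then show ?thesis using b[of i] by linarith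
  qed
  then have "range (\<lambda>j. (?f ^^ h j) P) \<subseteq> {..n * Q}" by auto
  then have "finite (range (\<lambda>j. (?f ^^ h j) P))" by (rule finite_subset) simp
  \<comment> \<open>Infinitely many visits of the accepting node meet finitely many residuals, so
    two visits share a residual and enclose the loop.\<close>
  then have "\<not> inj (\<lambda>j. (?f ^^ h j) P)" using finite_imageD infinite_UNIV_nat by blast
  then obtain i j where "i < j" and ij: "(?f ^^ h i) P = (?f ^^ h j) P"
    unfolding inj_def by (metis linorder_neqE_nat)
  \<comment> \<open>The loop length is written \<open>Suc l\<close> to exclude the empty
    loop.\<close>
  define l where "l = h j - h i - 1"
  have "h i < h j" using h(1) \<open>i < j\<close> by (simp add: strict_mono_less)
  then have l: "Suc l + h i = h j" by (simp add: l_def)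
  have le: "h 0 \<le> h i" using h(1) by (simp add: strict_mono_less_eq)
  have "path (2 * k) (map x [0..<h i]) (2 * t)"
    using path_append[OF h(2) path_segments[OF h(1,3), of 0 i]] le by (simp add: map_upt_append)
  then have "2 * t \<in> snd ((pstep n Q m ^^ h i) (P, eclo {2 * k}))"
    unfolding snd_pstep using x(2) by (intro CollectI exI[of _ "map x [0..<h i]"]) simp
  moreover have "(?f ^^ Suc l) ((?f ^^ h i) P) = (?f ^^ h i) P"
    using funpow_add[of "Suc l" "h i" ?f] ij l by (metis comp_apply)
  moreover have "2 * t \<in> snd ((pstep n Q m ^^ Suc l) ((?f ^^ h i) P, eclo {2 * t}))"
  proof -
    have "path (2 * t) (map x [h i..<h j]) (2 * t)"
      using path_segments[OF h(1,3), of i j] \<open>i < j\<close> by simp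
    moreover have "(?f ^^ d) ((?f ^^ h i) P) = (?f ^^ (h i + d)) P" for d
      by (simp add: funpow_add add.commute)
    ultimately show ?thesis
      unfolding snd_pstep using x(2) l by (intro CollectI exI[of _ "map x [h i..<h j]"]) auto
  qed
  ultimately show "\<exists>t<length w. k \<le> t \<and> tok_at w t = 13 \<and> (\<exists>i l. 2 * t \<in> snd ((pstep n Q m ^^ i) (P, eclo {2 * k})) \<and>
       (?f ^^ Suc l) ((?f ^^ i) P) = (?f ^^ i) P \<and> 2 * t \<in> snd ((pstep n Q m ^^ Suc l) ((?f ^^ i) P, eclo {2 * t})))"
    using t by blast
next
  let ?f = "rstep n Q m"
  assume "\<exists>t<length w. k \<le> t \<and> tok_at w t = 13 \<and> (\<exists>i l. 2 * t \<in> snd ((pstep n Q m ^^ i) (P, eclo {2 * k})) \<and>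
       (?f ^^ Suc l) ((?f ^^ i) P) = (?f ^^ i) P \<and> 2 * t \<in> snd ((pstep n Q m ^^ Suc l) ((?f ^^ i) P, eclo {2 * t})))"
  then obtain t i l where t: "t < length w" "k \<le> t" "tok_at w t = 13"
    and il: "2 * t \<in> snd ((pstep n Q m ^^ i) (P, eclo {2 * k}))" "(?f ^^ Suc l) ((?f ^^ i) P) = (?f ^^ i) P"
      "2 * t \<in> snd ((pstep n Q m ^^ Suc l) ((?f ^^ i) P, eclo {2 * t}))" by blast
  obtain u where u: "length u = i" "\<And>j. j < i \<Longrightarrow> allowed n Q m ((?f ^^ j) P) (u ! j)" "path (2 * k) u (2 * t)"
    using il(1) unfolding snd_pstep by blast
  obtain v where v: "length v = Suc l" "\<And>j. j < Suc l \<Longrightarrow> allowed n Q m ((?f ^^ j) ((?f ^^ i) P)) (v ! j)"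
    "path (2 * t) v (2 * t)" using il(3) unfolding snd_pstep by blast
  \<comment> \<open>The word \<open>u\<close> followed by \<open>v\<close> forever. Its letters are
    allowed because each turn of \<open>v\<close> restores the residual.\<close>
  define x where "x j = (if j < i then u ! j else v ! ((j - i) mod Suc l))" for j
  define h where "h j = i + j * Suc l" for j
  have per: "(?f ^^ (c * Suc l)) ((?f ^^ i) P) = (?f ^^ i) P" for c
  proof (induction c)
    case (Suc c)
    have "(?f ^^ (Suc c * Suc l)) ((?f ^^ i) P) = (?f ^^ (c * Suc l)) ((?f ^^ Suc l) ((?f ^^ i) P))"
      by (metis add.commute comp_apply funpow_add mult_Suc)
    then show ?case using Suc il(2) by simp
  qed simp
  have "allowed n Q m ((?f ^^ j) P) (x j)" for j
  proof (cases "j < i")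
    case False
    define c d where "c = (j - i) div Suc l" and "d = (j - i) mod Suc l"
    have j: "j = d + c * Suc l + i" using False div_mult_mod_eq[of "j - i" "Suc l"] by (simp add: c_def d_def)
    have "(?f ^^ j) P = (?f ^^ d) ((?f ^^ i) P)"
      unfolding j funpow_add comp_apply per ..
    moreover have "d < Suc l" by (simp add: d_def)
    ultimately show ?thesis using v(2)[of d] False by (simp add: x_def d_def)
  qed (simp add: x_def u(2))
  moreover have "x \<in> olang e"
  proof -
    have "strict_mono h" by (simp add: strict_mono_Suc_iff h_def)
    moreover have "map x [0..<h 0] = u" using u(1) by (intro nth_equalityI) (auto simp: h_def x_def)
    moreover have "map x [h j..<h (Suc j)] = v" for j
    proof (rule nth_equalityI)
      show "length (map x [h j..<h (Suc j)]) = length v" using v(1) by (simp add: h_def)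
      fix d assume "d < length (map x [h j..<h (Suc j)])"
      then have d': "d < h (Suc j) - h j" by (simp only: length_map length_upt)
      then have d: "d < Suc l" by (simp add: h_def)
      have "map x [h j..<h (Suc j)] ! d = x (h j + d)"
        using d' nth_map_upt[of d "h (Suc j)" "h j" x] by simp
      also have "h j + d - i = d + j * Suc l" by (simp add: h_def)
      then have "x (h j + d) = v ! d" using d by (simp add: x_def h_def mod_mult_self1 del: mult_Suc_right)
      finally show "map x [h j..<h (Suc j)] ! d = v ! d" .
    qed
    ultimately show ?thesis unfolding olang_iff_path[OF e] using t u(3) v(3) by (metis (no_types))
  qed
  ultimately show "\<exists>x. x \<in> olang e \<and> (\<forall>i. allowed n Q m ((?f ^^ i) P) (x i))" by blast
qed

end

text \<open>Up to the first index with a given value the orbit has no repetition, since a repetition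
  could be cut out to give a smaller index.\<close>

lemma orbit_bounded:
  fixes f :: "'a \<Rightarrow> 'a"
  assumes "finite A" "\<And>i. (f ^^ i) x \<in> A"
  shows "\<exists>i' < card A. (f ^^ i') x = (f ^^ i) x"
proof -
  define i' where "i' = (LEAST j. (f ^^ j) x = (f ^^ i) x)"
  have i': "(f ^^ i') x = (f ^^ i) x" unfolding i'_def by (rule LeastI) (rule refl)
  have inj: "inj_on (\<lambda>j. (f ^^ j) x) {..i'}"
  proof (rule linorder_inj_onI)
    fix a b assume ab: "a < b" "a \<in> {..i'}" "b \<in> {..i'}"
    show "(f ^^ a) x \<noteq> (f ^^ b) x"
    proof
      assume eq: "(f ^^ a) x = (f ^^ b) x"
      have "(f ^^ (i' - b + a)) x = (f ^^ (i' - b + b)) x" unfolding funpow_add comp_apply eq ..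
      then have "(f ^^ (i' - b + a)) x = (f ^^ i) x" using ab i' by simp
      then have "i' \<le> i' - b + a" unfolding i'_def by (rule Least_le)
      then show False using ab by simp
    qed
  qed auto
  have "Suc i' = card ((\<lambda>j. (f ^^ j) x) ` {..i'})" using card_image[OF inj] by simp
  also have "\<dots> \<le> card A" using assms by (intro card_mono) auto
  finally show ?thesis using i' by (intro exI[of _ i']) simp
qed

section \<open>The decision procedure on numbers\<close>

text \<open>The input \<open>w\<close> is coded as the number \<open>X = \<Sum>i. 16 ^ i * tok_code (w ! i)\<close>.
  All arithmetic is modulo the register size \<open>B\<close>.\<close>

definition tokN :: "nat \<Rightarrow> nat \<Rightarrow> nat" where
  "tokN X i = X div 16 ^ i mod 16"

definition arity :: "nat \<Rightarrow> nat" where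
  "arity c = (if c = 10 \<or> c = 11 \<or> c = 14 \<or> c = 15 then 2 else if c = 12 \<or> c = 13 then 1 else 0)"

text \<open>The end of the subexpression starting at \<open>i\<close>: the first position where the number of
  pending operands drops to 0.\<close>

definition endN :: "nat \<Rightarrow> nat \<Rightarrow> nat \<Rightarrow> nat \<Rightarrow> nat" where
  "endN B X L i = fst (((\<lambda>(j, c). (if c = 0 then j else (j + 1) mod B,
      if c = 0 then c else (c - 1 + arity (tokN X j)) mod B)) ^^ L) (i, 1))"

definition edgeN :: "nat \<Rightarrow> nat \<Rightarrow> nat \<Rightarrow> nat \<Rightarrow> nat \<Rightarrow> nat \<Rightarrow> nat \<Rightarrow> bool" where
  "edgeN B X L k p x q \<longleftrightarrow> (\<exists>i<L. k \<le> i \<and> gen (tokN X i) i ((i + 1) mod B) (endN B X L ((i + 1) mod B)) p x q)"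

definition setN :: "nat \<Rightarrow> nat \<Rightarrow> (nat \<Rightarrow> bool) \<Rightarrow> nat" where
  "setN B m P = (\<Sum>q<m. 2 ^ q * of_bool (P q)) mod B"

definition epsN :: "nat \<Rightarrow> nat \<Rightarrow> nat \<Rightarrow> nat \<Rightarrow> nat \<Rightarrow> nat" where
  "epsN B X L k S = setN B ((2 * L) mod B) (\<lambda>q. bit S q \<or> (\<exists>p<(2 * L) mod B. bit S p \<and> edgeN B X L k p 0 q))"

text \<open>\<open>B - 1\<close> is the largest register value. Since \<open>B\<close> will exceed
  the square of the number of nodes, that many rounds exhaust all silent moves.\<close>

definition cloN :: "nat \<Rightarrow> nat \<Rightarrow> nat \<Rightarrow> nat \<Rightarrow> nat \<Rightarrow> nat" where
  "cloN B X L k S = (epsN B X L k ^^ (B - 1)) S"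

definition nodeN :: "nat \<Rightarrow> nat \<Rightarrow> nat \<Rightarrow> nat \<Rightarrow> nat \<Rightarrow> nat" where
  "nodeN B X L k t = cloN B X L k (setN B ((2 * L) mod B) (\<lambda>q. q = (2 * t) mod B))"

definition nxN :: "nat \<Rightarrow> nat \<Rightarrow> nat \<Rightarrow> nat \<Rightarrow> nat \<Rightarrow> nat" where
  "nxN B n Q x R = (if x = 1 then (n * R) mod B else (n * (R - Q)) mod B)"

definition okN :: "nat \<Rightarrow> nat \<Rightarrow> nat \<Rightarrow> nat \<Rightarrow> nat \<Rightarrow> bool" where
  "okN B n Q x R \<longleftrightarrow> (if x = 1 then (R * (n - 1)) mod B \<le> Q else Q \<le> R \<and> ((R - Q) * (n - 1)) mod B \<le> Q)"

text \<open>Letters are the numbers 1 and 2, so \<open>3 - m\<close> is the other letter.\<close>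

definition rstepN :: "nat \<Rightarrow> nat \<Rightarrow> nat \<Rightarrow> nat \<Rightarrow> nat \<Rightarrow> nat" where
  "rstepN B n Q m R = (if okN B n Q m R then nxN B n Q m R
     else if okN B n Q (3 - m) R then nxN B n Q (3 - m) R else R)"

definition allowedN :: "nat \<Rightarrow> nat \<Rightarrow> nat \<Rightarrow> nat \<Rightarrow> nat \<Rightarrow> nat \<Rightarrow> bool" where
  "allowedN B n Q m R x \<longleftrightarrow> okN B n Q x R \<and> nxN B n Q x R = rstepN B n Q m R"

definition moveN :: "nat \<Rightarrow> nat \<Rightarrow> nat \<Rightarrow> nat \<Rightarrow> nat \<Rightarrow> nat \<Rightarrow> nat \<Rightarrow> nat \<Rightarrow> nat \<Rightarrow> nat" where
  "moveN B X L k n Q m R S = cloN B X L k (setN B ((2 * L) mod B)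
     (\<lambda>q. \<exists>p<(2 * L) mod B. bit S p \<and> (allowedN B n Q m R 1 \<and> edgeN B X L k p 1 q \<or> allowedN B n Q m R 2 \<and> edgeN B X L k p 2 q)))"

definition runN :: "nat \<Rightarrow> nat \<Rightarrow> nat \<Rightarrow> nat \<Rightarrow> nat \<Rightarrow> nat \<Rightarrow> nat \<Rightarrow> nat \<Rightarrow> nat \<Rightarrow> nat \<Rightarrow> nat \<times> nat" where
  "runN B X L k n Q m i R S = ((\<lambda>(R, S). (rstepN B n Q m R, moveN B X L k n Q m R S)) ^^ i) (R, S)"

definition lassoN :: "nat \<Rightarrow> nat \<Rightarrow> nat \<Rightarrow> nat \<Rightarrow> nat \<Rightarrow> nat \<Rightarrow> nat \<Rightarrow> nat \<Rightarrow> nat \<Rightarrow> nat \<Rightarrow> bool" where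
  "lassoN B X L k n Q m t R l \<longleftrightarrow>
     fst (runN B X L k n Q m ((l + 1) mod B) R (nodeN B X L k t)) = R \<and>
     bit (snd (runN B X L k n Q m ((l + 1) mod B) R (nodeN B X L k t))) ((2 * t) mod B)"

definition accN :: "nat \<Rightarrow> nat \<Rightarrow> nat \<Rightarrow> nat \<Rightarrow> nat \<Rightarrow> nat \<Rightarrow> nat \<Rightarrow> bool" where
  "accN B X L k n Q P \<longleftrightarrow> (\<exists>m<3. 0 < m \<and> (\<exists>i<B - 1. \<exists>t<L. k \<le> t \<and> tokN X t = 13 \<and>
     bit (snd (runN B X L k n Q m i P (nodeN B X L k k))) ((2 * t) mod B) \<and>
     (\<exists>l<B - 1. lassoN B X L k n Q m t (fst (runN B X L k n Q m i P (nodeN B X L k k))) l)))"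

text \<open>A grammar check at one position: operands must start with tokens of the right kind, 6 to
  12 for regular and 13 to 15 for omega-regular expressions. Checking all positions replaces a
  recursive parser.\<close>

definition wfN :: "nat \<Rightarrow> nat \<Rightarrow> nat \<Rightarrow> nat \<Rightarrow> bool" where
  "wfN B X L i \<longleftrightarrow>
    (let c = tokN X i; j = (i + 1) mod B; k = endN B X L j;
         isR = (\<lambda>j. 6 \<le> tokN X j \<and> tokN X j \<le> 12); isO = (\<lambda>j. 13 \<le> tokN X j)
     in (6 \<le> c \<and> c \<le> 9) \<or> ((c = 10 \<or> c = 11) \<and> isR j \<and> isR k) \<or> ((c = 12 \<or> c = 13) \<and> isR j) \<or>
        (c = 14 \<and> isR j \<and> isO k) \<or> (c = 15 \<and> isO j \<and> isO k))"

definition oexpN :: "nat \<Rightarrow> nat \<Rightarrow> nat \<Rightarrow> nat \<Rightarrow> bool" where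
  "oexpN B X L k \<longleftrightarrow> 13 \<le> tokN X k \<and> endN B X L k = L \<and> (\<forall>i<L. k \<le> i \<longrightarrow> wfN B X L i)"

text \<open>The codes of \<open>T0\<close> and \<open>T1\<close> are 1 and 2, hence the
  \<open>- 1\<close>.\<close>

definition valN :: "nat \<Rightarrow> nat \<Rightarrow> nat \<Rightarrow> nat \<Rightarrow> nat" where
  "valN B X i j = snd (((\<lambda>(l, a). ((l + 1) mod B, ((2 * a) mod B + (tokN X l - 1)) mod B)) ^^ (j - i)) (i, 0))"

text \<open>\<open>nat_enc\<close> produces a leading zero only in a word of length one; anything
  else must not count as an encoding.\<close>

definition natN :: "nat \<Rightarrow> nat \<Rightarrow> nat \<Rightarrow> nat \<Rightarrow> nat \<Rightarrow> bool" where
  "natN B X i j m \<longleftrightarrow> i < j \<and> (\<forall>l<j. i \<le> l \<longrightarrow> tokN X l = 1 \<or> tokN X l = 2) \<and>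
     (tokN X i = 2 \<or> j = (i + 1) mod B) \<and> m = valN B X i j"

text \<open>An integer is represented as \<open>p - q\<close> with one of the natural numbers \<open>p\<close>, \<open>q\<close> equal to 0.\<close>

definition intN :: "nat \<Rightarrow> nat \<Rightarrow> nat \<Rightarrow> nat \<Rightarrow> nat \<Rightarrow> nat \<Rightarrow> bool" where
  "intN B X i j p q \<longleftrightarrow> q = 0 \<and> natN B X i j p \<or> p = 0 \<and> 0 < q \<and> tokN X i = 3 \<and> natN B X ((i + 1) mod B) j q"

text \<open>\<open>rat_enc\<close> uses the normal form of \<open>quotient_of\<close>, so a fraction
  that is not reduced is no encoding.\<close>

definition ratN :: "nat \<Rightarrow> nat \<Rightarrow> nat \<Rightarrow> nat \<Rightarrow> nat \<Rightarrow> nat \<Rightarrow> nat \<Rightarrow> bool" where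
  "ratN B X i j p q d \<longleftrightarrow> (\<exists>c<j. tokN X c = 4 \<and> intN B X i c p q \<and> natN B X ((c + 1) mod B) j d) \<and> 0 < d \<and>
     (\<forall>y<B - 1. y dvd p \<and> y dvd q \<and> y dvd d \<longrightarrow> y = 1)"

definition mul4 :: "nat \<Rightarrow> nat \<Rightarrow> nat \<Rightarrow> nat \<Rightarrow> nat \<Rightarrow> nat" where
  "mul4 B w x y z = (((w * x) mod B * y) mod B * z) mod B"

text \<open>With numerators \<open>T\<close>, \<open>A\<close>, \<open>C\<close> of target and
  weights over a common denominator, \<open>x - y\<close> is \<open>(n - 1) * T - n * A\<close> and
  \<open>u - v\<close> is \<open>(n - 1) * (C - A)\<close>, negative parts being moved to
  \<open>y\<close> and \<open>v\<close>. The two cases are the two common signs.\<close>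

definition eqN :: "nat \<Rightarrow> nat \<Rightarrow> nat \<Rightarrow> nat \<Rightarrow> nat \<Rightarrow> nat \<Rightarrow> nat \<Rightarrow> nat \<Rightarrow> nat \<Rightarrow> nat \<Rightarrow> nat \<Rightarrow> nat \<Rightarrow> nat \<Rightarrow> bool" where
  "eqN B n tp tn td ap an ad bp bn bd P Q \<longleftrightarrow>
    (let x = (mul4 B (n - 1) tp ad bd + mul4 B n an td bd) mod B; y = (mul4 B (n - 1) tn ad bd + mul4 B n ap td bd) mod B;
         u = (mul4 B (n - 1) bp td ad + mul4 B (n - 1) an td bd) mod B; v = (mul4 B (n - 1) bn td ad + mul4 B (n - 1) ap td bd) mod B
     in y \<le> x \<and> P = x - y \<and> v \<le> u \<and> Q = u - v \<or> x \<le> y \<and> P = y - x \<and> u \<le> v \<and> Q = v - u)"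

text \<open>Bounds are \<open>B - 1\<close> because \<open>B\<close> itself is no register value.
  The codes 2 and 4 at the front spell the numerator 1 and the slash of \<open>1 / n\<close>, code 5
  is the separator, and \<open>L\<close> is the first position without a token.\<close>

definition ctdsN :: "nat \<Rightarrow> nat \<Rightarrow> bool" where
  "ctdsN B X \<longleftrightarrow>
    (\<exists>L<B - 1. tokN X L = 0 \<and> (\<forall>i<L. tokN X i \<noteq> 0) \<and> tokN X 0 = 2 \<and> tokN X 1 = 4 \<and>
      (\<exists>j1<L. \<exists>j2<L. \<exists>j3<L. \<exists>j4<L. tokN X j1 = 5 \<and> tokN X j2 = 5 \<and> tokN X j3 = 5 \<and> tokN X j4 = 5 \<and>
        oexpN B X L ((j4 + 1) mod B) \<and>
        (\<exists>n<B - 1. natN B X 2 j1 n \<and> 2 \<le> n \<and>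
        (\<exists>tp<B - 1. \<exists>tn<B - 1. \<exists>td<B - 1. ratN B X ((j1 + 1) mod B) j2 tp tn td \<and>
        (\<exists>ap<B - 1. \<exists>an<B - 1. \<exists>ad<B - 1. ratN B X ((j2 + 1) mod B) j3 ap an ad \<and>
        (\<exists>bp<B - 1. \<exists>bn<B - 1. \<exists>bd<B - 1. ratN B X ((j3 + 1) mod B) j4 bp bn bd \<and>
        (\<exists>P<B - 1. \<exists>Q<B - 1. eqN B n tp tn td ap an ad bp bn bd P Q \<and> (P * (n - 1)) mod B \<le> (n * Q) mod B \<and>
           accN B X L ((j4 + 1) mod B) n Q P)))))))"

section \<open>The procedure is computable in polynomial space\<close>

lemma psp_tokN [psp_intros]: "psp f \<Longrightarrow> psp g \<Longrightarrow> psp (\<lambda>B \<rho>. tokN (f B \<rho>) (g B \<rho>))"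
  unfolding tokN_def by (intro psp_mod psp_funpow_div psp_intros) simp_all

lemma psp_arity [psp_intros]: "psp f \<Longrightarrow> psp (\<lambda>B \<rho>. arity (f B \<rho>))"
  unfolding arity_def by (intro psp_intros) simp_all

lemma psp_setN [psp_intros]:
  assumes "psp m" "pspP (\<lambda>B \<rho>. P B (\<lambda>i. \<rho> (Suc i)) (\<rho> 0))"
  shows "psp (\<lambda>B \<rho>. setN B (m B \<rho>) (P B \<rho>))"
  unfolding setN_def by (rule psp_digits[where f = "\<lambda>B \<rho> q. of_bool (P B \<rho> q)"]) (use assms in auto)

lemma psp_subst4:
  assumes "psp (\<lambda>B \<rho>. h B (\<rho> 0) (\<rho> 1) (\<rho> 2) (\<rho> 3))" "psp f0" "psp f1" "psp f2" "psp f3"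
  shows "psp (\<lambda>B \<rho>. h B (f0 B \<rho>) (f1 B \<rho>) (f2 B \<rho>) (f3 B \<rho>))"
  using psp_subst_list[OF assms(1), of "[f0, f1, f2, f3]"] assms(2-) by simp

lemma psp_subst6:
  assumes "psp (\<lambda>B \<rho>. h B (\<rho> 0) (\<rho> 1) (\<rho> 2) (\<rho> 3) (\<rho> 4) (\<rho> 5))" "psp f0" "psp f1" "psp f2" "psp f3" "psp f4" "psp f5"
  shows "psp (\<lambda>B \<rho>. h B (f0 B \<rho>) (f1 B \<rho>) (f2 B \<rho>) (f3 B \<rho>) (f4 B \<rho>) (f5 B \<rho>))"
  using psp_subst_list[OF assms(1), of "[f0, f1, f2, f3, f4, f5]"] assms(2-) by simp

lemma psp_subst8:
  assumes "psp (\<lambda>B \<rho>. h B (\<rho> 0) (\<rho> 1) (\<rho> 2) (\<rho> 3) (\<rho> 4) (\<rho> 5) (\<rho> 6) (\<rho> 7))"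
    "psp f0" "psp f1" "psp f2" "psp f3" "psp f4" "psp f5" "psp f6" "psp f7"
  shows "psp (\<lambda>B \<rho>. h B (f0 B \<rho>) (f1 B \<rho>) (f2 B \<rho>) (f3 B \<rho>) (f4 B \<rho>) (f5 B \<rho>) (f6 B \<rho>) (f7 B \<rho>))"
  using psp_subst_list[OF assms(1), of "[f0, f1, f2, f3, f4, f5, f6, f7]"] assms(2-) by simp

lemma psp_subst9:
  assumes "psp (\<lambda>B \<rho>. h B (\<rho> 0) (\<rho> 1) (\<rho> 2) (\<rho> 3) (\<rho> 4) (\<rho> 5) (\<rho> 6) (\<rho> 7) (\<rho> 8))"
    "psp f0" "psp f1" "psp f2" "psp f3" "psp f4" "psp f5" "psp f6" "psp f7" "psp f8"
  shows "psp (\<lambda>B \<rho>. h B (f0 B \<rho>) (f1 B \<rho>) (f2 B \<rho>) (f3 B \<rho>) (f4 B \<rho>) (f5 B \<rho>) (f6 B \<rho>) (f7 B \<rho>) (f8 B \<rho>))"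
  using psp_subst_list[OF assms(1), of "[f0, f1, f2, f3, f4, f5, f6, f7, f8]"] assms(2-) by simp

lemma psp_endN [psp_intros]: "psp f \<Longrightarrow> psp g \<Longrightarrow> psp h \<Longrightarrow> psp (\<lambda>B \<rho>. endN B (f B \<rho>) (g B \<rho>) (h B \<rho>))"
proof (rule psp_subst3[where h = "endN"])
  show "psp (\<lambda>B \<rho>. endN B (\<rho> 0) (\<rho> (Suc 0)) (\<rho> 2))"
    unfolding endN_def by (rule psp_iter2; intro psp_intros)
qed

lemma psp_gen [psp_intros]:
  "psp f \<Longrightarrow> psp g \<Longrightarrow> psp h \<Longrightarrow> psp i \<Longrightarrow> psp j \<Longrightarrow> psp k \<Longrightarrow> psp l \<Longrightarrow>
   pspP (\<lambda>B \<rho>. gen (f B \<rho>) (g B \<rho>) (h B \<rho>) (i B \<rho>) (j B \<rho>) (k B \<rho>) (l B \<rho>))"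
  unfolding gen_def Let_def by (intro psp_intros psp_div psp_mod) simp_all

lemma psp_edgeN [psp_intros]:
  "psp f0 \<Longrightarrow> psp f1 \<Longrightarrow> psp f2 \<Longrightarrow> psp f3 \<Longrightarrow> psp f4 \<Longrightarrow> psp f5 \<Longrightarrow>
   pspP (\<lambda>B \<rho>. edgeN B (f0 B \<rho>) (f1 B \<rho>) (f2 B \<rho>) (f3 B \<rho>) (f4 B \<rho>) (f5 B \<rho>))"
proof (rule psp_subst6[where h = "\<lambda>B a b c d e f. of_bool (edgeN B a b c d e f)"])
  show "pspP (\<lambda>B \<rho>. edgeN B (\<rho> 0) (\<rho> 1) (\<rho> 2) (\<rho> 3) (\<rho> 4) (\<rho> 5))"
    unfolding edgeN_def by (intro psp_intros)
qed

lemma psp_cloN [psp_intros]: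
  "psp f0 \<Longrightarrow> psp f1 \<Longrightarrow> psp f2 \<Longrightarrow> psp f3 \<Longrightarrow>
   psp (\<lambda>B \<rho>. cloN B (f0 B \<rho>) (f1 B \<rho>) (f2 B \<rho>) (f3 B \<rho>))"
proof (rule psp_subst4[where h = "cloN"])
  show "psp (\<lambda>B \<rho>. cloN B (\<rho> 0) (\<rho> 1) (\<rho> 2) (\<rho> 3))"
    unfolding cloN_def epsN_def by (rule psp_iter; (intro psp_intros)?; simp)
qed

lemma psp_nodeN [psp_intros]:
  "psp f0 \<Longrightarrow> psp f1 \<Longrightarrow> psp f2 \<Longrightarrow> psp f3 \<Longrightarrow>
   psp (\<lambda>B \<rho>. nodeN B (f0 B \<rho>) (f1 B \<rho>) (f2 B \<rho>) (f3 B \<rho>))"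
proof (rule psp_subst4[where h = "nodeN"])
  show "psp (\<lambda>B \<rho>. nodeN B (\<rho> 0) (\<rho> 1) (\<rho> 2) (\<rho> 3))"
    unfolding nodeN_def by (intro psp_intros) simp_all
qed

lemma psp_nxN [psp_intros]:
  "psp f0 \<Longrightarrow> psp f1 \<Longrightarrow> psp f2 \<Longrightarrow> psp f3 \<Longrightarrow> psp (\<lambda>B \<rho>. nxN B (f0 B \<rho>) (f1 B \<rho>) (f2 B \<rho>) (f3 B \<rho>))"
  unfolding nxN_def by (intro psp_intros)

lemma psp_okN [psp_intros]:
  "psp f0 \<Longrightarrow> psp f1 \<Longrightarrow> psp f2 \<Longrightarrow> psp f3 \<Longrightarrow> pspP (\<lambda>B \<rho>. okN B (f0 B \<rho>) (f1 B \<rho>) (f2 B \<rho>) (f3 B \<rho>))"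
proof (rule psp_subst4[where h = "\<lambda>B a b c d. of_bool (okN B a b c d)"])
  \<comment> \<open>\<open>psp_if\<close> concerns numbers, so a conditional between truth values is
    first rewritten with connectives.\<close>
  have "okN B n Q x R \<longleftrightarrow> x = 1 \<and> (R * (n - 1)) mod B \<le> Q \<or> x \<noteq> 1 \<and> Q \<le> R \<and> ((R - Q) * (n - 1)) mod B \<le> Q" for B n Q x R
    by (auto simp: okN_def)
  then show "pspP (\<lambda>B \<rho>. okN B (\<rho> 0) (\<rho> 1) (\<rho> 2) (\<rho> 3))"
    by (simp only:) (intro psp_intros)
qed

lemma psp_rstepN [psp_intros]:
  "psp f0 \<Longrightarrow> psp f1 \<Longrightarrow> psp f2 \<Longrightarrow> psp f3 \<Longrightarrow> psp (\<lambda>B \<rho>. rstepN B (f0 B \<rho>) (f1 B \<rho>) (f2 B \<rho>) (f3 B \<rho>))"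
  unfolding rstepN_def by (intro psp_intros) simp_all

lemma psp_allowedN [psp_intros]:
  "psp f0 \<Longrightarrow> psp f1 \<Longrightarrow> psp f2 \<Longrightarrow> psp f3 \<Longrightarrow> psp f4 \<Longrightarrow>
   pspP (\<lambda>B \<rho>. allowedN B (f0 B \<rho>) (f1 B \<rho>) (f2 B \<rho>) (f3 B \<rho>) (f4 B \<rho>))"
  unfolding allowedN_def by (intro psp_intros)

lemma psp_moveN [psp_intros]:
  "psp f0 \<Longrightarrow> psp f1 \<Longrightarrow> psp f2 \<Longrightarrow> psp f3 \<Longrightarrow> psp f4 \<Longrightarrow> psp f5 \<Longrightarrow> psp f6 \<Longrightarrow> psp f7 \<Longrightarrow>
   psp (\<lambda>B \<rho>. moveN B (f0 B \<rho>) (f1 B \<rho>) (f2 B \<rho>) (f3 B \<rho>) (f4 B \<rho>) (f5 B \<rho>) (f6 B \<rho>) (f7 B \<rho>))"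
proof (rule psp_subst8[where h = "moveN"])
  show "psp (\<lambda>B \<rho>. moveN B (\<rho> 0) (\<rho> 1) (\<rho> 2) (\<rho> 3) (\<rho> 4) (\<rho> 5) (\<rho> 6) (\<rho> 7))"
    unfolding moveN_def by (intro psp_intros) simp_all
qed

lemma psp_runN [psp_intros]:
  assumes "psp f0" "psp f1" "psp f2" "psp f3" "psp f4" "psp f5" "psp f6" "psp f7" "psp f8"
  shows "psp (\<lambda>B \<rho>. fst (runN B (f0 B \<rho>) (f1 B \<rho>) (f2 B \<rho>) (f3 B \<rho>) (f4 B \<rho>) (f5 B \<rho>) (f6 B \<rho>) (f7 B \<rho>) (f8 B \<rho>)))"
    "psp (\<lambda>B \<rho>. snd (runN B (f0 B \<rho>) (f1 B \<rho>) (f2 B \<rho>) (f3 B \<rho>) (f4 B \<rho>) (f5 B \<rho>) (f6 B \<rho>) (f7 B \<rho>) (f8 B \<rho>)))"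
proof -
  have "psp (\<lambda>B \<rho>. fst (runN B (\<rho> 0) (\<rho> 1) (\<rho> 2) (\<rho> 3) (\<rho> 4) (\<rho> 5) (\<rho> 6) (\<rho> 7) (\<rho> 8)))"
    unfolding runN_def by (rule psp_iter2; intro psp_intros)
  then show "psp (\<lambda>B \<rho>. fst (runN B (f0 B \<rho>) (f1 B \<rho>) (f2 B \<rho>) (f3 B \<rho>) (f4 B \<rho>) (f5 B \<rho>) (f6 B \<rho>) (f7 B \<rho>) (f8 B \<rho>)))"
    by (rule psp_subst9[OF _ assms])
  have "psp (\<lambda>B \<rho>. snd (runN B (\<rho> 0) (\<rho> 1) (\<rho> 2) (\<rho> 3) (\<rho> 4) (\<rho> 5) (\<rho> 6) (\<rho> 7) (\<rho> 8)))"
    unfolding runN_def by (rule psp_iter2_snd; intro psp_intros)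
  then show "psp (\<lambda>B \<rho>. snd (runN B (f0 B \<rho>) (f1 B \<rho>) (f2 B \<rho>) (f3 B \<rho>) (f4 B \<rho>) (f5 B \<rho>) (f6 B \<rho>) (f7 B \<rho>) (f8 B \<rho>)))"
    by (rule psp_subst9[OF _ assms])
qed

lemma psp_lassoN [psp_intros]:
  "psp f0 \<Longrightarrow> psp f1 \<Longrightarrow> psp f2 \<Longrightarrow> psp f3 \<Longrightarrow> psp f4 \<Longrightarrow> psp f5 \<Longrightarrow> psp f6 \<Longrightarrow> psp f7 \<Longrightarrow> psp f8 \<Longrightarrow>
   pspP (\<lambda>B \<rho>. lassoN B (f0 B \<rho>) (f1 B \<rho>) (f2 B \<rho>) (f3 B \<rho>) (f4 B \<rho>) (f5 B \<rho>) (f6 B \<rho>) (f7 B \<rho>) (f8 B \<rho>))"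
  unfolding lassoN_def by (intro psp_intros) simp_all

lemma psp_accN [psp_intros]:
  "psp f0 \<Longrightarrow> psp f1 \<Longrightarrow> psp f2 \<Longrightarrow> psp f3 \<Longrightarrow> psp f4 \<Longrightarrow> psp f5 \<Longrightarrow>
   pspP (\<lambda>B \<rho>. accN B (f0 B \<rho>) (f1 B \<rho>) (f2 B \<rho>) (f3 B \<rho>) (f4 B \<rho>) (f5 B \<rho>))"
proof (rule psp_subst6[where h = "\<lambda>B a b c d e f. of_bool (accN B a b c d e f)"])
  show "pspP (\<lambda>B \<rho>. accN B (\<rho> 0) (\<rho> 1) (\<rho> 2) (\<rho> 3) (\<rho> 4) (\<rho> 5))"
    unfolding accN_def by (intro psp_intros) simp_all
qed

lemma psp_wfN [psp_intros]: "psp f \<Longrightarrow> psp g \<Longrightarrow> psp h \<Longrightarrow> pspP (\<lambda>B \<rho>. wfN B (f B \<rho>) (g B \<rho>) (h B \<rho>))"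
  unfolding wfN_def Let_def by (intro psp_intros) simp_all

lemma psp_oexpN [psp_intros]: "psp f \<Longrightarrow> psp g \<Longrightarrow> psp h \<Longrightarrow> pspP (\<lambda>B \<rho>. oexpN B (f B \<rho>) (g B \<rho>) (h B \<rho>))"
proof (rule psp_subst3[where h = "\<lambda>B a b c. of_bool (oexpN B a b c)"])
  show "pspP (\<lambda>B \<rho>. oexpN B (\<rho> 0) (\<rho> (Suc 0)) (\<rho> 2))"
    unfolding oexpN_def by (intro psp_intros) simp_all
qed

lemma psp_valN [psp_intros]: "psp f \<Longrightarrow> psp g \<Longrightarrow> psp h \<Longrightarrow> psp (\<lambda>B \<rho>. valN B (f B \<rho>) (g B \<rho>) (h B \<rho>))"
proof (rule psp_subst3[where h = "valN"])
  show "psp (\<lambda>B \<rho>. valN B (\<rho> 0) (\<rho> (Suc 0)) (\<rho> 2))"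
    unfolding valN_def by (rule psp_iter2_snd; (intro psp_intros)?; simp)
qed

lemma psp_natN [psp_intros]:
  "psp f0 \<Longrightarrow> psp f1 \<Longrightarrow> psp f2 \<Longrightarrow> psp f3 \<Longrightarrow> pspP (\<lambda>B \<rho>. natN B (f0 B \<rho>) (f1 B \<rho>) (f2 B \<rho>) (f3 B \<rho>))"
proof (rule psp_subst4[where h = "\<lambda>B a b c d. of_bool (natN B a b c d)"])
  show "pspP (\<lambda>B \<rho>. natN B (\<rho> 0) (\<rho> 1) (\<rho> 2) (\<rho> 3))"
    unfolding natN_def by (intro psp_intros) simp_all
qed

lemma psp_intN [psp_intros]:
  "psp f0 \<Longrightarrow> psp f1 \<Longrightarrow> psp f2 \<Longrightarrow> psp f3 \<Longrightarrow> psp f4 \<Longrightarrow>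
   pspP (\<lambda>B \<rho>. intN B (f0 B \<rho>) (f1 B \<rho>) (f2 B \<rho>) (f3 B \<rho>) (f4 B \<rho>))"
  unfolding intN_def by (intro psp_intros) simp_all

lemma psp_ratN [psp_intros]:
  "psp f0 \<Longrightarrow> psp f1 \<Longrightarrow> psp f2 \<Longrightarrow> psp f3 \<Longrightarrow> psp f4 \<Longrightarrow> psp f5 \<Longrightarrow>
   pspP (\<lambda>B \<rho>. ratN B (f0 B \<rho>) (f1 B \<rho>) (f2 B \<rho>) (f3 B \<rho>) (f4 B \<rho>) (f5 B \<rho>))"
proof (rule psp_subst6[where h = "\<lambda>B a b c d e f. of_bool (ratN B a b c d e f)"])
  show "pspP (\<lambda>B \<rho>. ratN B (\<rho> 0) (\<rho> 1) (\<rho> 2) (\<rho> 3) (\<rho> 4) (\<rho> 5))"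
    unfolding ratN_def by (intro psp_intros) simp_all
qed

lemma psp_mul4 [psp_intros]:
  "psp f0 \<Longrightarrow> psp f1 \<Longrightarrow> psp f2 \<Longrightarrow> psp f3 \<Longrightarrow> psp (\<lambda>B \<rho>. mul4 B (f0 B \<rho>) (f1 B \<rho>) (f2 B \<rho>) (f3 B \<rho>))"
  unfolding mul4_def by (intro psp_intros)

lemma psp_ctdsN: "psp f \<Longrightarrow> pspP (\<lambda>B \<rho>. ctdsN B (f B \<rho>))"
proof (rule psp_subst1[where h = "\<lambda>B a. of_bool (ctdsN B a)"])
  show "pspP (\<lambda>B \<rho>. ctdsN B (\<rho> 0))"
    unfolding ctdsN_def eqN_def Let_def by (intro psp_intros) simp_all
qed

section \<open>Correctness of the decision procedure\<close>

definition codeN :: "token list \<Rightarrow> nat" where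
  "codeN w = (\<Sum>i<length w. 16 ^ i * tok_code (w ! i))"

lemma codeN_Cons: "codeN (t # w) = tok_code t + 16 * codeN w"
  unfolding codeN_def
  by (simp add: sum.lessThan_Suc_shift sum_distrib_left mult.assoc del: sum.lessThan_Suc)

lemma tokN_codeN: "tokN (codeN w) i = tok_at w i"
proof (induction w arbitrary: i)
  case Nil then show ?case by (simp add: tokN_def tok_at_def codeN_def)
next
  case (Cons t w)
  have t: "tok_code t < 16" by (rule tok_code_bounds)
  show ?case
  proof (cases i)
    case 0 then show ?thesis using t by (simp add: tokN_def tok_at_def codeN_Cons)
  next
    case (Suc j)
    have "codeN (t # w) div 16 ^ i = codeN (t # w) div 16 div 16 ^ j" by (simp add: Suc div_mult2_eq)
    also have "codeN (t # w) div 16 = codeN w" using t by (simp add: codeN_Cons)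
    finally show ?thesis using Cons[of j] Suc by (simp add: tokN_def tok_at_def)
  qed
qed

lemma codeN_less: "codeN w < 16 ^ length w"
proof (induction w)
  case (Cons t w)
  then show ?case using tok_code_bounds(2)[of t] by (simp add: codeN_Cons)
qed (simp add: codeN_def)

lemma bit_setN:
  assumes "2 ^ m \<le> B"
  shows "bit (setN B m P) q \<longleftrightarrow> q < m \<and> P q"
proof -
  let ?xs = "map P [0..<m]"
  have eq: "(\<Sum>q<m. 2 ^ q * of_bool (P q)) = (horner_sum of_bool 2 ?xs :: nat)"
    by (simp add: horner_sum_eq_sum mult.commute lessThan_atLeast0)
  have "take_bit m (horner_sum of_bool 2 ?xs :: nat) = horner_sum of_bool 2 ?xs"
    by (rule bit_eqI) (auto simp: bit_take_bit_iff bit_horner_sum_bit_iff)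
  then have "horner_sum of_bool 2 ?xs < (2::nat) ^ m" by (simp only: take_bit_nat_eq_self_iff)
  then have "setN B m P = horner_sum of_bool 2 ?xs" unfolding setN_def eq using assms by simp
  then show ?thesis by (auto simp: bit_horner_sum_bit_iff)
qed

lemma setN_less: assumes "2 ^ m \<le> B" shows "setN B m P < 2 ^ m"
proof -
  have "take_bit m (setN B m P) = setN B m P"
    by (rule bit_eqI) (auto simp: bit_take_bit_iff bit_setN[OF assms])
  then show ?thesis by (simp only: take_bit_nat_eq_self_iff)
qed

section \<open>Locating the operands of an operator\<close>

definition end_step :: "nat \<Rightarrow> nat \<Rightarrow> nat \<times> nat \<Rightarrow> nat \<times> nat" where
  "end_step B X = (\<lambda>(j, c). (if c = 0 then j else (j + 1) mod B, if c = 0 then c else (c - 1 + arity (tokN X j)) mod B))"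

lemma end_step_Suc:
  "drop i w = t # v \<Longrightarrow> i + 1 < B \<Longrightarrow> c + 2 < B \<Longrightarrow> end_step B (codeN w) (i, Suc c) = (i + 1, c + arity (tok_code t))"
  using drop_ConsD[of i w t v] by (auto simp: end_step_def tokN_codeN tok_at_def arity_def)

text \<open>Reading one complete expression settles exactly one pending operand, however many others
  wait; \<open>c\<close> counts these and grows for the first operand of a binary operator. The size
  hypotheses keep position and counter from wrapping around.\<close>

lemma end_step_rexp:
  "drop i w = rexp_enc r @ v \<Longrightarrow> length w + 1 < B \<Longrightarrow> c + length (rexp_enc r) + 1 < B \<Longrightarrow>
   (end_step B (codeN w) ^^ length (rexp_enc r)) (i, Suc c) = (i + length (rexp_enc r), c)"
proof (induction r arbitrary: i v c)
  case (RPlus r s)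
  have d: "drop i w = TPlus # rexp_enc r @ rexp_enc s @ v" using RPlus.prems by simp
  have d1: "drop (i + 1) w = rexp_enc r @ rexp_enc s @ v" using drop_ConsD(3)[OF d] by simp
  have d2: "drop (i + 1 + length (rexp_enc r)) w = rexp_enc s @ v" using drop_appendD[OF d1] by simp
  have "end_step B (codeN w) (i, Suc c) = (i + 1, Suc (Suc c))"
    using end_step_Suc[OF d, of B c] drop_ConsD(1)[OF d] RPlus.prems rexp_enc_len[of r] by (simp add: arity_def)
  moreover have "length (rexp_enc (RPlus r s)) = length (rexp_enc s) + (length (rexp_enc r) + 1)" by simp
  ultimately show ?case
    using RPlus.IH(1)[OF d1, of "Suc c"] RPlus.IH(2)[OF d2, of c] RPlus.prems
    by (simp only: funpow_add comp_apply) simp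
next
  case (RTimes r s)
  have d: "drop i w = TTimes # rexp_enc r @ rexp_enc s @ v" using RTimes.prems by simp
  have d1: "drop (i + 1) w = rexp_enc r @ rexp_enc s @ v" using drop_ConsD(3)[OF d] by simp
  have d2: "drop (i + 1 + length (rexp_enc r)) w = rexp_enc s @ v" using drop_appendD[OF d1] by simp
  have "end_step B (codeN w) (i, Suc c) = (i + 1, Suc (Suc c))"
    using end_step_Suc[OF d, of B c] drop_ConsD(1)[OF d] RTimes.prems rexp_enc_len[of r] by (simp add: arity_def)
  moreover have "length (rexp_enc (RTimes r s)) = length (rexp_enc s) + (length (rexp_enc r) + 1)" by simp
  ultimately show ?case
    using RTimes.IH(1)[OF d1, of "Suc c"] RTimes.IH(2)[OF d2, of c] RTimes.prems
    by (simp only: funpow_add comp_apply) simp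
next
  case (RStar r)
  have d: "drop i w = TStar # rexp_enc r @ v" using RStar.prems by simp
  have d1: "drop (i + 1) w = rexp_enc r @ v" using drop_ConsD(3)[OF d] by simp
  have "end_step B (codeN w) (i, Suc c) = (i + 1, Suc c)"
    using end_step_Suc[OF d, of B c] drop_ConsD(1)[OF d] RStar.prems rexp_enc_len[of r] by (simp add: arity_def)
  moreover have "length (rexp_enc (RStar r)) = length (rexp_enc r) + 1" by simp
  ultimately show ?case
    using RStar.IH[OF d1, of c] RStar.prems by (simp only: funpow_add comp_apply) simp
next
  case (RSym x)
  then have d: "drop i w = (case x of La \<Rightarrow> TA | Lb \<Rightarrow> TB) # v" by (cases x) auto
  then show ?case using end_step_Suc[OF d, of B c] drop_ConsD(1)[OF d] RSym.prems by (cases x) (simp_all add: arity_def)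
next
  case REmpty
  then have d: "drop i w = TEmpty # v" by simp
  then show ?case using end_step_Suc[OF d, of B c] drop_ConsD(1)[OF d] REmpty.prems by (simp add: arity_def)
next
  case REps
  then have d: "drop i w = TEps # v" by simp
  then show ?case using end_step_Suc[OF d, of B c] drop_ConsD(1)[OF d] REps.prems by (simp add: arity_def)
qed

lemma end_step_oexp:
  "drop i w = oexp_enc e @ v \<Longrightarrow> length w + 1 < B \<Longrightarrow> c + length (oexp_enc e) + 1 < B \<Longrightarrow>
   (end_step B (codeN w) ^^ length (oexp_enc e)) (i, Suc c) = (i + length (oexp_enc e), c)"
proof (induction e arbitrary: i v c)
  case (Omega r)
  have d: "drop i w = TOmega # rexp_enc r @ v" using Omega.prems by simp
  have d1: "drop (i + 1) w = rexp_enc r @ v" using drop_ConsD(3)[OF d] by simp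
  have "end_step B (codeN w) (i, Suc c) = (i + 1, Suc c)"
    using end_step_Suc[OF d, of B c] drop_ConsD(1)[OF d] Omega.prems rexp_enc_len[of r] by (simp add: arity_def)
  moreover have "length (oexp_enc (Omega r)) = length (rexp_enc r) + 1" by simp
  ultimately show ?case
    using end_step_rexp[OF d1, of B c] Omega.prems by (simp only: funpow_add comp_apply) simp
next
  case (OConc r e)
  have d: "drop i w = TConc # rexp_enc r @ oexp_enc e @ v" using OConc.prems by simp
  have d1: "drop (i + 1) w = rexp_enc r @ oexp_enc e @ v" using drop_ConsD(3)[OF d] by simp
  have d2: "drop (i + 1 + length (rexp_enc r)) w = oexp_enc e @ v" using drop_appendD[OF d1] by simp
  have "end_step B (codeN w) (i, Suc c) = (i + 1, Suc (Suc c))"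
    using end_step_Suc[OF d, of B c] drop_ConsD(1)[OF d] OConc.prems rexp_enc_len[of r] by (simp add: arity_def)
  moreover have "length (oexp_enc (OConc r e)) = length (oexp_enc e) + (length (rexp_enc r) + 1)" by simp
  ultimately show ?case
    using end_step_rexp[OF d1, of B "Suc c"] OConc.IH[OF d2, of c] OConc.prems
    by (simp only: funpow_add comp_apply) simp
next
  case (OPlus e f)
  have d: "drop i w = TOPlus # oexp_enc e @ oexp_enc f @ v" using OPlus.prems by simp
  have d1: "drop (i + 1) w = oexp_enc e @ oexp_enc f @ v" using drop_ConsD(3)[OF d] by simp
  have d2: "drop (i + 1 + length (oexp_enc e)) w = oexp_enc f @ v" using drop_appendD[OF d1] by simp
  have "end_step B (codeN w) (i, Suc c) = (i + 1, Suc (Suc c))"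
    using end_step_Suc[OF d, of B c] drop_ConsD(1)[OF d] OPlus.prems oexp_enc_len[of e] by (simp add: arity_def)
  moreover have "length (oexp_enc (OPlus e f)) = length (oexp_enc f) + (length (oexp_enc e) + 1)" by simp
  ultimately show ?case
    using OPlus.IH(1)[OF d1, of "Suc c"] OPlus.IH(2)[OF d2, of c] OPlus.prems
    by (simp only: funpow_add comp_apply) simp
qed

text \<open>With no operand pending the scan stands still, so it may be run for \<open>L\<close>
  steps regardless of when it finishes.\<close>

lemma endN_eq:
  assumes "(end_step B X ^^ m) (i, 1) = (j, 0)" "m \<le> L"
  shows "endN B X L i = j"
proof -
  have "(end_step B X ^^ d) (j, 0) = (j, 0)" for d by (induction d) (auto simp: end_step_def)
  then have "(end_step B X ^^ (L - m + m)) (i, 1) = (j, 0)" unfolding funpow_add comp_apply assms(1) .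
  then show ?thesis using assms(2) by (simp add: endN_def end_step_def)
qed

lemma nfa_endN: "length w + 2 < B \<Longrightarrow> nfa w (endN B (codeN w) (length w))"
proof
  fix i r v assume B: "length w + 2 < B" and d: "drop i w = rexp_enc r @ v"
  have "length (rexp_enc r) \<le> length w" using arg_cong[OF d, of length] by simp
  then show "endN B (codeN w) (length w) i = i + length (rexp_enc r)"
  proof (intro endN_eq)
    show "(end_step B (codeN w) ^^ length (rexp_enc r)) (i, 1) = (i + length (rexp_enc r), 0)"
      using end_step_rexp[OF d, of B 0] B \<open>length (rexp_enc r) \<le> length w\<close> by simp
  qed
next
  fix i e v assume B: "length w + 2 < B" and d: "drop i w = oexp_enc e @ v"
  have "length (oexp_enc e) \<le> length w" using arg_cong[OF d, of length] by simp
  then show "endN B (codeN w) (length w) i = i + length (oexp_enc e)"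
  proof (intro endN_eq)
    show "(end_step B (codeN w) ^^ length (oexp_enc e)) (i, 1) = (i + length (oexp_enc e), 0)"
      using end_step_oexp[OF d, of B 0] B \<open>length (oexp_enc e) \<le> length w\<close> by simp
  qed
qed

section \<open>Residual arithmetic without overflow\<close>

lemma okN_eq:
  assumes "R * (n - 1) \<le> n * Q" "n * Q < B"
  shows "okN B n Q (letter_code x) R = ok n Q x R"
proof -
  have "(R - Q) * (n - 1) \<le> R * (n - 1)" by (intro mult_le_mono1) simp
  then have "(R - Q) * (n - 1) < B" "R * (n - 1) < B" using assms by linarith+
  then show ?thesis by (cases x) (simp_all add: okN_def)
qed

text \<open>The maximal residual \<open>Q * n / (n - 1)\<close> is largest for
  \<open>n = 2\<close>.\<close>

lemma residual_le:
  fixes n R Q :: nat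
  assumes "2 \<le> n" "R * (n - 1) \<le> n * Q" shows "R \<le> 2 * Q"
proof -
  have "n * Q \<le> (2 * (n - 1)) * Q" using assms(1) by (intro mult_le_mono1) simp
  then have "R * (n - 1) \<le> (2 * Q) * (n - 1)" using order_trans[OF assms(2)] by (simp only: mult_ac)
  then show ?thesis using assms(1) by (simp only: mult_le_cancel2)
qed

lemma nxN_eq:
  assumes "2 \<le> n" "R * (n - 1) \<le> n * Q" "2 * n * Q < B"
  shows "nxN B n Q (letter_code x) R = nx n Q x R"
proof -
  have "n * R \<le> n * (2 * Q)" using residual_le[OF assms(1,2)] by (intro mult_le_mono2)
  also have "n * (2 * Q) = 2 * n * Q" by simp
  finally have 1: "n * R < B" using assms(3) by (rule le_less_trans)
  have "n * (R - Q) \<le> n * R" by (intro mult_le_mono2) simp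
  then have "n * (R - Q) < B" using 1 by linarith
  then show ?thesis using 1 by (cases x) (auto simp: nxN_def)
qed

lemma rstepN_eq:
  assumes "2 \<le> n" "R * (n - 1) \<le> n * Q" "2 * n * Q < B"
  shows "rstepN B n Q (letter_code m) R = rstep n Q m R"
    and "allowedN B n Q (letter_code m) R (letter_code x) = allowed n Q m R x"
proof -
  have "3 - letter_code m = letter_code (other m)" by (cases m) auto
  moreover have "n * Q < B" using assms(3) by linarith
  ultimately show r: "rstepN B n Q (letter_code m) R = rstep n Q m R"
    using okN_eq[OF assms(2)] nxN_eq[OF assms] by (simp add: rstepN_def rstep_def)
  show "allowedN B n Q (letter_code m) R (letter_code x) = allowed n Q m R x"
    using okN_eq[OF assms(2) \<open>n * Q < B\<close>] nxN_eq[OF assms] r by (simp add: allowedN_def allowed_def)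
qed

definition bits :: "nat \<Rightarrow> nat set" where
  "bits S = {q. bit S q}"

text \<open>Besides holding positions, \<open>B\<close> must exceed the square of the number
  \<open>2 * L\<close> of nodes, which bounds the silent edges and so the rounds of the closure, and
  registers must offer one bit per node.\<close>

locale sized = 
  fixes w :: "token list" and k B L :: nat
  assumes L: "L = length w" and BL: "L + 2 < B" "(2 * L) * (2 * L) < B" "2 ^ (2 * L) \<le> B"
begin

abbreviation "X \<equiv> codeN w"

sublocale nfa w k "endN B X L"
  using nfa_endN[of w B] BL L by simp

lemma L2B: "2 * L < B"
  using less_exp[of "2 * L"] BL(3) by (rule less_le_trans)

lemma L2: "(2 * L) mod B = 2 * L"
  using L2B by simp

lemma edgeN_eq: "p < 2 * L \<Longrightarrow> q < 2 * L \<Longrightarrow> edgeN B X L k p x q = edge p x q"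
proof -
  assume "p < 2 * L" "q < 2 * L"
  moreover have "(i + 1) mod B = i + 1" if "i < L" for i using that BL(1) by simp
  ultimately show ?thesis unfolding edgeN_def edge_def tokN_codeN L[symmetric] by auto
qed

lemma edge_less: "edge p x q \<Longrightarrow> p < 2 * L \<and> q < 2 * L" unfolding edge_def using L by simp

definition E0 :: "(nat \<times> nat) set" where
  "E0 = {(p, q). edge p 0 q}"

lemma path_Nil_iff: "path p [] q \<longleftrightarrow> (p, q) \<in> E0\<^sup>*"
proof
  show "(p, q) \<in> E0\<^sup>*" if "path p [] q"
    using that by (induction p "[] :: letter list" q rule: path.induct) (auto simp: E0_def intro: converse_rtrancl_into_rtrancl)
  show "path p [] q" if "(p, q) \<in> E0\<^sup>*"
    using that by (induction rule: converse_rtrancl_induct) (auto simp: E0_def intro: path.intros)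
qed

lemma bits_setN: "bits (setN B (2 * L) P) = {q. q < 2 * L \<and> P q}"
  using bit_setN[OF BL(3)] by (simp add: bits_def)

lemma bits_epsN: "bits S \<subseteq> {..<2 * L} \<Longrightarrow> bits (epsN B X L k S) = bits S \<union> E0 `` bits S"
  unfolding epsN_def L2 bits_setN using edgeN_eq edge_less by (fastforce simp: bits_def E0_def)

lemma bits_epsN_iter:
  assumes "bits S \<subseteq> {..<2 * L}"
  shows "bits ((epsN B X L k ^^ m) S) = (\<Union>j\<le>m. (E0 ^^ j)) `` bits S \<and> bits ((epsN B X L k ^^ m) S) \<subseteq> {..<2 * L}"
proof (induction m)
  case 0 then show ?case using assms by auto
next
  case (Suc m)
  have "bits ((epsN B X L k ^^ Suc m) S) = bits ((epsN B X L k ^^ m) S) \<union> E0 `` bits ((epsN B X L k ^^ m) S)"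
    unfolding funpow.simps comp_apply by (rule bits_epsN[OF conjunct2[OF Suc]])
  moreover have "\<dots> = (\<Union>j\<le>Suc m. (E0 ^^ j)) `` bits S"
  proof (intro equalityI subsetI)
    fix x assume "x \<in> bits ((epsN B X L k ^^ m) S) \<union> E0 `` bits ((epsN B X L k ^^ m) S)"
    then consider p j where "p \<in> bits S" "j \<le> m" "(p, x) \<in> E0 ^^ j"
      | p j y where "p \<in> bits S" "j \<le> m" "(p, y) \<in> E0 ^^ j" "(y, x) \<in> E0" using Suc by auto
    then show "x \<in> (\<Union>j\<le>Suc m. (E0 ^^ j)) `` bits S"
    proof cases
      case 1
      then have "j \<le> Suc m" by simp
      then show ?thesis using 1 by blast
    next
      case 2
      then have "(p, x) \<in> E0 ^^ Suc j" "Suc j \<le> Suc m" by auto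
      then show ?thesis using 2(1) by blast
    qed
  next
    fix x assume "x \<in> (\<Union>j\<le>Suc m. (E0 ^^ j)) `` bits S"
    then obtain p j where p: "p \<in> bits S" "j \<le> Suc m" "(p, x) \<in> E0 ^^ j" by blast
    have IH: "bits ((epsN B X L k ^^ m) S) = (\<Union>j\<le>m. (E0 ^^ j)) `` bits S" using Suc by blast
    show "x \<in> bits ((epsN B X L k ^^ m) S) \<union> E0 `` bits ((epsN B X L k ^^ m) S)"
    proof (cases j)
      case 0
      then show ?thesis using p unfolding IH by blast
    next
      case (Suc i)
      then obtain y where "(p, y) \<in> E0 ^^ i" "(y, x) \<in> E0" using p(3) by auto
      moreover have "i \<le> m" using p(2) Suc by simp
      ultimately show ?thesis using p(1) unfolding IH by blast
    qed
  qed
  moreover have "E0 `` A \<subseteq> {..<2 * L}" for A using edge_less by (auto simp: E0_def)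
  ultimately show ?case using Suc by (metis Un_least)
qed

lemma bits_cloN:
  assumes "bits S \<subseteq> {..<2 * L}"
  shows "bits (cloN B X L k S) = eclo (bits S)"
proof -
  have sub: "E0 \<subseteq> {..<2 * L} \<times> {..<2 * L}" using edge_less by (auto simp: E0_def)
  have fin: "finite E0" using finite_subset[OF sub] by simp
  have "card E0 \<le> (2 * L) * (2 * L)" using card_mono[OF _ sub] by (simp add: card_cartesian_product)
  then have "card E0 \<le> B - 1" using BL(2) by linarith
  then have "E0\<^sup>* = (\<Union>j\<le>B - 1. (E0 ^^ j))"
  proof (intro equalityI subsetI)
    fix x assume "x \<in> E0\<^sup>*"
    then obtain j where "j \<le> card E0" "x \<in> E0 ^^ j" unfolding rtrancl_finite_eq_relpow[OF fin] by blast
    moreover from this have "j \<le> B - 1" using \<open>card E0 \<le> B - 1\<close> by linarith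
    ultimately show "x \<in> (\<Union>j\<le>B - 1. (E0 ^^ j))" by blast
  next
    fix x assume "x \<in> (\<Union>j\<le>B - 1. (E0 ^^ j))"
    then show "x \<in> E0\<^sup>*" using relpow_imp_rtrancl by (cases x) blast
  qed
  then show ?thesis
    unfolding cloN_def eclo_def path_Nil_iff using conjunct1[OF bits_epsN_iter[OF assms, of "B - 1"]] by blast
qed

lemma epsN_less: "epsN B X L k S < 2 ^ (2 * L)"
  unfolding epsN_def L2 using setN_less[OF BL(3)] .

lemma cloN_less: "cloN B X L k S < 2 ^ (2 * L)"
proof -
  obtain m where m: "B - 1 = Suc m" using BL(1) by (cases "B - 1") auto
  show ?thesis unfolding cloN_def m by (simp add: epsN_less)
qed

lemma bits_nodeN: "t < L \<Longrightarrow> bits (nodeN B X L k t) = eclo {2 * t}"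
proof -
  assume t: "t < L"
  then have "(2 * t) mod B = 2 * t" using L2B by simp
  then have "bits (setN B (2 * L) (\<lambda>q. q = (2 * t) mod B)) = {2 * t}" using t by (auto simp: bits_setN)
  then show ?thesis unfolding nodeN_def L2 using bits_cloN t by simp
qed

lemma bits_moveN:
  assumes "2 \<le> n" "R * (n - 1) \<le> n * Q" "2 * n * Q < B" "bits S \<subseteq> {..<2 * L}"
  shows "(rstepN B n Q (letter_code m) R, bits (moveN B X L k n Q (letter_code m) R S)) = pstep n Q m (R, bits S)"
proof -
  note a = rstepN_eq[OF assms(1-3)]
  have "{q. q < 2 * L \<and> (\<exists>p<2 * L. bit S p \<and> (allowedN B n Q (letter_code m) R 1 \<and> edgeN B X L k p 1 q \<or>
       allowedN B n Q (letter_code m) R 2 \<and> edgeN B X L k p 2 q))} =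
      {q. \<exists>x p. allowed n Q m R x \<and> p \<in> bits S \<and> edge p (letter_code x) q}" (is "?A = ?B")
  proof
    show "?A \<subseteq> ?B"
    proof
      fix q assume "q \<in> ?A"
      then obtain p where "p < 2 * L" "q < 2 * L" "bit S p" "allowedN B n Q (letter_code m) R 1 \<and> edgeN B X L k p 1 q \<or>
       allowedN B n Q (letter_code m) R 2 \<and> edgeN B X L k p 2 q" by blast
      then have "allowed n Q m R La \<and> edge p (letter_code La) q \<or> allowed n Q m R Lb \<and> edge p (letter_code Lb) q"
        using a(2)[of m La] a(2)[of m Lb] edgeN_eq by auto
      then show "q \<in> ?B" using \<open>bit S p\<close> unfolding bits_def by blast
    qed
    show "?B \<subseteq> ?A"
    proof
      fix q assume "q \<in> ?B"
      then obtain x p where "allowed n Q m R x" "bit S p" "edge p (letter_code x) q" by (auto simp: bits_def)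
      then show "q \<in> ?A" using a(2)[of m x] edge_less[of p "letter_code x" q] edgeN_eq[of p q "letter_code x"]
        by (cases x) auto
    qed
  qed
  then have "bits (moveN B X L k n Q (letter_code m) R S) = eclo {q. \<exists>x p. allowed n Q m R x \<and> p \<in> bits S \<and> edge p (letter_code x) q}"
    unfolding moveN_def L2 by (subst bits_cloN) (auto simp: bits_setN)
  then show ?thesis using a(1)[of m] by (simp add: pstep_def)
qed

lemma runN_eq:
  assumes n: "2 \<le> n" and R: "R * (n - 1) \<le> n * Q" and Q: "2 * n * Q < B" and S: "bits S \<subseteq> {..<2 * L}" "S < 2 ^ (2 * L)"
  shows "fst (runN B X L k n Q (letter_code m) i R S) = fst ((pstep n Q m ^^ i) (R, bits S))" (is ?a)
    and "bits (snd (runN B X L k n Q (letter_code m) i R S)) = snd ((pstep n Q m ^^ i) (R, bits S))" (is ?b)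
    and "runN B X L k n Q (letter_code m) i R S \<in> {..2 * Q} \<times> {..<2 ^ (2 * L)}" (is ?c)
proof -
  have "?a \<and> ?b \<and> fst (runN B X L k n Q (letter_code m) i R S) * (n - 1) \<le> n * Q \<and>
    bits (snd (runN B X L k n Q (letter_code m) i R S)) \<subseteq> {..<2 * L} \<and> snd (runN B X L k n Q (letter_code m) i R S) < 2 ^ (2 * L)"
  proof (induction i)
    case 0 then show ?case using R S by (simp add: runN_def)
  next
    case (Suc i)
    obtain R1 S1 where r: "runN B X L k n Q (letter_code m) i R S = (R1, S1)" by fastforce
    have p: "(pstep n Q m ^^ i) (R, bits S) = (R1, bits S1)" using Suc r by (simp add: prod_eq_iff)
    have R1: "R1 * (n - 1) \<le> n * Q" and S1: "bits S1 \<subseteq> {..<2 * L}" using Suc r by auto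
    have eq: "runN B X L k n Q (letter_code m) (Suc i) R S
        = (rstepN B n Q (letter_code m) R1, moveN B X L k n Q (letter_code m) R1 S1)"
      using r by (simp add: runN_def)
    have pe: "(pstep n Q m ^^ Suc i) (R, bits S) =
        (rstepN B n Q (letter_code m) R1, bits (moveN B X L k n Q (letter_code m) R1 S1))"
      using p bits_moveN[OF n R1 Q S1, of m] by simp
    have lt: "moveN B X L k n Q (letter_code m) R1 S1 < 2 ^ (2 * L)" unfolding moveN_def by (rule cloN_less)
    moreover have "bits S' \<subseteq> {..<2 * L}" if "S' < 2 ^ (2 * L)" for S'
    proof
      fix q assume "q \<in> bits S'"
      moreover have "take_bit (2 * L) S' = S'" using that by (simp only: take_bit_nat_eq_self_iff)
      ultimately show "q \<in> {..<2 * L}" using bit_take_bit_iff[of "2 * L" S' q] by (simp add: bits_def)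
    qed
    moreover have "rstepN B n Q (letter_code m) R1 * (n - 1) \<le> n * Q"
      using rstepN_eq(1)[OF n R1 Q] rstep_bound[OF _ R1] n by simp
    ultimately show ?case unfolding eq pe by simp
  qed
  then show ?a ?b ?c using residual_le[OF n] by (auto simp: mem_Times_iff)
qed

text \<open>The indices in \<open>lasso_iff\<close> are unbounded, but each can be replaced by one
  below \<open>B - 1\<close> that yields the same pair of residual and node set, because
  \<open>big\<close> bounds the number of such pairs.\<close>

lemma accN_iff:
  assumes e: "drop k w = oexp_enc e" and n: "2 \<le> n" and P: "P * (n - 1) \<le> n * Q" and Q: "2 * n * Q < B"
    and big: "(2 * Q + 1) * 2 ^ (2 * L) < B"
  shows "accN B X L k n Q P \<longleftrightarrow> (\<exists>x. x \<in> olang e \<and> valid_seq n Q P x)"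
proof -
  have kL: "k < L" using drop_appendD_less[of k w "oexp_enc e" "[]"] oexp_enc_len[of e] e L by simp
  have node: "bits (nodeN B X L k t) = eclo {2 * t}" "bits (nodeN B X L k t) \<subseteq> {..<2 * L}" "nodeN B X L k t < 2 ^ (2 * L)"
    if "t < L" for t
  proof -
    show lt: "nodeN B X L k t < 2 ^ (2 * L)" unfolding nodeN_def by (rule cloN_less)
    show "bits (nodeN B X L k t) = eclo {2 * t}" using bits_nodeN[OF that] .
    have "take_bit (2 * L) (nodeN B X L k t) = nodeN B X L k t" using lt by (simp only: take_bit_nat_eq_self_iff)
    then show "bits (nodeN B X L k t) \<subseteq> {..<2 * L}" using bit_take_bit_iff[of "2 * L" "nodeN B X L k t"] by (auto simp: bits_def)
  qed
  have t2: "(2 * t) mod B = 2 * t" if "t < L" for t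
    using that L2B by simp
  let ?run = "\<lambda>m i R t. runN B X L k n Q (letter_code m) i R (nodeN B X L k t)"
  let ?r = "\<lambda>m i. (rstep n Q m ^^ i) P"
  have run: "fst (?run m i R t) = (rstep n Q m ^^ i) R" "bit (snd (?run m i R t)) q \<longleftrightarrow> q \<in> snd ((pstep n Q m ^^ i) (R, eclo {2 * t}))"
    if "R * (n - 1) \<le> n * Q" "t < L" for m i R t q
  proof -
    note r = runN_eq[OF n that(1) Q node(2,3)[OF that(2)], of m i, unfolded node(1)[OF that(2)]]
    show "fst (?run m i R t) = (rstep n Q m ^^ i) R" using r(1) by (simp only: fst_pstep)
    show "bit (snd (?run m i R t)) q \<longleftrightarrow> q \<in> snd ((pstep n Q m ^^ i) (R, eclo {2 * t}))"
      unfolding r(2)[symmetric] by (simp add: bits_def)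
  qed
  have bound: "\<exists>i'<B - 1. ?run m i' R t = ?run m i R t" and bound1: "\<exists>l'<B - 1. ?run m (Suc l') R t = ?run m (Suc i) R t"
    if "R * (n - 1) \<le> n * Q" "t < L" for m i R t
  proof -
    define f where "f = (\<lambda>(R, S). (rstepN B n Q (letter_code m) R, moveN B X L k n Q (letter_code m) R S))"
    define y where "y = (R, nodeN B X L k t)"
    have rf: "?run m i R t = (f ^^ i) y" for i by (simp add: runN_def f_def y_def)
    let ?A = "{..2 * Q} \<times> {..<2 ^ (2 * L) :: nat}"
    have A: "(f ^^ i) y \<in> ?A" for i using runN_eq(3)[OF n that(1) Q node(2,3)[OF that(2)], of m i] rf by simp
    have card: "card ?A \<le> B - 1" using big by (simp add: card_cartesian_product)
    show "\<exists>i'<B - 1. ?run m i' R t = ?run m i R t"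
      using orbit_bounded[OF _ A, of i] card unfolding rf by (auto intro: less_le_trans)
    \<comment> \<open>A loop has at least one step, so its orbit is taken to start after the first
      step.\<close>
    have sw: "(f ^^ Suc j) y = (f ^^ j) (f y)" for j by (simp only: funpow_Suc_right comp_apply)
    then have "(f ^^ j) (f y) \<in> ?A" for j using A[of "Suc j"] by simp
    then show "\<exists>l'<B - 1. ?run m (Suc l') R t = ?run m (Suc i) R t"
      using orbit_bounded[of ?A f "f y" i] card unfolding rf sw by (auto intro: less_le_trans)
  qed
  have rb: "?r m i * (n - 1) \<le> n * Q" for m i
    using n P by (induction i) (simp_all add: rstep_bound[simplified])
  have m3: "(\<exists>m<3. 0 < m \<and> F m) \<longleftrightarrow> (\<exists>m. F (letter_code m))" for F
  proof
    assume "\<exists>m<3. 0 < m \<and> F m"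
    then obtain m where "m < 3" "0 < m" "F m" by blast
    then have "m = 1 \<or> m = 2" by linarith
    then show "\<exists>m. F (letter_code m)" using \<open>F m\<close> by (metis letter_code.simps)
  next
    assume "\<exists>m. F (letter_code m)"
    then obtain m where "F (letter_code m)" by blast
    then show "\<exists>m<3. 0 < m \<and> F m" by (cases m) (auto intro!: exI[of _ "letter_code m"])
  qed
  have lasso: "lassoN B X L k n Q (letter_code m) t R l \<longleftrightarrow> fst (?run m (Suc l) R t) = R \<and> bit (snd (?run m (Suc l) R t)) (2 * t)"
    if "t < L" "l < B - 1" for m t R l
    using that t2 by (simp add: lassoN_def)
  have "accN B X L k n Q P \<longleftrightarrow> (\<exists>m. \<exists>i<B - 1. \<exists>t<L. k \<le> t \<and> tok_at w t = 13 \<and> bit (snd (?run m i P k)) (2 * t) \<and>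
      (\<exists>l<B - 1. fst (?run m (Suc l) (fst (?run m i P k)) t) = fst (?run m i P k) \<and> bit (snd (?run m (Suc l) (fst (?run m i P k)) t)) (2 * t)))"
    unfolding accN_def m3 tokN_codeN using lasso t2 by (metis (no_types, lifting))
  also have "\<dots> \<longleftrightarrow> (\<exists>m. \<exists>i. \<exists>t<L. k \<le> t \<and> tok_at w t = 13 \<and> bit (snd (?run m i P k)) (2 * t) \<and>
      (\<exists>l. fst (?run m (Suc l) (fst (?run m i P k)) t) = fst (?run m i P k) \<and> bit (snd (?run m (Suc l) (fst (?run m i P k)) t)) (2 * t)))"
  proof (rule ex_cong1, rule iffI)
    fix m
    assume "\<exists>i. \<exists>t<L. k \<le> t \<and> tok_at w t = 13 \<and> bit (snd (?run m i P k)) (2 * t) \<and>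
      (\<exists>l. fst (?run m (Suc l) (fst (?run m i P k)) t) = fst (?run m i P k) \<and> bit (snd (?run m (Suc l) (fst (?run m i P k)) t)) (2 * t))"
    then obtain i t l where h: "t < L" "k \<le> t" "tok_at w t = 13" "bit (snd (?run m i P k)) (2 * t)"
      "fst (?run m (Suc l) (fst (?run m i P k)) t) = fst (?run m i P k)" "bit (snd (?run m (Suc l) (fst (?run m i P k)) t)) (2 * t)" by blast
    obtain i' where i': "i' < B - 1" "?run m i' P k = ?run m i P k" using bound[OF P kL] by blast
    have "fst (?run m i P k) * (n - 1) \<le> n * Q" using run(1)[OF P kL] rb by simp
    then obtain l' where l': "l' < B - 1" "?run m (Suc l') (fst (?run m i P k)) t = ?run m (Suc l) (fst (?run m i P k)) t"
      using bound1[OF _ h(1)] by blast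
    show "\<exists>i<B - 1. \<exists>t<L. k \<le> t \<and> tok_at w t = 13 \<and> bit (snd (?run m i P k)) (2 * t) \<and>
      (\<exists>l<B - 1. fst (?run m (Suc l) (fst (?run m i P k)) t) = fst (?run m i P k) \<and> bit (snd (?run m (Suc l) (fst (?run m i P k)) t)) (2 * t))"
      using h i' l' by (intro exI[of _ i'] conjI exI[of _ t] exI[of _ l']) simp_all
  qed blast
  also have "\<dots> \<longleftrightarrow> (\<exists>m. \<exists>t<length w. k \<le> t \<and> tok_at w t = 13 \<and> (\<exists>i l. 2 * t \<in> snd ((pstep n Q m ^^ i) (P, eclo {2 * k})) \<and>
       (rstep n Q m ^^ Suc l) (?r m i) = ?r m i \<and> 2 * t \<in> snd ((pstep n Q m ^^ Suc l) (?r m i, eclo {2 * t}))))"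
  proof (rule ex_cong1)
    fix m
    have "(\<exists>l. fst (?run m (Suc l) (?r m i) t) = ?r m i \<and> bit (snd (?run m (Suc l) (?r m i) t)) (2 * t)) \<longleftrightarrow>
       (\<exists>l. (rstep n Q m ^^ Suc l) (?r m i) = ?r m i \<and> 2 * t \<in> snd ((pstep n Q m ^^ Suc l) (?r m i, eclo {2 * t})))"
      if "t < L" for i t unfolding run[OF rb that] ..
    then show "(\<exists>i. \<exists>t<L. k \<le> t \<and> tok_at w t = 13 \<and> bit (snd (?run m i P k)) (2 * t) \<and>
      (\<exists>l. fst (?run m (Suc l) (fst (?run m i P k)) t) = fst (?run m i P k) \<and> bit (snd (?run m (Suc l) (fst (?run m i P k)) t)) (2 * t))) \<longleftrightarrow>
      (\<exists>t<length w. k \<le> t \<and> tok_at w t = 13 \<and> (\<exists>i l. 2 * t \<in> snd ((pstep n Q m ^^ i) (P, eclo {2 * k})) \<and>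
       (rstep n Q m ^^ Suc l) (?r m i) = ?r m i \<and> 2 * t \<in> snd ((pstep n Q m ^^ Suc l) (?r m i, eclo {2 * t}))))"
      unfolding run(1)[OF P kL] run(2)[OF P kL] L[symmetric] by blast
  qed
  also have "\<dots> \<longleftrightarrow> (\<exists>m x. x \<in> olang e \<and> (\<forall>i. allowed n Q m (?r m i) (x i)))"
    unfolding lasso_iff[OF e n P, symmetric] ..
  also have "\<dots> \<longleftrightarrow> (\<exists>x. x \<in> olang e \<and> valid_seq n Q P x)"
    unfolding valid_seq_iff[OF n] using P by blast
  finally show ?thesis .
qed

end

section \<open>Recognising encoded expressions\<close>

lemma tok_code_inj: "tok_code s = tok_code t \<longleftrightarrow> s = t"
  by (cases s; cases t; simp)

lemma tok_at_eq: "tok_at w i = tok_code t \<longleftrightarrow> i < length w \<and> w ! i = t"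
  using tok_code_bounds(1)[of t] by (auto simp: tok_at_def tok_code_inj)

lemma tok_at_pos: "0 < tok_at w i \<longleftrightarrow> i < length w"
  using tok_code_bounds(1) by (auto simp: tok_at_def)

lemma tok_at_drop: "drop i w = t # v \<Longrightarrow> tok_at w i = tok_code t"
  using drop_ConsD[of i w t v] by (simp add: tok_at_def)

lemma tok_at_rexp:
  assumes "drop i w = rexp_enc r @ v" shows "6 \<le> tok_at w i \<and> tok_at w i \<le> 12"
proof (cases r)
  case (RSym x) then show ?thesis using assms tok_at_drop[of i w] by (cases x) auto
qed (use assms tok_at_drop[of i w] in auto)

lemma tok_at_oexp:
  assumes "drop i w = oexp_enc e @ v" shows "13 \<le> tok_at w i"
  using assms tok_at_drop[of i w] by (cases e) auto

context sized begin

lemma Suc_mod: "i < L \<Longrightarrow> (i + 1) mod B = i + 1"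
  using BL(1) by simp

lemma wfN_rexp: "drop i w = rexp_enc r @ v \<Longrightarrow> i \<le> j \<Longrightarrow> j < i + length (rexp_enc r) \<Longrightarrow> wfN B X L j"
proof (induction r arbitrary: i v)
  case REmpty
  then have "tok_at w j = 8" using tok_at_drop[of i w] by (simp add: le_less_Suc_eq)
  then show ?case by (simp add: wfN_def tokN_codeN)
next
  case REps
  then have "tok_at w j = 9" using tok_at_drop[of i w] by (simp add: le_less_Suc_eq)
  then show ?case by (simp add: wfN_def tokN_codeN)
next
  case (RSym x)
  then have "tok_at w j = 6 \<or> tok_at w j = 7" using tok_at_drop[of i w] by (cases x) (simp_all add: le_less_Suc_eq)
  then show ?case by (auto simp: wfN_def tokN_codeN)
next
  case (RPlus r s)
  let ?k = "i + 1 + length (rexp_enc r)"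
  have d: "drop i w = TPlus # rexp_enc r @ rexp_enc s @ v" using RPlus.prems by simp
  have d1: "drop (i + 1) w = rexp_enc r @ rexp_enc s @ v" using drop_ConsD(3)[OF d] by simp
  have d2: "drop ?k w = rexp_enc s @ v" using drop_appendD[OF d1] by simp
  consider "j = i" | "i + 1 \<le> j" "j < i + 1 + length (rexp_enc r)" | "?k \<le> j" "j < ?k + length (rexp_enc s)"
    using RPlus.prems(2,3) by fastforce
  then show ?case
  proof cases
    case 1
    then show ?thesis using Suc_mod[of i] drop_ConsD(1)[OF d] L tok_at_drop[OF d] E_rexp[OF d1] tok_at_rexp[OF d1] tok_at_rexp[OF d2]
      by (simp add: wfN_def tokN_codeN)
  qed (use RPlus.IH(1)[OF d1] RPlus.IH(2)[OF d2] in auto)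
next
  case (RTimes r s)
  let ?k = "i + 1 + length (rexp_enc r)"
  have d: "drop i w = TTimes # rexp_enc r @ rexp_enc s @ v" using RTimes.prems by simp
  have d1: "drop (i + 1) w = rexp_enc r @ rexp_enc s @ v" using drop_ConsD(3)[OF d] by simp
  have d2: "drop ?k w = rexp_enc s @ v" using drop_appendD[OF d1] by simp
  consider "j = i" | "i + 1 \<le> j" "j < i + 1 + length (rexp_enc r)" | "?k \<le> j" "j < ?k + length (rexp_enc s)"
    using RTimes.prems(2,3) by fastforce
  then show ?case
  proof cases
    case 1
    then show ?thesis using Suc_mod[of i] drop_ConsD(1)[OF d] L tok_at_drop[OF d] E_rexp[OF d1] tok_at_rexp[OF d1] tok_at_rexp[OF d2]
      by (simp add: wfN_def tokN_codeN)
  qed (use RTimes.IH(1)[OF d1] RTimes.IH(2)[OF d2] in auto)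
next
  case (RStar r)
  have d: "drop i w = TStar # rexp_enc r @ v" using RStar.prems by simp
  have d1: "drop (i + 1) w = rexp_enc r @ v" using drop_ConsD(3)[OF d] by simp
  consider "j = i" | "i + 1 \<le> j" "j < i + 1 + length (rexp_enc r)" using RStar.prems(2,3) by fastforce
  then show ?case
  proof cases
    case 1
    then show ?thesis using Suc_mod[of i] drop_ConsD(1)[OF d] L tok_at_drop[OF d] tok_at_rexp[OF d1]
      by (simp add: wfN_def tokN_codeN)
  qed (use RStar.IH[OF d1] in auto)
qed

lemma wfN_oexp: "drop i w = oexp_enc e @ v \<Longrightarrow> i \<le> j \<Longrightarrow> j < i + length (oexp_enc e) \<Longrightarrow> wfN B X L j"
proof (induction e arbitrary: i v)
  case (Omega r)
  have d: "drop i w = TOmega # rexp_enc r @ v" using Omega.prems by simp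
  have d1: "drop (i + 1) w = rexp_enc r @ v" using drop_ConsD(3)[OF d] by simp
  consider "j = i" | "i + 1 \<le> j" "j < i + 1 + length (rexp_enc r)" using Omega.prems(2,3) by fastforce
  then show ?case
  proof cases
    case 1
    then show ?thesis using Suc_mod[of i] drop_ConsD(1)[OF d] L tok_at_drop[OF d] tok_at_rexp[OF d1]
      by (simp add: wfN_def tokN_codeN)
  qed (use wfN_rexp[OF d1] in auto)
next
  case (OConc r e)
  let ?k = "i + 1 + length (rexp_enc r)"
  have d: "drop i w = TConc # rexp_enc r @ oexp_enc e @ v" using OConc.prems by simp
  have d1: "drop (i + 1) w = rexp_enc r @ oexp_enc e @ v" using drop_ConsD(3)[OF d] by simp
  have d2: "drop ?k w = oexp_enc e @ v" using drop_appendD[OF d1] by simp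
  consider "j = i" | "i + 1 \<le> j" "j < i + 1 + length (rexp_enc r)" | "?k \<le> j" "j < ?k + length (oexp_enc e)"
    using OConc.prems(2,3) by fastforce
  then show ?case
  proof cases
    case 1
    then show ?thesis using Suc_mod[of i] drop_ConsD(1)[OF d] L tok_at_drop[OF d] E_rexp[OF d1] tok_at_rexp[OF d1] tok_at_oexp[OF d2]
      by (simp add: wfN_def tokN_codeN)
  qed (use wfN_rexp[OF d1] OConc.IH[OF d2] in auto)
next
  case (OPlus e f)
  let ?k = "i + 1 + length (oexp_enc e)"
  have d: "drop i w = TOPlus # oexp_enc e @ oexp_enc f @ v" using OPlus.prems by simp
  have d1: "drop (i + 1) w = oexp_enc e @ oexp_enc f @ v" using drop_ConsD(3)[OF d] by simp
  have d2: "drop ?k w = oexp_enc f @ v" using drop_appendD[OF d1] by simp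
  consider "j = i" | "i + 1 \<le> j" "j < i + 1 + length (oexp_enc e)" | "?k \<le> j" "j < ?k + length (oexp_enc f)"
    using OPlus.prems(2,3) by fastforce
  then show ?case
  proof cases
    case 1
    then show ?thesis using Suc_mod[of i] drop_ConsD(1)[OF d] L tok_at_drop[OF d] E_oexp[OF d1] tok_at_oexp[OF d1] tok_at_oexp[OF d2]
      by (simp add: wfN_def tokN_codeN)
  qed (use OPlus.IH(1)[OF d1] OPlus.IH(2)[OF d2] in auto)
qed

text \<open>The local checks determine a parse tree. Induction on the remaining input parses the
  first operand; only then is \<open>endN\<close> known to return its end, and there the same
  hypothesis parses the second operand.\<close>

lemma wfN_parse:
  assumes wf: "\<And>i. i < L \<Longrightarrow> k \<le> i \<Longrightarrow> wfN B X L i" and "k \<le> i"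
  shows "(6 \<le> tok_at w i \<and> tok_at w i \<le> 12 \<longrightarrow> (\<exists>r v. drop i w = rexp_enc r @ v)) \<and>
         (13 \<le> tok_at w i \<longrightarrow> (\<exists>e v. drop i w = oexp_enc e @ v))"
  using \<open>k \<le> i\<close>
proof (induction "L - i" arbitrary: i rule: less_induct)
  case less
  show ?case
  proof (cases "i < L")
    case False
    then show ?thesis using L by (simp add: tok_at_def)
  next
    case True
    define t where "t = w ! i"
    have d: "drop i w = t # drop (i + 1) w" using True L Cons_nth_drop_Suc[of i w] by (simp add: t_def)
    note tok = tok_at_drop[OF d]
    have m: "(i + 1) mod B = i + 1" using Suc_mod True by simp
    have R: "\<exists>r v. drop j w = rexp_enc r @ v" if "6 \<le> tok_at w j" "tok_at w j \<le> 12" "i < j" for j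
      using less.hyps[of j] that True less.prems by force
    have O: "\<exists>e v. drop j w = oexp_enc e @ v" if "13 \<le> tok_at w j" "i < j" for j
      using less.hyps[of j] that True less.prems by force
    have w: "wfN B X L i" using wf True less.prems by simp
    have bin_rr: "\<exists>r s v. drop (i + 1) w = rexp_enc r @ rexp_enc s @ v" if "t = TPlus \<or> t = TTimes"
    proof -
      have "6 \<le> tok_at w (i + 1) \<and> tok_at w (i + 1) \<le> 12"
        and 2: "6 \<le> tok_at w (endN B X L (i + 1)) \<and> tok_at w (endN B X L (i + 1)) \<le> 12"
        using w that tok m by (auto simp: wfN_def Let_def tokN_codeN)
      then obtain r v where r: "drop (i + 1) w = rexp_enc r @ v" using R[of "i + 1"] by auto
      obtain s v' where "drop (i + 1 + length (rexp_enc r)) w = rexp_enc s @ v'"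
        using R[of "i + 1 + length (rexp_enc r)"] 2 E_rexp[OF r] by auto
      then have "drop (i + 1) w = rexp_enc r @ rexp_enc s @ v'" using r drop_appendD[OF r] by simp
      then show ?thesis by blast
    qed
    have un_r: "\<exists>r v. drop (i + 1) w = rexp_enc r @ v" if "t = TStar \<or> t = TOmega"
      using w that tok m R[of "i + 1"] by (auto simp: wfN_def Let_def tokN_codeN)
    have bin_ro: "\<exists>r e v. drop (i + 1) w = rexp_enc r @ oexp_enc e @ v" if "t = TConc"
    proof -
      have "6 \<le> tok_at w (i + 1) \<and> tok_at w (i + 1) \<le> 12" and 2: "13 \<le> tok_at w (endN B X L (i + 1))"
        using w that tok m by (auto simp: wfN_def Let_def tokN_codeN)
      then obtain r v where r: "drop (i + 1) w = rexp_enc r @ v" using R[of "i + 1"] by auto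
      obtain e v' where "drop (i + 1 + length (rexp_enc r)) w = oexp_enc e @ v'"
        using O[of "i + 1 + length (rexp_enc r)"] 2 E_rexp[OF r] by auto
      then have "drop (i + 1) w = rexp_enc r @ oexp_enc e @ v'" using r drop_appendD[OF r] by simp
      then show ?thesis by blast
    qed
    have bin_oo: "\<exists>e f v. drop (i + 1) w = oexp_enc e @ oexp_enc f @ v" if "t = TOPlus"
    proof -
      have "13 \<le> tok_at w (i + 1)" and 2: "13 \<le> tok_at w (endN B X L (i + 1))"
        using w that tok m by (auto simp: wfN_def Let_def tokN_codeN)
      then obtain e v where e: "drop (i + 1) w = oexp_enc e @ v" using O[of "i + 1"] by auto
      obtain f v' where "drop (i + 1 + length (oexp_enc e)) w = oexp_enc f @ v'"
        using O[of "i + 1 + length (oexp_enc e)"] 2 E_oexp[OF e] by auto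
      then have "drop (i + 1) w = oexp_enc e @ oexp_enc f @ v'" using e drop_appendD[OF e] by simp
      then show ?thesis by blast
    qed
    have leafR: "\<exists>r v. drop i w = rexp_enc r @ v" if "rexp_enc r0 = [t]" for r0
      using that d by (intro exI[of _ r0] exI[of _ "drop (i + 1) w"]) simp
    show ?thesis
    proof (cases t)
      case TA then show ?thesis using leafR[of "RSym La"] tok by simp
    next
      case TB then show ?thesis using leafR[of "RSym Lb"] tok by simp
    next
      case TEmpty then show ?thesis using leafR[of REmpty] tok by simp
    next
      case TEps then show ?thesis using leafR[of REps] tok by simp
    next
      case TPlus
      then obtain r s v where "drop (i + 1) w = rexp_enc r @ rexp_enc s @ v" using bin_rr by auto
      then have "drop i w = rexp_enc (RPlus r s) @ v" using d TPlus by simp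
      then show ?thesis using tok TPlus by (auto simp del: rexp_enc.simps)
    next
      case TTimes
      then obtain r s v where "drop (i + 1) w = rexp_enc r @ rexp_enc s @ v" using bin_rr by auto
      then have "drop i w = rexp_enc (RTimes r s) @ v" using d TTimes by simp
      then show ?thesis using tok TTimes by (auto simp del: rexp_enc.simps)
    next
      case TStar
      then obtain r v where "drop (i + 1) w = rexp_enc r @ v" using un_r by auto
      then have "drop i w = rexp_enc (RStar r) @ v" using d TStar by simp
      then show ?thesis using tok TStar by (auto simp del: rexp_enc.simps)
    next
      case TOmega
      then obtain r v where "drop (i + 1) w = rexp_enc r @ v" using un_r by auto
      then have "drop i w = oexp_enc (Omega r) @ v" using d TOmega by simp
      then show ?thesis using tok TOmega by (auto simp del: oexp_enc.simps)
    next
      case TConc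
      then obtain r e v where "drop (i + 1) w = rexp_enc r @ oexp_enc e @ v" using bin_ro by auto
      then have "drop i w = oexp_enc (OConc r e) @ v" using d TConc by simp
      then show ?thesis using tok TConc by (auto simp del: oexp_enc.simps)
    next
      case TOPlus
      then obtain e f v where "drop (i + 1) w = oexp_enc e @ oexp_enc f @ v" using bin_oo by auto
      then have "drop i w = oexp_enc (OPlus e f) @ v" using d TOPlus by simp
      then show ?thesis using tok TOPlus by (auto simp del: oexp_enc.simps)
    qed (use tok in auto)
  qed
qed

lemma oexpN_iff: "oexpN B X L k \<longleftrightarrow> (\<exists>e. drop k w = oexp_enc e)"
proof
  assume a: "oexpN B X L k"
  then obtain e v where e: "drop k w = oexp_enc e @ v"
    using wfN_parse[of k] by (auto simp: oexpN_def tokN_codeN)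
  have "k + length (oexp_enc e) = length w" using a E_oexp[OF e] L by (simp add: oexpN_def)
  moreover have "length w - k = length (oexp_enc e) + length v" using arg_cong[OF e, of length] by simp
  ultimately have "length v = 0" by linarith
  then show "\<exists>e. drop k w = oexp_enc e" using e by auto
next
  assume "\<exists>e. drop k w = oexp_enc e"
  then obtain e where e: "drop k w = oexp_enc e @ []" by auto
  have kl: "k < L" using drop_appendD_less[OF e oexp_enc_len] L by simp
  have "length w - k = length (oexp_enc e)" using arg_cong[OF e, of length] by simp
  then have "k + length (oexp_enc e) = L" using kl L by simp
  then show "oexpN B X L k"
    using E_oexp[OF e] tok_at_oexp[OF e] wfN_oexp[OF e] by (simp add: oexpN_def tokN_codeN)
qed

end

section \<open>Recognising encoded numbers\<close>

definition occ :: "token list \<Rightarrow> nat \<Rightarrow> nat \<Rightarrow> token list \<Rightarrow> bool" where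
  "occ w i j u \<longleftrightarrow> (\<exists>v. drop i w = u @ v) \<and> j = i + length u"

lemma occ_append: "occ w i j (u @ u') \<longleftrightarrow> occ w i (i + length u) u \<and> occ w (i + length u) j u'"
proof
  assume "occ w i j (u @ u')"
  then obtain v where v: "drop i w = u @ u' @ v" "j = i + length u + length u'" by (auto simp: occ_def)
  then show "occ w i (i + length u) u \<and> occ w (i + length u) j u'"
    using drop_appendD[OF v(1)] by (auto simp: occ_def)
next
  assume "occ w i (i + length u) u \<and> occ w (i + length u) j u'"
  then obtain v v' where v: "drop i w = u @ v" "drop (i + length u) w = u' @ v'" "j = i + length u + length u'"
    by (auto simp: occ_def)
  then show "occ w i j (u @ u')" using drop_appendD[OF v(1)] by (auto simp: occ_def)
qed

lemma occ_trans: "occ w i j u \<Longrightarrow> occ w j l u' \<Longrightarrow> occ w i l (u @ u')"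
  using occ_append[of w i l u u'] by (auto simp: occ_def)

lemma occ_single: "occ w i j [t] \<longleftrightarrow> tok_at w i = tok_code t \<and> j = i + 1"
proof -
  have "(\<exists>v. drop i w = t # v) \<longleftrightarrow> i < length w \<and> w ! i = t"
    using drop_ConsD(1,2)[of i w t] Cons_nth_drop_Suc[of i w] by metis
  then show ?thesis by (auto simp: occ_def tok_at_eq)
qed

lemma occ_length: "occ w i j u \<Longrightarrow> u \<noteq> [] \<Longrightarrow> j \<le> length w"
proof -
  assume a: "occ w i j u" "u \<noteq> []"
  then obtain v where v: "drop i w = u @ v" "j = i + length u" by (auto simp: occ_def)
  have "length w - i = length u + length v" using arg_cong[OF v(1), of length] by simp
  moreover have "0 < length u" using a(2) by simp
  ultimately show ?thesis using v(2) by linarith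
qed

definition bval :: "token list \<Rightarrow> nat" where
  "bval u = foldl (\<lambda>a t. 2 * a + (tok_code t - 1)) 0 u"

definition binary :: "token list \<Rightarrow> bool" where
  "binary u \<longleftrightarrow> u \<noteq> [] \<and> set u \<subseteq> {T0, T1} \<and> (hd u = T1 \<or> length u = 1)"

lemma bval_snoc: "bval (u @ [t]) = 2 * bval u + (tok_code t - 1)"
  by (simp add: bval_def)

lemma bval_less: "set u \<subseteq> {T0, T1} \<Longrightarrow> bval u < 2 ^ length u"
  by (induction u rule: rev_induct) (auto simp: bval_snoc, simp add: bval_def)

declare nat_enc.simps [simp del]

lemma binary_nat_enc: "binary (nat_enc m) \<and> bval (nat_enc m) = m \<and> (2 \<le> m \<longrightarrow> hd (nat_enc m) = T1)"
proof (induction m rule: nat_enc.induct)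
  case (1 m)
  show ?case
  proof (cases "m < 2")
    case True
    then have "nat_enc m = [if m = 0 then T0 else T1]" using nat_enc.simps[of m] by simp
    then show ?thesis using True by (auto simp: binary_def bval_def)
  next
    case False
    then have e: "nat_enc m = nat_enc (m div 2) @ [if m mod 2 = 0 then T0 else T1]" using nat_enc.simps[of m] by simp
    have IH: "binary (nat_enc (m div 2))" "bval (nat_enc (m div 2)) = m div 2" "2 \<le> m div 2 \<longrightarrow> hd (nat_enc (m div 2)) = T1"
      using 1 False by auto
    have hd: "hd (nat_enc (m div 2)) = T1"
    proof (cases "2 \<le> m div 2")
      case False
      then have "m div 2 = 1" using \<open>\<not> m < 2\<close> by simp
      then show ?thesis using nat_enc.simps[of 1] by simp
    qed (use IH in simp)
    have "bval (nat_enc m) = 2 * (m div 2) + m mod 2" unfolding e bval_snoc IH(2) by (auto simp: mod_2_eq_odd)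
    then show ?thesis using hd IH(1) e by (auto simp: binary_def)
  qed
qed

lemma bval_pos: "set u \<subseteq> {T0, T1} \<Longrightarrow> u \<noteq> [] \<Longrightarrow> hd u = T1 \<Longrightarrow> 0 < bval u"
proof (induction u rule: rev_induct)
  case (snoc t u)
  then show ?case by (cases "u = []") (auto simp: bval_snoc, simp add: bval_def)
qed simp

lemma nat_enc_bval: "binary u \<Longrightarrow> nat_enc (bval u) = u"
proof (induction u rule: rev_induct)
  case (snoc t u)
  have t: "t = T0 \<or> t = T1" using snoc.prems by (auto simp: binary_def)
  show ?case
  proof (cases "u = []")
    case True
    then show ?thesis using t nat_enc.simps[of 0] nat_enc.simps[of 1] by (auto simp: bval_def)
  next
    case False
    then have b: "binary u" "hd u = T1" "set u \<subseteq> {T0, T1}" using snoc.prems by (auto simp: binary_def)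
    \<comment> \<open>Without a leading zero the shorter word has positive value, so
      \<open>nat_enc\<close> really takes its recursive branch on the longer one.\<close>
    have pos: "0 < bval u" using bval_pos[OF b(3) False b(2)] .
    then have "\<not> bval (u @ [t]) < 2" "bval (u @ [t]) div 2 = bval u" "bval (u @ [t]) mod 2 = tok_code t - 1"
      using t by (auto simp: bval_snoc)
    then show ?thesis using nat_enc.simps[of "bval (u @ [t])"] snoc.IH[OF b(1)] t by auto
  qed
qed (simp add: binary_def)

lemma eq_nat_enc_iff: "u = nat_enc m \<longleftrightarrow> binary u \<and> m = bval u"
  using binary_nat_enc[of m] nat_enc_bval[of u] by auto

lemma nat_enc_nonempty: "nat_enc m \<noteq> []"
  using binary_nat_enc[of m] by (simp add: binary_def)

context sized begin

text \<open>Numbers encoded in the input are below \<open>2 ^ L\<close>, so quantifiers bounded by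
  \<open>B - 1\<close> see all of them.\<close>

lemma Z_less: "2 ^ L < B - 1"
proof (cases "L = 0")
  case True then show ?thesis using BL(1) by simp
next
  case False
  have "(2::nat) * 2 ^ L \<le> 2 ^ L * 2 ^ L" using False by (intro mult_le_mono1 self_le_power) auto
  also have "\<dots> = 2 ^ (2 * L)" by (simp add: mult_2 power_add)
  finally have "2 * 2 ^ L \<le> B" using BL(3) by simp
  moreover have "(2::nat) \<le> 2 ^ L" using False by (intro self_le_power) auto
  ultimately show ?thesis by linarith
qed

lemma valN_bval:
  assumes d: "drop i w = u @ v" and u: "set u \<subseteq> {T0, T1}" "u \<noteq> []"
  shows "valN B X i (i + length u) = bval u"
proof -
  have le: "i + length u \<le> L" using occ_length[of w i "i + length u" u] d u L by (auto simp: occ_def)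
  have "((\<lambda>(l, a). ((l + 1) mod B, ((2 * a) mod B + (tokN X l - 1)) mod B)) ^^ m) (i, 0) = (i + m, bval (take m u))"
    if "m \<le> length u" for m
    using that
  proof (induction m)
    case 0 then show ?case by (simp add: bval_def)
  next
    case (Suc m)
    have "tok_at w (i + m) = tok_code (u ! m)"
    proof -
      have "w ! (i + m) = (u @ v) ! m" using d Suc.prems le L by (metis nth_drop less_le_trans add_leD1 linorder_not_le not_less_eq_eq)
      then show ?thesis using Suc.prems le L by (simp add: tok_at_def nth_append)
    qed
    moreover have t: "take (Suc m) u = take m u @ [u ! m]" using Suc.prems by (simp add: take_Suc_conv_app_nth)
    moreover have "bval (take (Suc m) u) < B"
    proof -
      have "set (take (Suc m) u) \<subseteq> {T0, T1}" using u(1) set_take_subset[of "Suc m" u] by blast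
      then have "bval (take (Suc m) u) < 2 ^ length (take (Suc m) u)" by (rule bval_less)
      also have "\<dots> \<le> 2 ^ L" using le by (intro power_increasing) auto
      finally show ?thesis using Z_less by linarith
    qed
    moreover have "i + m + 1 < B" using Suc.prems le BL(1) by simp
    ultimately show ?case using Suc by (simp add: tokN_codeN bval_snoc mod_simps)
  qed
  from this[of "length u"] show ?thesis by (simp add: valN_def)
qed

lemma natN_occ:
  assumes d: "drop i w = u @ v" and u: "u \<noteq> []"
  shows "natN B X i (i + length u) m \<longleftrightarrow> u = nat_enc m"
proof -
  have le: "i + length u \<le> L" using occ_length[of w i "i + length u" u] d u L by (auto simp: occ_def)
  have tok: "tok_at w (i + l) = tok_code (u ! l)" if "l < length u" for l
  proof -
    have "w ! (i + l) = (u @ v) ! l" using d that le L by (metis nth_drop add_leD1)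
    then show ?thesis using that le L by (simp add: tok_at_def nth_append)
  qed
  have c12: "tok_code t = 1 \<or> tok_code t = 2 \<longleftrightarrow> t \<in> {T0, T1}" "tok_code t = 2 \<longleftrightarrow> t = T1" for t by (cases t; simp)+
  have 1: "(\<forall>l<i + length u. i \<le> l \<longrightarrow> tokN X l = 1 \<or> tokN X l = 2) \<longleftrightarrow> set u \<subseteq> {T0, T1}"
  proof -
    have "(\<forall>l<i + length u. i \<le> l \<longrightarrow> tokN X l = 1 \<or> tokN X l = 2) \<longleftrightarrow> (\<forall>l<length u. tokN X (i + l) = 1 \<or> tokN X (i + l) = 2)"
      by (metis le_add1 le_Suc_ex nat_add_left_cancel_less)
    also have "\<dots> \<longleftrightarrow> (\<forall>l<length u. u ! l \<in> {T0, T1})" using tok c12 by (simp add: tokN_codeN)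
    also have "\<dots> \<longleftrightarrow> set u \<subseteq> {T0, T1}" by (auto simp: in_set_conv_nth subset_iff)
    finally show ?thesis .
  qed
  have 2: "tokN X i = 2 \<longleftrightarrow> hd u = T1" using tok[of 0] u c12 by (simp add: tokN_codeN hd_conv_nth)
  have "0 < length u" using u by simp
  then have "i < L" using le by linarith
  then have 3: "i + length u = (i + 1) mod B \<longleftrightarrow> length u = 1" using Suc_mod by simp
  show ?thesis unfolding natN_def 1 2 3 eq_nat_enc_iff binary_def using valN_bval[OF d _ u] u by auto
qed

lemma natN_iff: "natN B X i j m \<longleftrightarrow> occ w i j (nat_enc m)"
proof
  assume a: "natN B X i j m"
  have ij: "i < j" using a by (simp add: natN_def)
  \<comment> \<open>The last token of the interval is a digit, hence no blank, so the interval ends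
    inside the input.\<close>
  then have "tokN X (j - 1) \<noteq> 0" using a unfolding natN_def by (metis One_nat_def Suc_pred diff_less le_Suc_eq less_Suc_eq_le less_nat_zero_code linorder_not_le neq0_conv one_neq_zero zero_less_Suc zero_neq_numeral)
  then have "0 < tok_at w (j - 1)" unfolding tokN_codeN by simp
  then have "j - 1 < L" using tok_at_pos L by blast
  then have jL: "j \<le> length w" using L by simp
  define u where "u = take (j - i) (drop i w)"
  have lu: "length u = j - i" using jL ij by (simp add: u_def)
  then have u: "u \<noteq> []" "j = i + length u" using ij by auto
  have d: "drop i w = u @ drop (j - i) (drop i w)" by (simp only: u_def append_take_drop_id)
  have "u = nat_enc m" using natN_occ[OF d u(1)] a u(2) by simp
  then show "occ w i j (nat_enc m)" using d u(2) by (auto simp: occ_def)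
next
  assume "occ w i j (nat_enc m)"
  then obtain v where "drop i w = nat_enc m @ v" "j = i + length (nat_enc m)" by (auto simp: occ_def)
  then show "natN B X i j m" using natN_occ nat_enc_nonempty by simp
qed

lemma occ_nat_less: "occ w i j (nat_enc m) \<Longrightarrow> m < 2 ^ L"
proof -
  assume a: "occ w i j (nat_enc m)"
  have "i + length (nat_enc m) \<le> L" using occ_length[OF a nat_enc_nonempty] a L by (simp add: occ_def)
  then have "length (nat_enc m) \<le> L" by simp
  then have "(2::nat) ^ length (nat_enc m) \<le> 2 ^ L" by (intro power_increasing) auto
  moreover have "m < 2 ^ length (nat_enc m)"
    using bval_less[of "nat_enc m"] binary_nat_enc[of m] by (simp add: binary_def)
  ultimately show ?thesis by linarith
qed

lemma occ_Cons: "occ w i j (t # u) \<longleftrightarrow> tok_at w i = tok_code t \<and> occ w (i + 1) j u"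
  using occ_append[of w i j "[t]" u] occ_single[of w i "i + 1" t] by simp

lemma intN_iff: "intN B X i j p q \<longleftrightarrow> occ w i j (int_enc (int p - int q)) \<and> (p = 0 \<or> q = 0)"
proof -
  have m: "(i + 1) mod B = i + 1" if "tok_at w i = 3"
    using that tok_at_pos[of w i] L Suc_mod by simp
  have 1: "p = 0 \<and> 0 < q \<and> tokN X i = 3 \<and> natN B X ((i + 1) mod B) j q \<longleftrightarrow> p = 0 \<and> 0 < q \<and> occ w i j (int_enc (int p - int q))"
    using m by (auto simp: natN_iff tokN_codeN int_enc_def occ_Cons)
  show ?thesis unfolding intN_def 1 unfolding natN_iff by (auto simp: int_enc_def)
qed

text \<open>Since \<open>p\<close> or \<open>q\<close> is 0, the numerator equals
  \<open>p + q\<close> up to sign and its divisors are the common divisors of \<open>p\<close> and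
  \<open>q\<close>. A divisor of \<open>d\<close> is at most \<open>d\<close>, so bounding
  \<open>y\<close> by \<open>B - 1\<close> misses none.\<close>

lemma coprime_pos_neg:
  assumes "p = 0 \<or> q = 0" "0 < d" "d < B - 1"
  shows "(\<forall>y<B - 1. y dvd p \<and> y dvd q \<and> y dvd d \<longrightarrow> y = 1) \<longleftrightarrow> coprime (int p - int q) (int d)"
proof -
  have "(\<forall>y<B - 1. y dvd p \<and> y dvd q \<and> y dvd d \<longrightarrow> y = 1) \<longleftrightarrow> (\<forall>y. y dvd p \<and> y dvd q \<and> y dvd d \<longrightarrow> y = 1)"
    using assms(2,3) dvd_imp_le[of _ d] by (metis le_less_trans)
  also have "\<dots> \<longleftrightarrow> coprime (p + q) d" using assms(1) by (auto simp: coprime_def)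
  also have "\<dots> \<longleftrightarrow> coprime (int p - int q) (int d)"
    using assms(1) coprime_int_iff[of "p + q" d] by auto
  finally show ?thesis .
qed

lemma ratN_iff:
  "ratN B X i j p q d \<longleftrightarrow> (\<exists>r. quotient_of r = (int p - int q, int d) \<and> (p = 0 \<or> q = 0) \<and> occ w i j (rat_enc r))"
proof
  assume a: "ratN B X i j p q d"
  then obtain c where c: "tok_at w c = tok_code TSlash" "intN B X i c p q" "natN B X ((c + 1) mod B) j d" and d: "0 < d"
    and cop: "\<forall>y<B - 1. y dvd p \<and> y dvd q \<and> y dvd d \<longrightarrow> y = 1" unfolding ratN_def tokN_codeN by auto
  have "c < L" using c(1) tok_at_pos[of w c] tok_code_bounds(1)[of TSlash] L by simp
  then have o: "occ w i c (int_enc (int p - int q))" "occ w (c + 1) j (nat_enc d)" "p = 0 \<or> q = 0"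
    using c(2,3) Suc_mod by (auto simp: intN_iff natN_iff)
  have dl: "d < B - 1" using occ_nat_less[OF o(2)] Z_less by linarith
  define r where "r = Fract (int p - int q) (int d)"
  have r: "quotient_of r = (int p - int q, int d)"
    using coprime_pos_neg[OF o(3) d dl] cop d by (simp add: r_def quotient_of_Fract)
  have "occ w c (c + 1) [TSlash]" using c(1) by (simp add: occ_single)
  then have "occ w i j (int_enc (int p - int q) @ [TSlash] @ nat_enc d)" using occ_trans o by blast
  moreover have "rat_enc r = int_enc (int p - int q) @ [TSlash] @ nat_enc d" using r by (simp add: rat_enc_def int_enc_def)
  ultimately show "\<exists>r. quotient_of r = (int p - int q, int d) \<and> (p = 0 \<or> q = 0) \<and> occ w i j (rat_enc r)"
    using r o(3) by auto
next
  assume "\<exists>r. quotient_of r = (int p - int q, int d) \<and> (p = 0 \<or> q = 0) \<and> occ w i j (rat_enc r)"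
  then obtain r where r: "quotient_of r = (int p - int q, int d)" "p = 0 \<or> q = 0" "occ w i j (rat_enc r)" by blast
  define c where "c = i + length (int_enc (int p - int q))"
  have "rat_enc r = int_enc (int p - int q) @ TSlash # nat_enc d" using r(1) by (simp add: rat_enc_def int_enc_def)
  then have o: "occ w i c (int_enc (int p - int q))" "tok_at w c = tok_code TSlash" "occ w (c + 1) j (nat_enc d)"
    using r(3) by (auto simp: occ_append occ_Cons c_def)
  have cL: "c < L" using o(2) tok_at_pos[of w c] tok_code_bounds(1)[of TSlash] L by simp
  have "c + 1 + length (nat_enc d) = j" using o(3) by (auto simp: occ_def)
  then have "c < j" by linarith
  moreover have d: "0 < d" using quotient_of_denom_pos[OF r(1)] by simp
  moreover have "d < B - 1" using occ_nat_less[OF o(3)] Z_less by linarith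
  then have "\<forall>y<B - 1. y dvd p \<and> y dvd q \<and> y dvd d \<longrightarrow> y = 1"
    using coprime_pos_neg[OF r(2) d] quotient_of_coprime[OF r(1)] by blast
  ultimately show "ratN B X i j p q d"
    unfolding ratN_def tokN_codeN using o r(2) Suc_mod[OF cL] by (auto simp: intN_iff natN_iff)
qed

end

section \<open>Sizes of the numbers, and correctness for whole inputs\<close>

lemma mul4_eq: "w * x * y * z < B \<Longrightarrow> mul4 B w x y z = w * x * y * z"
  by (simp add: mul4_def mod_simps)

lemma mul4_less:
  fixes w x y z Z :: nat
  assumes "w < Z" "x < Z" "y < Z" "z < Z"
  shows "w * x * y * z < Z ^ 4"
proof -
  have "w * x < Z * Z" using assms by (intro mult_strict_mono) auto
  then have "w * x * y < Z * Z * Z" using assms by (intro mult_strict_mono) auto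
  then have "w * x * y * z < Z * Z * Z * Z" using assms by (intro mult_strict_mono) auto
  then show ?thesis by (simp add: power4_eq_xxxx)
qed

text \<open>Products of four factors below \<open>Z\<close> are below \<open>Z ^ 4\<close>, so each
  sum of two stays below \<open>2 * Z ^ 4 \<le> B\<close> and the modular evaluation is
  exact.\<close>

lemma eqN_iff:
  fixes n tp tn td ap an ad bp bn bd Z B P Q :: nat
  assumes lt: "n < Z" "tp < Z" "tn < Z" "td < Z" "ap < Z" "an < Z" "ad < Z" "bp < Z" "bn < Z" "bd < Z"
    and B: "2 * Z ^ 4 \<le> B" and n: "1 \<le> n"
  defines "T \<equiv> (int tp - int tn) * int ad * int bd" and "A \<equiv> (int ap - int an) * int td * int bd"
    and "C \<equiv> (int bp - int bn) * int td * int ad"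
  shows "eqN B n tp tn td ap an ad bp bn bd P Q \<longleftrightarrow>
    ((int n - 1) * T - int n * A = int P \<and> (int n - 1) * (C - A) = int Q \<or>
     (int n - 1) * T - int n * A = - int P \<and> (int n - 1) * (C - A) = - int Q)"
    and "eqN B n tp tn td ap an ad bp bn bd P Q \<Longrightarrow> P < 2 * Z ^ 4 \<and> Q < 2 * Z ^ 4"
proof -
  have n1: "n - 1 < Z" using lt(1) by simp
  have sum: "(mul4 B a b c d + mul4 B a' b' c' d') mod B = a * b * c * d + a' * b' * c' * d'"
    "a * b * c * d + a' * b' * c' * d' < 2 * Z ^ 4"
    if "a < Z" "b < Z" "c < Z" "d < Z" "a' < Z" "b' < Z" "c' < Z" "d' < Z" for a b c d a' b' c' d'
  proof -
    have 1: "a * b * c * d < Z ^ 4" "a' * b' * c' * d' < Z ^ 4" using mul4_less that by auto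
    then show l: "a * b * c * d + a' * b' * c' * d' < 2 * Z ^ 4" by linarith
    have "a * b * c * d < B" "a' * b' * c' * d' < B" using 1 B by linarith+
    then show "(mul4 B a b c d + mul4 B a' b' c' d') mod B = a * b * c * d + a' * b' * c' * d'"
      using mul4_eq l B by simp
  qed
  define x y u v where "x = (n - 1) * tp * ad * bd + n * an * td * bd"
    and "y = (n - 1) * tn * ad * bd + n * ap * td * bd"
    and "u = (n - 1) * bp * td * ad + (n - 1) * an * td * bd"
    and "v = (n - 1) * bn * td * ad + (n - 1) * ap * td * bd"
  have eq: "eqN B n tp tn td ap an ad bp bn bd P Q \<longleftrightarrow>
      (y \<le> x \<and> P = x - y \<and> v \<le> u \<and> Q = u - v \<or> x \<le> y \<and> P = y - x \<and> u \<le> v \<and> Q = v - u)"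
    unfolding eqN_def Let_def x_def y_def u_def v_def using sum(1) lt n1 by simp
  have "x < 2 * Z ^ 4" "y < 2 * Z ^ 4" "u < 2 * Z ^ 4" "v < 2 * Z ^ 4"
    unfolding x_def y_def u_def v_def by (intro sum(2) lt n1)+
  then show "eqN B n tp tn td ap an ad bp bn bd P Q \<Longrightarrow> P < 2 * Z ^ 4 \<and> Q < 2 * Z ^ 4" unfolding eq by linarith
  have i: "int (n - 1) = int n - 1" using n by simp
  have "(int n - 1) * T - int n * A = int x - int y" "(int n - 1) * (C - A) = int u - int v"
    unfolding T_def A_def C_def x_def y_def u_def v_def of_nat_add of_nat_mult i by (simp_all add: algebra_simps)
  then show "eqN B n tp tn td ap an ad bp bn bd P Q \<longleftrightarrow>
    ((int n - 1) * T - int n * A = int P \<and> (int n - 1) * (C - A) = int Q \<or>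
     (int n - 1) * T - int n * A = - int P \<and> (int n - 1) * (C - A) = - int Q)"
    unfolding eq by auto
qed

lemma CTDS_lang_iff:
  "w \<in> CTDS_inv_nat_lang \<longleftrightarrow> (\<exists>n t a b e. 2 \<le> n \<and> w = CTDS_enc (1 / of_nat n) t a b e \<and>
     (\<exists>x. x \<in> olang e \<and> discounted_sum_is (1 / of_nat n) a b x t))"
  unfolding CTDS_inv_nat_lang_def CTDS_yes_def by fastforce

lemma rat_enc_inverse: "2 \<le> n \<Longrightarrow> rat_enc (1 / of_nat n) = [T1, TSlash] @ nat_enc n"
proof -
  assume "2 \<le> n"
  then have "quotient_of (Fract 1 (int n)) = (1, int n)" by (simp add: quotient_of_Fract)
  moreover have "Fract 1 (int n) = 1 / of_nat n" by (simp add: Fract_of_int_quotient)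
  ultimately show ?thesis using nat_enc.simps[of 1] by (simp add: rat_enc_def int_enc_def)
qed

lemma CTDS_enc_occ:
  assumes "2 \<le> n"
  shows "w = CTDS_enc (1 / of_nat n) t a b e \<longleftrightarrow>
    (\<exists>j1 j2 j3 j4. tok_at w 0 = 2 \<and> tok_at w 1 = 4 \<and> occ w 2 j1 (nat_enc n) \<and> tok_at w j1 = 5 \<and>
      occ w (j1 + 1) j2 (rat_enc t) \<and> tok_at w j2 = 5 \<and> occ w (j2 + 1) j3 (rat_enc a) \<and> tok_at w j3 = 5 \<and>
      occ w (j3 + 1) j4 (rat_enc b) \<and> tok_at w j4 = 5 \<and> drop (j4 + 1) w = oexp_enc e)" (is "?l \<longleftrightarrow> ?r")
proof -
  let ?u = "[T1, TSlash] @ nat_enc n @ [TSep] @ rat_enc t @ [TSep] @ rat_enc a @ [TSep] @ rat_enc b @ [TSep]"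
  have enc: "CTDS_enc (1 / of_nat n) t a b e = ?u @ oexp_enc e"
    using rat_enc_inverse[OF assms] by (simp add: CTDS_enc_def TDS_enc_def)
  have "w = ?u @ oexp_enc e \<longleftrightarrow> (\<exists>m. occ w 0 m ?u \<and> drop m w = oexp_enc e)"
  proof
    assume w: "w = ?u @ oexp_enc e"
    have "drop 0 w = ?u @ oexp_enc e" using w by (simp only: drop_0)
    then have "occ w 0 (0 + length ?u) ?u" and "drop (0 + length ?u) w = oexp_enc e"
      using drop_appendD by (blast intro: occ_def[THEN iffD2])+
    then show "\<exists>m. occ w 0 m ?u \<and> drop m w = oexp_enc e" by blast
  next
    assume "\<exists>m. occ w 0 m ?u \<and> drop m w = oexp_enc e"
    then obtain m v where v: "drop 0 w = ?u @ v" "m = 0 + length ?u" "drop m w = oexp_enc e" unfolding occ_def by blast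
    have "v = oexp_enc e" using drop_appendD[OF v(1)] v(2,3) by simp
    then show "w = ?u @ oexp_enc e" using v(1) by (simp only: drop_0)
  qed
  also have "\<dots> \<longleftrightarrow> ?r"
  proof
    assume "\<exists>m. occ w 0 m ?u \<and> drop m w = oexp_enc e"
    then obtain m where m: "occ w 0 m ?u" "drop m w = oexp_enc e" by blast
    define j1 j2 j3 j4 where "j1 = 2 + length (nat_enc n)" and "j2 = j1 + 1 + length (rat_enc t)"
      and "j3 = j2 + 1 + length (rat_enc a)" and "j4 = j3 + 1 + length (rat_enc b)"
    have "occ w 0 (0 + length [T1, TSlash]) [T1, TSlash]" and r1: "occ w 2 m (nat_enc n @ [TSep] @ rat_enc t @ [TSep] @ rat_enc a @ [TSep] @ rat_enc b @ [TSep])"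
      using m(1) unfolding occ_append[of w 0 m "[T1, TSlash]"] by (simp_all add: numeral_2_eq_2)
    then have "occ w 0 2 ([T1] @ [TSlash])" by (simp add: numeral_2_eq_2)
    then have 0: "tok_at w 0 = 2" "tok_at w 1 = 4" unfolding occ_append by (simp_all add: occ_single)
    from r1 have 1: "occ w 2 j1 (nat_enc n)" and "occ w j1 m ([TSep] @ rat_enc t @ [TSep] @ rat_enc a @ [TSep] @ rat_enc b @ [TSep])"
      unfolding occ_append[of w 2] j1_def by simp_all
    then have 2: "tok_at w j1 = 5" and r2: "occ w (j1 + 1) m (rat_enc t @ [TSep] @ rat_enc a @ [TSep] @ rat_enc b @ [TSep])"
      unfolding occ_append[of w j1] by (simp_all add: occ_single)
    from r2 have 3: "occ w (j1 + 1) j2 (rat_enc t)" and "occ w j2 m ([TSep] @ rat_enc a @ [TSep] @ rat_enc b @ [TSep])"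
      unfolding occ_append[of w "j1 + 1"] j2_def by simp_all
    then have 4: "tok_at w j2 = 5" and r3: "occ w (j2 + 1) m (rat_enc a @ [TSep] @ rat_enc b @ [TSep])"
      unfolding occ_append[of w j2] by (simp_all add: occ_single)
    from r3 have 5: "occ w (j2 + 1) j3 (rat_enc a)" and "occ w j3 m ([TSep] @ rat_enc b @ [TSep])"
      unfolding occ_append[of w "j2 + 1"] j3_def by simp_all
    then have 6: "tok_at w j3 = 5" and r4: "occ w (j3 + 1) m (rat_enc b @ [TSep])"
      unfolding occ_append[of w j3] by (simp_all add: occ_single)
    from r4 have 7: "occ w (j3 + 1) j4 (rat_enc b)" and "occ w j4 m [TSep]"
      unfolding occ_append[of w "j3 + 1"] j4_def by simp_all
    then have 8: "tok_at w j4 = 5" "m = j4 + 1" by (simp_all add: occ_single)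
    show ?r using 0 1 2 3 4 5 6 7 8 m(2) by blast
  next
    assume ?r
    then obtain j1 j2 j3 j4 where j: "tok_at w 0 = 2" "tok_at w 1 = 4" "occ w 2 j1 (nat_enc n)" "tok_at w j1 = 5"
      "occ w (j1 + 1) j2 (rat_enc t)" "tok_at w j2 = 5" "occ w (j2 + 1) j3 (rat_enc a)" "tok_at w j3 = 5"
      "occ w (j3 + 1) j4 (rat_enc b)" "tok_at w j4 = 5" "drop (j4 + 1) w = oexp_enc e" by blast
    have s: "occ w i (i + 1) [TSep]" if "tok_at w i = 5" for i using that by (simp add: occ_single)
    have "occ w 0 1 [T1]" "occ w 1 2 [TSlash]" using j(1,2) by (simp_all add: occ_single)
    then have "occ w 0 2 [T1, TSlash]" using occ_trans by fastforce
    from occ_trans[OF this occ_trans[OF j(3) occ_trans[OF s[OF j(4)] occ_trans[OF j(5) occ_trans[OF s[OF j(6)]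
      occ_trans[OF j(7) occ_trans[OF s[OF j(8)] occ_trans[OF j(9) s[OF j(10)]]]]]]]]]
    show "\<exists>m. occ w 0 m ?u \<and> drop m w = oexp_enc e" using j(11) by blast
  qed
  finally show ?thesis unfolding enc .
qed

text \<open>The largest demand on \<open>B\<close> is \<open>4 * Z ^ 6\<close>, from the number of
  pairs in the search; \<open>256 * Z ^ 8\<close> exceeds it with room for all constants.\<close>

lemma power_Z:
  assumes "(2::nat) ^ (8 * (L + 1)) \<le> B" "Z = 2 ^ L"
  shows "256 * Z ^ 8 \<le> B" "1 \<le> Z" "L < Z"
proof -
  have "(2::nat) ^ (8 * (L + 1)) = 2 ^ (8 * L) * 2 ^ 8" unfolding power_add[symmetric] by simp
  also have "(2::nat) ^ (8 * L) = Z ^ 8" unfolding assms(2) power_mult[symmetric] by (simp add: mult.commute)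
  finally show "256 * Z ^ 8 \<le> B" using assms(1) by simp
  show "1 \<le> Z" "L < Z" using assms(2) less_exp[of L] by simp_all
qed

lemma power_le_8: "(1::nat) \<le> Z \<Longrightarrow> i \<le> 8 \<Longrightarrow> Z ^ i \<le> Z ^ 8"
  by (rule power_increasing)

lemma sized_ok:
  assumes "2 ^ (8 * (length w + 1)) \<le> B"
  shows "sized w B (length w)"
proof
  define Z :: nat where "Z = 2 ^ length w"
  note z = power_Z[OF assms Z_def]
  have p: "Z \<le> Z ^ 8" "Z ^ 2 \<le> Z ^ 8" using power_le_8[OF z(2), of 1] power_le_8[OF z(2), of 2] by simp_all
  then show "length w + 2 < B" using z by simp
  have "(2 * length w) * (2 * length w) \<le> (2 * Z) * (2 * Z)" using z(3) by (intro mult_le_mono) auto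
  also have "\<dots> = 4 * Z ^ 2" by (simp add: power2_eq_square)
  finally show "(2 * length w) * (2 * length w) < B" using z p by linarith
  have "(2::nat) ^ (2 * length w) = Z ^ 2" unfolding Z_def power_mult[symmetric] by (simp add: mult.commute)
  then show "2 ^ (2 * length w) \<le> B" using z p by linarith
qed simp

lemma core_iff:
  fixes w :: "token list"
  assumes B: "2 ^ (8 * (length w + 1)) \<le> B" and n: "2 \<le> n" and e: "drop k w = oexp_enc e"
    and lt: "n < Z" "tp < Z" "tn < Z" "td < Z" "ap < Z" "an < Z" "ad < Z" "bp < Z" "bn < Z" "bd < Z"
    and Z: "Z = 2 ^ length w"
    and q: "quotient_of t = (int tp - int tn, int td)" "quotient_of a = (int ap - int an, int ad)"
      "quotient_of b = (int bp - int bn, int bd)"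
  shows "(\<exists>P<B - 1. \<exists>Q<B - 1. eqN B n tp tn td ap an ad bp bn bd P Q \<and> (P * (n - 1)) mod B \<le> (n * Q) mod B \<and>
      accN B (codeN w) (length w) k n Q P) \<longleftrightarrow> (\<exists>x. x \<in> olang e \<and> discounted_sum_is (1 / of_nat n) a b x t)"
proof -
  interpret sized w k B "length w" using sized_ok[OF B] .
  note z = power_Z[OF B Z]
  have p: "1 \<le> Z ^ 8" "Z ^ 4 \<le> Z ^ 8" "Z ^ 5 \<le> Z ^ 8" "Z ^ 6 \<le> Z ^ 8"
    using power_le_8[OF z(2)] z(2) by auto
  define T A C D where "T = (int tp - int tn) * int ad * int bd" and "A = (int ap - int an) * int td * int bd"
    and "C = (int bp - int bn) * int td * int ad" and "D = int td * int ad * int bd"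
  have pos: "0 < td" "0 < ad" "0 < bd" using quotient_of_denom_pos[OF q(1)] quotient_of_denom_pos[OF q(2)] quotient_of_denom_pos[OF q(3)] by auto
  have tab: "t = of_int T / of_int D" "a = of_int A / of_int D" "b = of_int C / of_int D"
    using quotient_of_div[OF q(1)] quotient_of_div[OF q(2)] quotient_of_div[OF q(3)] pos
    by (simp_all add: T_def A_def C_def D_def)
  have D: "0 < D" using pos by (simp add: D_def)
  have "2 * Z ^ 4 \<le> B" using z p by linarith
  note eqn = eqN_iff[OF lt this, of P Q for P Q, folded T_def A_def C_def]
  have eq: "eqN B n tp tn td ap an ad bp bn bd P Q \<longleftrightarrow>
    ((int n - 1) * T - int n * A = int P \<and> (int n - 1) * (C - A) = int Q \<or>
     (int n - 1) * T - int n * A = - int P \<and> (int n - 1) * (C - A) = - int Q)" for P Q using eqn(1) n by simp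
  \<comment> \<open>All overflow conditions of the search in one place: \<open>P\<close> and
    \<open>Q\<close> are below \<open>2 * Z ^ 4\<close>, \<open>n\<close> is below \<open>Z\<close>,
    and there are \<open>Z ^ 2\<close> node sets.\<close>
  have small: "P < B - 1 \<and> Q < B - 1 \<and> (P * (n - 1)) mod B = P * (n - 1) \<and> (n * Q) mod B = n * Q \<and>
      2 * n * Q < B \<and> (2 * Q + 1) * 2 ^ (2 * length w) < B" if "eqN B n tp tn td ap an ad bp bn bd P Q" for P Q
  proof -
    have PQ: "P < 2 * Z ^ 4" "Q < 2 * Z ^ 4" using eqn(2)[OF _ that] n by auto
    have "P * (n - 1) \<le> 2 * Z ^ 4 * Z" using PQ lt(1) by (intro mult_le_mono) auto
    also have "\<dots> = 2 * Z ^ 5" by (simp add: eval_nat_numeral algebra_simps)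
    finally have 1: "P * (n - 1) < B" using z p by linarith
    have "n * Q \<le> Z * (2 * Z ^ 4)" using PQ lt(1) by (intro mult_le_mono) auto
    also have "\<dots> = 2 * Z ^ 5" by (simp add: eval_nat_numeral algebra_simps)
    finally have 2: "n * Q \<le> 2 * Z ^ 5" .
    have "(2 * Q + 1) * 2 ^ (2 * length w) \<le> (4 * Z ^ 4) * Z ^ 2"
    proof (rule mult_le_mono)
      show "2 * Q + 1 \<le> 4 * Z ^ 4" using PQ by linarith
      show "(2::nat) ^ (2 * length w) \<le> Z ^ 2" unfolding Z power_mult[symmetric] by (simp add: mult.commute)
    qed
    also have "\<dots> = 4 * Z ^ 6" by (simp flip: power_add)
    finally have 3: "(2 * Q + 1) * 2 ^ (2 * length w) < B" using z p by linarith
    have "P < B - 1" "Q < B - 1" "n * Q < B" "2 * n * Q < B" using PQ 2 z p by linarith+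
    then show ?thesis using 1 3 by simp
  qed
  have "(\<exists>P<B - 1. \<exists>Q<B - 1. eqN B n tp tn td ap an ad bp bn bd P Q \<and> (P * (n - 1)) mod B \<le> (n * Q) mod B \<and>
      accN B X (length w) k n Q P) \<longleftrightarrow>
    (\<exists>P Q. eqN B n tp tn td ap an ad bp bn bd P Q \<and> (\<exists>x. x \<in> olang e \<and> valid_seq n Q P x))"
  proof
    assume "\<exists>P<B - 1. \<exists>Q<B - 1. eqN B n tp tn td ap an ad bp bn bd P Q \<and> (P * (n - 1)) mod B \<le> (n * Q) mod B \<and>
      accN B X (length w) k n Q P"
    then obtain P Q where PQ: "eqN B n tp tn td ap an ad bp bn bd P Q" "(P * (n - 1)) mod B \<le> (n * Q) mod B"
      "accN B X (length w) k n Q P" by blast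
    have "P * (n - 1) \<le> n * Q" using PQ(2) small[OF PQ(1)] by simp
    then have "\<exists>x. x \<in> olang e \<and> valid_seq n Q P x" using accN_iff[OF e n, of P Q] small[OF PQ(1)] PQ(3) by blast
    then show "\<exists>P Q. eqN B n tp tn td ap an ad bp bn bd P Q \<and> (\<exists>x. x \<in> olang e \<and> valid_seq n Q P x)" using PQ(1) by blast
  next
    assume "\<exists>P Q. eqN B n tp tn td ap an ad bp bn bd P Q \<and> (\<exists>x. x \<in> olang e \<and> valid_seq n Q P x)"
    then obtain P Q x where PQ: "eqN B n tp tn td ap an ad bp bn bd P Q" "x \<in> olang e" "valid_seq n Q P x" by blast
    have le: "P * (n - 1) \<le> n * Q" using PQ(3) valid_seq_iff[OF n] by blast
    then have "accN B X (length w) k n Q P" using accN_iff[OF e n le] small[OF PQ(1)] PQ(2,3) by blast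
    then show "\<exists>P<B - 1. \<exists>Q<B - 1. eqN B n tp tn td ap an ad bp bn bd P Q \<and> (P * (n - 1)) mod B \<le> (n * Q) mod B \<and>
      accN B X (length w) k n Q P"
      using PQ(1) small[OF PQ(1)] le by (intro exI[of _ P] conjI exI[of _ Q]) simp_all
  qed
  also have "\<dots> \<longleftrightarrow> (\<exists>x. x \<in> olang e \<and> discounted_sum_is (1 / of_nat n) a b x t)"
    unfolding discounted_sum_iff[OF n D tab] eq by blast
  finally show ?thesis .
qed

lemma ctdsN_iff:
  assumes B: "2 ^ (8 * (length w + 1)) \<le> B"
  shows "ctdsN B (codeN w) \<longleftrightarrow> w \<in> CTDS_inv_nat_lang"
proof -
  define L where "L = length w"
  define Z :: nat where "Z = 2 ^ length w"
  have sz: "sized w B L" using sized_ok[OF B] by (simp add: L_def)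
  interpret sized w k B L for k using sz .
  have ZB: "Z < B - 1" using Z_less by (simp add: Z_def L_def)
  have Suc: "tok_at w j = 5 \<Longrightarrow> (j + 1) mod B = j + 1" for j using Suc_mod[of j] tok_at_pos[of w j] L_def by simp
  have tokL: "tok_at w j = 5 \<Longrightarrow> j < L" for j using tok_at_pos[of w j] L_def by simp
  \<comment> \<open>Tokens have nonzero codes and positions beyond the input have code 0, so the
    first zero is the length.\<close>
  have len: "tok_at w l = 0 \<and> (\<forall>i<l. tok_at w i \<noteq> 0) \<longleftrightarrow> l = L" for l
  proof -
    have "tok_at w i = 0 \<longleftrightarrow> L \<le> i" for i using tok_at_pos[of w i] L_def by (auto simp: not_less)
    then show ?thesis by (metis le_antisym linorder_not_le order_refl)
  qed
  have L1: "L < B - 1" using BL(1) by simp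
  have rat_less: "p < Z \<and> q < Z \<and> d < Z" if "ratN B X i j p q d" for i j p q d
  proof -
    have "\<exists>c c'. natN B X c c' p \<or> p = 0" "\<exists>c c'. natN B X c c' q \<or> q = 0" "\<exists>c c'. natN B X c c' d"
      using that unfolding ratN_def intN_def by blast+
    moreover have "natN B X c c' m \<Longrightarrow> m < Z" for c c' m unfolding natN_iff using occ_nat_less by (simp add: Z_def L_def)
    moreover have "0 < Z" by (simp add: Z_def)
    ultimately show ?thesis by metis
  qed
  have nat_less: "m < Z" if "occ w i j (nat_enc m)" for i j m using occ_nat_less[OF that] by (simp add: Z_def L_def)
  have pn: "\<exists>p q. z = int p - int q \<and> (p = 0 \<or> q = 0)" for z
    by (rule exI[of _ "nat z"], rule exI[of _ "nat (- z)"]) auto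
  have split: "\<exists>p q d. quotient_of r = (int p - int q, int d) \<and> (p = 0 \<or> q = 0)" for r
  proof -
    obtain z d where zd: "quotient_of r = (z, d)" by fastforce
    then have "d = int (nat d)" using quotient_of_denom_pos by fastforce
    then show ?thesis using zd pn[of z] by metis
  qed
  show ?thesis
  proof
    assume "ctdsN B X"
    then obtain l j1 j2 j3 j4 n tp tn td ap an ad bp bn bd where
      l: "tok_at w l = 0 \<and> (\<forall>i<l. tok_at w i \<noteq> 0)" and t01: "tok_at w 0 = 2" "tok_at w 1 = 4" and
      j: "tok_at w j1 = 5" "tok_at w j2 = 5" "tok_at w j3 = 5" "tok_at w j4 = 5" and
      e: "oexpN B X l ((j4 + 1) mod B)" and n: "natN B X 2 j1 n" "2 \<le> n" and
      r: "ratN B X ((j1 + 1) mod B) j2 tp tn td" "ratN B X ((j2 + 1) mod B) j3 ap an ad" "ratN B X ((j3 + 1) mod B) j4 bp bn bd" and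
      acc: "\<exists>P<B - 1. \<exists>Q<B - 1. eqN B n tp tn td ap an ad bp bn bd P Q \<and> (P * (n - 1)) mod B \<le> (n * Q) mod B \<and>
           accN B X l ((j4 + 1) mod B) n Q P"
      unfolding ctdsN_def tokN_codeN by blast
    have lL: "l = L" using l len by blast
    obtain e' where e': "drop (j4 + 1) w = oexp_enc e'" using e unfolding lL Suc[OF j(4)] oexpN_iff by blast
    obtain t where t: "quotient_of t = (int tp - int tn, int td)" "occ w (j1 + 1) j2 (rat_enc t)"
      using r(1) unfolding Suc[OF j(1)] ratN_iff by blast
    obtain a where a: "quotient_of a = (int ap - int an, int ad)" "occ w (j2 + 1) j3 (rat_enc a)"
      using r(2) unfolding Suc[OF j(2)] ratN_iff by blast
    obtain b where b: "quotient_of b = (int bp - int bn, int bd)" "occ w (j3 + 1) j4 (rat_enc b)"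
      using r(3) unfolding Suc[OF j(3)] ratN_iff by blast
    have n': "occ w 2 j1 (nat_enc n)" using n(1) unfolding natN_iff .
    have w: "w = CTDS_enc (1 / of_nat n) t a b e'"
      unfolding CTDS_enc_occ[OF n(2)] using t01 n' j t(2) a(2) b(2) e' by blast
    have "\<exists>x. x \<in> olang e' \<and> discounted_sum_is (1 / of_nat n) a b x t"
      using core_iff[OF B n(2) e' nat_less[OF n'] _ _ _ _ _ _ _ _ _ Z_def t(1) a(1) b(1)] acc rat_less[OF r(1)] rat_less[OF r(2)] rat_less[OF r(3)]
      unfolding lL L_def Suc[OF j(4)] by blast
    then show "w \<in> CTDS_inv_nat_lang" unfolding CTDS_lang_iff using w n(2) by blast
  next
    assume "w \<in> CTDS_inv_nat_lang"
    then obtain n t a b e where n: "2 \<le> n" and w: "w = CTDS_enc (1 / of_nat n) t a b e"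
      and x: "\<exists>x. x \<in> olang e \<and> discounted_sum_is (1 / of_nat n) a b x t" unfolding CTDS_lang_iff by blast
    obtain j1 j2 j3 j4 where t01: "tok_at w 0 = 2" "tok_at w 1 = 4" and n': "occ w 2 j1 (nat_enc n)"
      and j: "tok_at w j1 = 5" "tok_at w j2 = 5" "tok_at w j3 = 5" "tok_at w j4 = 5"
      and o: "occ w (j1 + 1) j2 (rat_enc t)" "occ w (j2 + 1) j3 (rat_enc a)" "occ w (j3 + 1) j4 (rat_enc b)"
      and e: "drop (j4 + 1) w = oexp_enc e" using w unfolding CTDS_enc_occ[OF n] by blast
    obtain tp tn td where t: "quotient_of t = (int tp - int tn, int td)" "tp = 0 \<or> tn = 0" using split by blast
    obtain ap an ad where a: "quotient_of a = (int ap - int an, int ad)" "ap = 0 \<or> an = 0" using split by blast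
    obtain bp bn bd where b: "quotient_of b = (int bp - int bn, int bd)" "bp = 0 \<or> bn = 0" using split by blast
    have r: "ratN B X ((j1 + 1) mod B) j2 tp tn td" "ratN B X ((j2 + 1) mod B) j3 ap an ad" "ratN B X ((j3 + 1) mod B) j4 bp bn bd"
      unfolding Suc[OF j(1)] Suc[OF j(2)] Suc[OF j(3)] ratN_iff using t a b o by blast+
    have lt: "n < Z" "tp < Z" "tn < Z" "td < Z" "ap < Z" "an < Z" "ad < Z" "bp < Z" "bn < Z" "bd < Z"
      using nat_less[OF n'] rat_less[OF r(1)] rat_less[OF r(2)] rat_less[OF r(3)] by auto
    have ltB: "n < B - 1" "tp < B - 1" "tn < B - 1" "td < B - 1" "ap < B - 1" "an < B - 1" "ad < B - 1"
      "bp < B - 1" "bn < B - 1" "bd < B - 1" using lt ZB by linarith+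
    have acc: "\<exists>P<B - 1. \<exists>Q<B - 1. eqN B n tp tn td ap an ad bp bn bd P Q \<and> (P * (n - 1)) mod B \<le> (n * Q) mod B \<and>
           accN B X L ((j4 + 1) mod B) n Q P"
      using core_iff[OF B n e lt Z_def t(1) a(1) b(1)] x unfolding L_def Suc[OF j(4)] by blast
    have e': "oexpN B X L ((j4 + 1) mod B)" unfolding Suc[OF j(4)] oexpN_iff using e by blast
    have l: "tok_at w L = 0" "\<forall>i<L. tok_at w i \<noteq> 0" using len[of L] by auto
    have n'': "natN B X 2 j1 n" unfolding natN_iff by (rule n')
    show "ctdsN B X" unfolding ctdsN_def tokN_codeN
      apply (rule exI[of _ L], intro conjI L1 l t01)
      apply (rule exI[of _ j1], rule conjI[OF tokL[OF j(1)]], rule exI[of _ j2], rule conjI[OF tokL[OF j(2)]])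
      apply (rule exI[of _ j3], rule conjI[OF tokL[OF j(3)]], rule exI[of _ j4], rule conjI[OF tokL[OF j(4)]])
      apply (intro conjI j e')
      apply (rule exI[of _ n], intro conjI ltB n'' n)
      apply (rule exI[of _ tp], rule conjI[OF ltB(2)], rule exI[of _ tn], rule conjI[OF ltB(3)], rule exI[of _ td], rule conjI[OF ltB(4)])
      apply (rule conjI[OF r(1)])
      apply (rule exI[of _ ap], rule conjI[OF ltB(5)], rule exI[of _ an], rule conjI[OF ltB(6)], rule exI[of _ ad], rule conjI[OF ltB(7)])
      apply (rule conjI[OF r(2)])
      apply (rule exI[of _ bp], rule conjI[OF ltB(8)], rule exI[of _ bn], rule conjI[OF ltB(9)], rule exI[of _ bd], rule conjI[OF ltB(10)])
      apply (rule conjI[OF r(3)])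
      apply (rule acc)
      done
  qed
qed

section \<open>Reduction to the input registers\<close>

text \<open>Undoes the bit slicing of the input registers.\<close>

definition tok4 :: "(nat \<Rightarrow> nat) \<Rightarrow> nat \<Rightarrow> nat" where
  "tok4 \<rho> q = (if bit (\<rho> 0) q then 1 else 0) + (if bit (\<rho> 1) q then 2 else 0) +
     (if bit (\<rho> 2) q then 4 else 0) + (if bit (\<rho> 3) q then 8 else 0)"

lemma tok4_input_reg: "tok4 (\<lambda>i. input_reg w (if i < 4 then i else 0)) q = tok_at w q"
proof (cases "q < length w")
  case True
  have "(if bit (tok_code t) 0 then 1 else 0) + (if bit (tok_code t) 1 then 2 else 0) +
     (if bit (tok_code t) 2 then 4 else 0) + (if bit (tok_code t) 3 then 8 else 0) = tok_code t" for t
    by (cases t) (simp_all add: bit_iff_odd)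
  then show ?thesis using True by (simp add: tok4_def bit_input_reg tok_at_def)
qed (simp add: tok4_def bit_input_reg tok_at_def)

lemma psp_add_less:
  assumes "psp f" "psp g" "\<And>B \<rho>. 1024 \<le> B \<Longrightarrow> f B \<rho> + g B \<rho> < B"
  shows "psp (\<lambda>B \<rho>. f B \<rho> + g B \<rho>)"
  by (rule psp_cong[OF psp_add[OF assms(1,2)]]) (simp add: assms(3))

lemma psp_tok4: "psp f \<Longrightarrow> (\<And>i. psp (F i)) \<Longrightarrow> psp (\<lambda>B \<rho>. tok4 (\<lambda>i. F i B \<rho>) (f B \<rho>))"
  unfolding tok4_def by (intro psp_add_less psp_intros) simp_all

lemma digit_sum:
  assumes "length w < N" "\<And>q. f q = tok_at w q"
  shows "(\<Sum>q<N. 16 ^ q * f q) = codeN w"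
proof -
  have "(\<Sum>q<N. 16 ^ q * f q) = (\<Sum>q<length w. 16 ^ q * f q)"
    using assms by (intro sum.mono_neutral_right) (auto simp: tok_at_def)
  then show ?thesis by (simp add: codeN_def assms(2) tok_at_def)
qed

text \<open>An unconstrained instance is the constrained one for the expression \<open>(a + b)\<^sup>\<omega>\<close>, whose code is
  appended to the input.\<close>

definition all_words :: oexp where
  "all_words = Omega (RPlus (RSym La) (RSym Lb))"

lemma olang_all_words: "olang all_words = UNIV"
proof -
  have "x \<in> olang all_words" for x
  proof -
    have "strict_mono (\<lambda>i::nat. i)" by (simp add: strict_mono_def)
    moreover have "map x [i..<Suc i] \<in> lang (RPlus (RSym La) (RSym Lb))" for i by (cases "x i") auto
    ultimately show ?thesis unfolding all_words_def olang.simps by (intro CollectI exI[of _ "\<lambda>i. i"]) blast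
  qed
  then show ?thesis by blast
qed

definition all_suffix :: "token list" where
  "all_suffix = TSep # oexp_enc all_words"

lemma all_suffix_eq: "all_suffix = [TSep, TOmega, TPlus, TA, TB]"
  by (simp add: all_suffix_def all_words_def)

lemma TSep_oexp: "TSep \<notin> set (oexp_enc e)"
proof -
  have "TSep \<notin> set (rexp_enc r)" for r by (induction r rule: rexp_enc.induct) auto
  then show ?thesis by (induction e) auto
qed

text \<open>An encoded omega expression contains no separator, so the last separator shows where the
  expression starts, and an appended expression can be split off again.\<close>

lemma last_sep:
  assumes "u @ x # v = u' @ x # v'" "x \<notin> set v" "x \<notin> set v'"
  shows "u = u'"
proof -
  obtain us where "u = u' @ us \<and> us @ x # v = x # v' \<or> u @ us = u' \<and> x # v = us @ x # v'"
    using assms(1) unfolding append_eq_append_conv2 by blast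
  then show ?thesis using assms(2,3) by (cases us) auto
qed

lemma TDS_iff_CTDS: "w \<in> TDS_inv_nat_lang \<longleftrightarrow> w @ all_suffix \<in> CTDS_inv_nat_lang"
proof
  assume "w \<in> TDS_inv_nat_lang"
  then obtain lam t a b where w: "w = TDS_enc lam t a b" and lam: "\<exists>n::nat. n \<ge> 2 \<and> lam = 1 / of_nat n" and "TDS_yes lam t a b"
    unfolding TDS_inv_nat_lang_def by blast
  then have "CTDS_yes lam t a b all_words" by (auto simp: TDS_yes_def CTDS_yes_def olang_all_words)
  moreover have "w @ all_suffix = CTDS_enc lam t a b all_words" using w by (simp add: CTDS_enc_def all_suffix_def)
  ultimately show "w @ all_suffix \<in> CTDS_inv_nat_lang" unfolding CTDS_inv_nat_lang_def using lam by blast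
next
  assume "w @ all_suffix \<in> CTDS_inv_nat_lang"
  then obtain lam t a b e where w: "w @ all_suffix = CTDS_enc lam t a b e" and lam: "\<exists>n::nat. n \<ge> 2 \<and> lam = 1 / of_nat n"
    and yes: "CTDS_yes lam t a b e" unfolding CTDS_inv_nat_lang_def by blast
  have "w = TDS_enc lam t a b"
    using last_sep[of w TSep "oexp_enc all_words" "TDS_enc lam t a b" "oexp_enc e"] w TSep_oexp
    by (simp add: all_suffix_def CTDS_enc_def)
  moreover have "TDS_yes lam t a b" using yes by (auto simp: TDS_yes_def CTDS_yes_def)
  ultimately show "w \<in> TDS_inv_nat_lang" unfolding TDS_inv_nat_lang_def using lam by blast
qed

text \<open>Position \<open>q\<close> is \<open>d\<close> places after the end of the nonempty word with token codes \<open>h\<close>.\<close>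

definition after_end :: "(nat \<Rightarrow> nat) \<Rightarrow> nat \<Rightarrow> nat \<Rightarrow> bool" where
  "after_end h d q \<longleftrightarrow> h (q - (d + 1)) \<noteq> 0 \<and> h (q - d) = 0"

text \<open>For \<open>q \<le> d\<close> both truncated differences are 0 and the two conditions
  contradict each other, so no position near the start qualifies by accident.\<close>

lemma after_end_iff:
  assumes "w \<noteq> []" shows "after_end (tok_at w) d q \<longleftrightarrow> q = length w + d"
proof -
  have z: "tok_at w i = 0 \<longleftrightarrow> length w \<le> i" for i using tok_at_pos[of w i] by auto
  have "0 < length w" using assms by simp
  then show ?thesis unfolding after_end_def z by linarith
qed

text \<open>The codes 5, 13, 10, 6, 7 spell \<open>all_suffix\<close>, which is added only while the
  number that codes the input is formed.\<close>

definition suffixed :: "(nat \<Rightarrow> nat) \<Rightarrow> nat \<Rightarrow> nat" where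
  "suffixed h q = (if after_end h 0 q then 5 else if after_end h 1 q then 13 else if after_end h 2 q then 10
     else if after_end h 3 q then 6 else if after_end h 4 q then 7 else h q)"

lemma suffixed_tok_at:
  assumes "w \<noteq> []" shows "suffixed (tok_at w) q = tok_at (w @ all_suffix) q"
proof (cases "q < length w \<or> length w + 5 \<le> q")
  case True
  then show ?thesis unfolding suffixed_def after_end_iff[OF assms] by (auto simp: tok_at_def all_suffix_eq nth_append)
next
  case False
  then have "q - length w \<in> {0, 1, 2, 3, 4}" by auto
  then have "q \<in> {length w, length w + 1, length w + 2, length w + 3, length w + 4}" using False by auto
  then show ?thesis unfolding suffixed_def after_end_iff[OF assms] by (auto simp: tok_at_def all_suffix_eq nth_append)
qed

text \<open>Why 64: for a nonempty word \<open>2 ^ (64 * length w)\<close> is at least 1024, and it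
  dominates \<open>2 ^ (8 * (length w + 6))\<close>, which \<open>ctdsN_iff\<close> requires of an
  input extended by five tokens.\<close>

lemma in_PSPACE_psp:
  assumes f: "pspP f" and L: "\<And>w. w \<in> Lg \<Longrightarrow> w \<noteq> []"
    and eq: "\<And>w. w \<noteq> [] \<Longrightarrow> f (2 ^ (64 * length w)) (\<lambda>i. input_reg w (if i < 4 then i else 0)) \<longleftrightarrow> w \<in> Lg"
  shows "in_PSPACE Lg"
proof -
  obtain t where t: "\<And>B \<rho>. 1024 \<le> B \<Longrightarrow> \<forall>i. \<rho> i < B \<Longrightarrow> eval B t \<rho> = of_bool (f B \<rho>)"
    using f by (rule pspE) blast
  have "eval (2 ^ ((63 + 1) * length w)) t (\<lambda>i. input_reg w (if i < 4 then i else 0)) \<noteq> 0 \<longleftrightarrow> w \<in> Lg" if w: "w \<noteq> []" for w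
  proof -
    have "1 \<le> length w" using w by (cases w) auto
    then have "10 \<le> 64 * length w" by linarith
    then have "(2::nat) ^ 10 \<le> 2 ^ (64 * length w)" by (intro power_increasing) auto
    then have B: "1024 \<le> (2::nat) ^ (64 * length w)" by simp
    have "input_reg w v < 2 ^ (64 * length w)" for v
    proof -
      have "take_bit (64 * length w) (input_reg w v) = input_reg w v"
        by (rule bit_eqI) (auto simp: bit_take_bit_iff bit_input_reg)
      then show ?thesis by (simp only: take_bit_nat_eq_self_iff)
    qed
    then have "eval (2 ^ (64 * length w)) t (\<lambda>i. input_reg w (if i < 4 then i else 0)) =
        of_bool (f (2 ^ (64 * length w)) (\<lambda>i. input_reg w (if i < 4 then i else 0)))"
      using t[OF B, of "\<lambda>i. input_reg w (if i < 4 then i else 0)"] by simp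
    then show ?thesis using eq[OF w] by simp
  qed
  then have "Lg = {w. w \<noteq> [] \<and> eval (2 ^ ((63 + 1) * length w)) t (\<lambda>i. input_reg w (if i < 4 then i else 0)) \<noteq> 0}"
    using L by blast
  then show ?thesis using in_PSPACE_trm[of 63 t] by simp
qed

text \<open>The sum runs over \<open>B - 1\<close> positions because the length is not known yet;
  digits beyond the word are 0. The factor 7 leaves room for five more tokens, and four bits per
  token then need 28 of the 64 bits available per input token.\<close>

lemma codeN_mod:
  assumes "w \<noteq> []" "length u \<le> 7 * length w" "\<And>q. f q = tok_at u q"
  defines "B \<equiv> 2 ^ (64 * length w)"
  shows "(\<Sum>q<B - 1. 16 ^ q * f q) mod B = codeN u"
proof -
  have n: "1 \<le> length w" using assms(1) by (cases w) auto
  have "length u < 64 * length w - 1" using assms(2) n by linarith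
  moreover have "64 * length w < B" unfolding B_def by (rule less_exp)
  ultimately have "length u < B - 1" by linarith
  then have "(\<Sum>q<B - 1. 16 ^ q * f q) = codeN u" by (rule digit_sum) (rule assms(3))
  moreover have "codeN u < B"
  proof -
    have "(16::nat) ^ length u = 2 ^ (4 * length u)" by (simp add: power_mult)
    also have "\<dots> \<le> B" unfolding B_def using assms(2) by (intro power_increasing) auto
    finally show ?thesis using codeN_less[of u] by linarith
  qed
  ultimately show ?thesis by simp
qed

theorem theorem15:
  shows "in_PSPACE TDS_inv_nat_lang \<and> in_PSPACE CTDS_inv_nat_lang"
proof
  let ?\<rho> = "\<lambda>w i. input_reg w (if i < (4::nat) then i else 0)"
  have h: "tok4 (?\<rho> w) = tok_at w" for w using tok4_input_reg by blast
  have ne: "w \<in> CTDS_inv_nat_lang \<Longrightarrow> w \<noteq> []" "w \<in> TDS_inv_nat_lang \<Longrightarrow> w \<noteq> []" for w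
    unfolding CTDS_inv_nat_lang_def TDS_inv_nat_lang_def CTDS_enc_def TDS_enc_def by auto
  show "in_PSPACE CTDS_inv_nat_lang"
  proof (rule in_PSPACE_psp)
    show "pspP (\<lambda>B \<rho>. ctdsN B ((\<Sum>q<B - 1. 16 ^ q * tok4 \<rho> q) mod B))"
      by (intro psp_ctdsN psp_digits psp_top psp_tok4 psp_var) simp
    fix w :: "token list" assume w: "w \<noteq> []"
    then have "1 \<le> length w" by (cases w) auto
    then have "8 * (length w + 1) \<le> 64 * length w" by simp
    then have "(2::nat) ^ (8 * (length w + 1)) \<le> 2 ^ (64 * length w)" by (rule power_increasing) simp
    moreover have "(\<Sum>q<2 ^ (64 * length w) - 1. 16 ^ q * tok4 (?\<rho> w) q) mod 2 ^ (64 * length w) = codeN w"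
      unfolding h by (rule codeN_mod[OF w]) simp_all
    ultimately show "ctdsN (2 ^ (64 * length w)) ((\<Sum>q<2 ^ (64 * length w) - 1. 16 ^ q * tok4 (?\<rho> w) q) mod 2 ^ (64 * length w))
        \<longleftrightarrow> w \<in> CTDS_inv_nat_lang"
      using ctdsN_iff by simp
  qed (rule ne)
  show "in_PSPACE TDS_inv_nat_lang"
  proof (rule in_PSPACE_psp)
    show "pspP (\<lambda>B \<rho>. ctdsN B ((\<Sum>q<B - 1. 16 ^ q * suffixed (tok4 \<rho>) q) mod B))"
      unfolding suffixed_def after_end_def
      by (intro psp_ctdsN psp_digits psp_top psp_intros psp_tok4) (simp_all add: psp_const)
    fix w :: "token list" assume w: "w \<noteq> []"
    then have n: "1 \<le> length w" by (cases w) auto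
    then have "8 * (length (w @ all_suffix) + 1) \<le> 64 * length w" by (simp add: all_suffix_eq)
    then have "(2::nat) ^ (8 * (length (w @ all_suffix) + 1)) \<le> 2 ^ (64 * length w)" by (rule power_increasing) simp
    moreover have "(\<Sum>q<2 ^ (64 * length w) - 1. 16 ^ q * suffixed (tok4 (?\<rho> w)) q) mod 2 ^ (64 * length w) = codeN (w @ all_suffix)"
      unfolding h using n by (intro codeN_mod[OF w]) (simp_all add: suffixed_tok_at[OF w] all_suffix_eq)
    ultimately show "ctdsN (2 ^ (64 * length w)) ((\<Sum>q<2 ^ (64 * length w) - 1. 16 ^ q * suffixed (tok4 (?\<rho> w)) q) mod 2 ^ (64 * length w))
        \<longleftrightarrow> w \<in> TDS_inv_nat_lang"
      using ctdsN_iff[of "w @ all_suffix"] TDS_iff_CTDS[of w] by simp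
  qed (rule ne)
qed

end
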